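(* Let $\mathcal{X}$ be $\mathbb{T}^n$ or $\mathbb{R}^n$, let $\mathcal{T}\subset[0,1]$ be measurable, let $\pi\in\mathrm{P}(\mathcal{X}^2)$, let $\mu=(\mu_t)_{t\in\mathcal{T}}$ be a family of probability measures on $\mathcal{X}$ such that $t\in\mathcal{T}\mapsto\mu_t\in\mathrm{P}(\mathcal{X})$ is weakly continuous, and let $\alpha\in\mathrm{P}(\mathcal{T})$ be a probability measure with $\operatorname{supp}\alpha=\mathcal{T}$. Then $$\inf\{H(Q|R):\ Q\in\mathrm{P}(\Omega),\ Q_t=\mu_t\ \forall t\in\mathcal{T},\ Q_{01}=\pi\}=H(\mu_0|R_0)+J(\mu,\pi).$$ Moreover, for any class of functions $\mathcal{A}$ dense in $B(\mathcal{T}\times\mathcal{X})\times B(\mathcal{X}^2)$ with respect to the pointwise convergence, the dual equality is $$J(\mu,\pi)=\sup_{(p,\eta)\in\mathcal{A}}\Big\{\int_{\mathcal{T}\times\mathcal{X}}p\,d\mu^\alpha+\int_{\mathcal{X}^2}\eta\,d\pi-\int_{\mathcal{X}}\log E_{R^x}\exp\Big(\int_{\mathcal{T}}p(t,X_t)\,\alpha(dt)+\eta(x,X_1)\Big)\,\mu_0(dx)\Big\},$$ where $\mu^\alpha(dt\,dx):=\alpha(dt)\,\mu_t(dx)$.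
   Context: $\mathcal{X}$ is the flat torus $\mathbb{T}^n=\mathbb{R}^n/[0,1]^n$ or $\mathbb{R}^n$, and $\mathrm{vol}$ is its volume measure (normalized to a probability measure on $\mathbb{T}^n$, Lebesgue measure on $\mathbb{R}^n$). $\Omega=C([0,1],\mathcal{X})$ with canonical process $X_t(\omega)=\omega_t$ and the $\sigma$-field it generates. $\mathrm{P}(\cdot)$ and $\mathrm{M}(\cdot)$ are the sets of probability and of positive measures. For a measure $Q$ on $\Omega$, $Q_t=(X_t)_\#Q$ and $Q_{01}=(X_0,X_1)_\#Q$. Fix $a>0$. $R^x\in\mathrm{P}(\Omega)$ is the law of $x+\sqrt a\,B$, where $B$ is a standard Brownian motion on $\mathcal{X}$ started at $0$, and $R=\int_{\mathcal{X}}R^x(\cdot)\,\mathrm{vol}(dx)\in\mathrm{M}(\Omega)$ (reversible Brownian motion; $R_0=\mathrm{vol}$). The relative entropy is $H(\mathsf q|\mathsf r)=\int\log(d\mathsf q/d\mathsf r)\,d\mathsf q\in(-\infty,\infty]$, defined when $\mathsf q\ll\mathsf r$ and $\int\log_-(d\mathsf q/d\mathsf r)\,d\mathsf q<\infty$, with $H(\mathsf q|\mathsf r)=+\infty$ when $\mathsf q\not\ll\mathsf r$. The infimum of the empty set is $+\infty$. $\mu_0\in\mathrm{P}(\mathcal{X})$ is the prescribed initial marginal; if $0\notin\mathcal{T}$ it is $\mu_0:=\pi(\cdot\times\mathcal{X})$. It is understood that $H(\mu_0|R_0)$ is meaningful in $(-\infty,\infty]$. Set $R^{\mu_0}:=\int_{\mathcal{X}}R^x(\cdot)\,\mu_0(dx)$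 and $$J(\mu,\pi):=\inf\{H(Q|R^{\mu_0}):\ Q\in\mathrm{P}(\Omega),\ Q_t=\mu_t\ \forall t\in\mathcal{T},\ Q_{01}=\pi\}.$$ $B(\mathcal{T}\times\mathcal{X})$ and $B(\mathcal{X}^2)$ are the spaces of bounded measurable real functions on $\mathcal{T}\times\mathcal{X}$ and $\mathcal{X}^2$.
   Formalization: "Dense with respect to the pointwise convergence" is taken as: the closure of A under iterated pointwise limits of uniformly bounded sequences is all of B(T×X)×B(X²). Without boundedness the dual equality fails, e.g. for finitely supported functions when μ_t and π have no atoms. *)

theory Defs
  imports "HOL-Probability.Probability"
begin

section \<open>The state space\<close>

text \<open>
  The flat torus is modelled on the representatives \<open>[0,1)\<^sup>n\<close> of the cosets of the integer
  lattice, with the topology that makes reduction modulo the lattice a quotient map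
  (see \<open>quotient_map_torus_proj\<close>).
\<close>

definition torus_proj :: "real ^ 'n \<Rightarrow> real ^ 'n" where
  "torus_proj x = (\<chi> i. frac (x $ i))"

definition flat_torus :: "(real ^ 'n) topology" where
  "flat_torus = topology (\<lambda>U. U \<subseteq> range torus_proj \<and> open (torus_proj -` U))"

lemma openin_flat_torus:
  fixes U :: "(real ^ 'n) set"
  shows "openin flat_torus U \<longleftrightarrow> U \<subseteq> range torus_proj \<and> open (torus_proj -` U)"
proof -
  have "istopology (\<lambda>U. U \<subseteq> range torus_proj \<and> open (torus_proj -` U :: (real ^ 'n) set))"
    unfolding istopology_def by (auto simp: vimage_Union)
  then show ?thesis
    by (simp only: flat_torus_def topology_inverse')
qed

lemma topspace_flat_torus: "topspace flat_torus = range torus_proj"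
  unfolding topspace_def openin_flat_torus by (auto intro!: exI[of _ "range torus_proj"] simp: vimage_def)

lemma range_torus_proj: "range torus_proj = {x. \<forall>i. 0 \<le> x $ i \<and> x $ i < 1}"
proof -
  have "x = torus_proj x" if "\<forall>i. 0 \<le> x $ i \<and> x $ i < 1" for x :: "real ^ 'n"
    using that by (simp add: torus_proj_def vec_eq_iff frac_eq)
  then show ?thesis
    by (auto simp: torus_proj_def frac_lt_1)
qed

lemma quotient_map_torus_proj: "quotient_map euclidean flat_torus torus_proj"
  unfolding quotient_map_def by (auto simp: topspace_flat_torus openin_flat_torus vimage_def)

datatype flat_space = Torus | Euclidean

definition topo :: "flat_space \<Rightarrow> (real ^ 'n) topology" where
  "topo X = (case X of Torus \<Rightarrow> flat_torus | Euclidean \<Rightarrow> euclidean)"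

definition proj :: "flat_space \<Rightarrow> real ^ 'n \<Rightarrow> real ^ 'n" where
  "proj X = (case X of Torus \<Rightarrow> torus_proj | Euclidean \<Rightarrow> id)"

definition borelX :: "flat_space \<Rightarrow> (real ^ 'n) measure" where
  "borelX X = sigma (topspace (topo X)) {U. openin (topo X) U}"

definition vol :: "flat_space \<Rightarrow> (real ^ 'n) measure" where
  "vol X = (case X of
      Torus \<Rightarrow> distr (uniform_measure lborel (cbox 0 1)) (borelX Torus) torus_proj
    | Euclidean \<Rightarrow> lborel)"

section \<open>Path space\<close>

text \<open>A path is a function on \<open>[0,1]\<close>, extended by \<open>undefined\<close> outside of the unit interval.\<close>

definition paths :: "flat_space \<Rightarrow> (real \<Rightarrow> real ^ 'n) set" where
  "paths X = {\<omega> \<in> extensional {0..1}. continuous_map (top_of_set {0..1}) (topo X) \<omega>}"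

definition path_space :: "flat_space \<Rightarrow> (real \<Rightarrow> real ^ 'n) measure" where
  "path_space X = restrict_space (\<Pi>\<^sub>M t\<in>{0..1}. borelX X) (paths X)"

definition marg :: "flat_space \<Rightarrow> (real \<Rightarrow> real ^ 'n) measure \<Rightarrow> real \<Rightarrow> (real ^ 'n) measure" where
  "marg X Q t = distr Q (borelX X) (\<lambda>\<omega>. \<omega> t)"

definition marg01 ::
    "flat_space \<Rightarrow> (real \<Rightarrow> real ^ 'n) measure \<Rightarrow> ((real ^ 'n) \<times> (real ^ 'n)) measure" where
  "marg01 X Q = distr Q (borelX X \<Otimes>\<^sub>M borelX X) (\<lambda>\<omega>. (\<omega> 0, \<omega> 1))"

section \<open>Brownian motion\<close>

text \<open>
  Standard Brownian motion on \<open>[0,1]\<close> with values in Euclidean space, started at \<open>0\<close>, on a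
  probability space \<open>M\<close>; all sample paths are required to be continuous.
\<close>

definition standard_bm :: "'w measure \<Rightarrow> (real \<Rightarrow> 'w \<Rightarrow> real ^ 'n) \<Rightarrow> bool" where
  "standard_bm M B \<longleftrightarrow>
     prob_space M \<and>
     (\<forall>t\<in>{0..1}. B t \<in> borel_measurable M) \<and>
     (\<forall>\<omega>\<in>space M. B 0 \<omega> = 0 \<and> continuous_on {0..1} (\<lambda>t. B t \<omega>)) \<and>
     (\<forall>s t. 0 \<le> s \<and> s < t \<and> t \<le> 1 \<longrightarrow>
        distributed M lborel (\<lambda>\<omega>. B t \<omega> - B s \<omega>)
          (\<lambda>x. ennreal (\<Prod>i\<in>UNIV. normal_density 0 (sqrt (t - s)) (x $ i)))) \<and>
     (\<forall>k (\<tau> :: nat \<Rightarrow> real). 0 \<le> \<tau> 0 \<and> (\<forall>i<k. \<tau> i < \<tau> (Suc i)) \<and> \<tau> k \<le> 1 \<longrightarrow>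
        prob_space.indep_vars M (\<lambda>_. borel) (\<lambda>i \<omega>. B (\<tau> (Suc i)) \<omega> - B (\<tau> i) \<omega>) {..<k})"

text \<open>
  The law \<open>R\<^sup>x\<close> of \<open>x + \<surd>a B\<close>. Brownian motion on the torus is the projection of Brownian
  motion on Euclidean space. The law does not depend on the choice of \<open>(M, B)\<close>.
\<close>

definition bm_law ::
    "flat_space \<Rightarrow> real \<Rightarrow> 'w measure \<Rightarrow> (real \<Rightarrow> 'w \<Rightarrow> real ^ 'n) \<Rightarrow> real ^ 'n \<Rightarrow>
      (real \<Rightarrow> real ^ 'n) measure" where
  "bm_law X a M B x =
     distr M (path_space X) (\<lambda>\<omega>. \<lambda>t\<in>{0..1}. proj X (x + sqrt a *\<^sub>R B t \<omega>))"

text \<open>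
  The mixture of the laws \<open>R\<^sup>x\<close> under a measure \<open>m\<close> on the state space. The library's \<open>bind\<close>
  integrates kernels also against measures of infinite mass, such as Lebesgue measure.
\<close>

definition bm_mix ::
    "flat_space \<Rightarrow> real \<Rightarrow> 'w measure \<Rightarrow> (real \<Rightarrow> 'w \<Rightarrow> real ^ 'n) \<Rightarrow> (real ^ 'n) measure \<Rightarrow>
      (real \<Rightarrow> real ^ 'n) measure" where
  "bm_mix X a M B m = m \<bind> bm_law X a M B"

section \<open>Relative entropy\<close>

definition entropy_meaningful :: "'a measure \<Rightarrow> 'a measure \<Rightarrow> bool" where
  "entropy_meaningful q r \<longleftrightarrow>
     (absolutely_continuous r q \<longrightarrow>
        (\<integral>\<^sup>+x. ennreal (- entropy_density (exp 1) r q x) \<partial>q) < \<infinity>)"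

text \<open>
  The library's \<open>KL_divergence\<close> is real-valued, hence useless when the integral diverges.
  Below, the integral of the logarithm is the difference of the integrals of its positive and
  negative parts (\<open>ennreal\<close> truncates at \<open>0\<close>). The value is significant only
  under \<open>entropy_meaningful q r\<close>.
\<close>

definition rel_entropy :: "'a measure \<Rightarrow> 'a measure \<Rightarrow> ereal" where
  "rel_entropy q r =
     (if absolutely_continuous r q
      then enn2ereal (\<integral>\<^sup>+x. ennreal (entropy_density (exp 1) r q x) \<partial>q)
           - enn2ereal (\<integral>\<^sup>+x. ennreal (- entropy_density (exp 1) r q x) \<partial>q)
      else \<infinity>)"

section \<open>The entropic problem\<close>

definition weakly_continuous_on ::
    "flat_space \<Rightarrow> real set \<Rightarrow> (real \<Rightarrow> (real ^ 'n) measure) \<Rightarrow> bool" where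
  "weakly_continuous_on X T \<mu> \<longleftrightarrow>
     (\<forall>f. continuous_map (topo X) euclideanreal f \<and> bounded (f ` topspace (topo X)) \<longrightarrow>
        continuous_on T (\<lambda>t. \<integral>x. f x \<partial>\<mu> t))"

text \<open>The topological support, relative to the subspace topology of \<open>space \<alpha>\<close>.\<close>

definition msupport :: "'a::topological_space measure \<Rightarrow> 'a set" where
  "msupport \<alpha> = {t \<in> space \<alpha>. \<forall>U. open U \<and> t \<in> U \<longrightarrow> emeasure \<alpha> (U \<inter> space \<alpha>) > 0}"

definition initial_marginal ::
    "flat_space \<Rightarrow> real set \<Rightarrow> (real \<Rightarrow> (real ^ 'n) measure) \<Rightarrow>
      ((real ^ 'n) \<times> (real ^ 'n)) measure \<Rightarrow> (real ^ 'n) measure" where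
  "initial_marginal X T \<mu> \<pi> = (if 0 \<in> T then \<mu> 0 else distr \<pi> (borelX X) fst)"

definition admissible ::
    "flat_space \<Rightarrow> real set \<Rightarrow> (real \<Rightarrow> (real ^ 'n) measure) \<Rightarrow>
      ((real ^ 'n) \<times> (real ^ 'n)) measure \<Rightarrow> (real \<Rightarrow> real ^ 'n) measure set" where
  "admissible X T \<mu> \<pi> =
     {Q \<in> space (prob_algebra (path_space X)). (\<forall>t\<in>T. marg X Q t = \<mu> t) \<and> marg01 X Q = \<pi>}"

definition cond_entropy_inf ::
    "flat_space \<Rightarrow> real \<Rightarrow> 'w measure \<Rightarrow> (real \<Rightarrow> 'w \<Rightarrow> real ^ 'n) \<Rightarrow> real set \<Rightarrow>
      (real \<Rightarrow> (real ^ 'n) measure) \<Rightarrow> ((real ^ 'n) \<times> (real ^ 'n)) measure \<Rightarrow> ereal" where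
  "cond_entropy_inf X a M B T \<mu> \<pi> =
     (INF Q\<in>admissible X T \<mu> \<pi>.
        rel_entropy Q (bm_mix X a M B (initial_marginal X T \<mu> \<pi>)))"

definition time_space :: "flat_space \<Rightarrow> real set \<Rightarrow> (real \<times> (real ^ 'n)) measure" where
  "time_space X T = restrict_space borel T \<Otimes>\<^sub>M borelX X"

text \<open>The measure \<open>\<alpha>(dt) \<mu>\<^sub>t(dx)\<close>.\<close>

definition mu_alpha ::
    "flat_space \<Rightarrow> real set \<Rightarrow> (real \<Rightarrow> (real ^ 'n) measure) \<Rightarrow> real measure \<Rightarrow>
      (real \<times> (real ^ 'n)) measure" where
  "mu_alpha X T \<mu> \<alpha> = \<alpha> \<bind> (\<lambda>t. distr (\<mu> t) (time_space X T) (\<lambda>x. (t, x)))"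

definition dual_functional ::
    "flat_space \<Rightarrow> real \<Rightarrow> 'w measure \<Rightarrow> (real \<Rightarrow> 'w \<Rightarrow> real ^ 'n) \<Rightarrow> real set \<Rightarrow> real measure \<Rightarrow>
      (real \<Rightarrow> (real ^ 'n) measure) \<Rightarrow> ((real ^ 'n) \<times> (real ^ 'n)) measure \<Rightarrow>
      (real \<times> (real ^ 'n) \<Rightarrow> real) \<Rightarrow> ((real ^ 'n) \<times> (real ^ 'n) \<Rightarrow> real) \<Rightarrow> real" where
  "dual_functional X a M B T \<alpha> \<mu> \<pi> p \<eta> =
     (\<integral>z. p z \<partial>mu_alpha X T \<mu> \<alpha>) + (\<integral>w. \<eta> w \<partial>\<pi>)
     - (\<integral>x. ln (\<integral>\<omega>. exp ((\<integral>t. p (t, \<omega> t) \<partial>\<alpha>) + \<eta> (x, \<omega> 1)) \<partial>bm_law X a M B x)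
          \<partial>initial_marginal X T \<mu> \<pi>)"

section \<open>Density for pointwise convergence\<close>

definition bounded_measurable :: "'a measure \<Rightarrow> ('a \<Rightarrow> real) set" where
  "bounded_measurable N = {f \<in> borel_measurable N. bounded (f ` space N)}"

definition bp_tendsto :: "'a measure \<Rightarrow> (nat \<Rightarrow> 'a \<Rightarrow> real) \<Rightarrow> ('a \<Rightarrow> real) \<Rightarrow> bool" where
  "bp_tendsto N fs f \<longleftrightarrow>
     (\<exists>C. \<forall>k. \<forall>x\<in>space N. \<bar>fs k x\<bar> \<le> C) \<and> (\<forall>x\<in>space N. (\<lambda>k. fs k x) \<longlonglongrightarrow> f x)"

definition bp_closed ::
    "'a measure \<Rightarrow> 'b measure \<Rightarrow> (('a \<Rightarrow> real) \<times> ('b \<Rightarrow> real)) set \<Rightarrow> bool" where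
  "bp_closed N N' S \<longleftrightarrow>
     (\<forall>ps \<eta>s p \<eta>. (\<forall>k. (ps k, \<eta>s k) \<in> S) \<and> bp_tendsto N ps p \<and> bp_tendsto N' \<eta>s \<eta> \<longrightarrow>
        (p, \<eta>) \<in> S)"

text \<open>
  Density of a class of pairs of bounded measurable functions for bounded pointwise convergence:
  the smallest set that contains the class and is closed under pointwise limits of uniformly
  bounded sequences is the whole space. Boundedness of the sequences is needed: for merely
  pointwise limits the class on which the dual functional is nonpositive can be dense, and
  the dual equality fails for it. A single passage to the limit is not required to suffice, as
  bounded continuous functions only yield functions of the first Baire class in one step.
\<close>

definition bp_dense ::
    "'a measure \<Rightarrow> 'b measure \<Rightarrow> (('a \<Rightarrow> real) \<times> ('b \<Rightarrow> real)) set \<Rightarrow> bool" where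
  "bp_dense N N' A \<longleftrightarrow>
     A \<subseteq> bounded_measurable N \<times> bounded_measurable N' \<and>
     (\<forall>S. A \<subseteq> S \<and> bp_closed N N' S \<longrightarrow> bounded_measurable N \<times> bounded_measurable N' \<subseteq> S)"

end

theory Submission
  imports Defs "HOL-Real_Asymp.Real_Asymp"
begin

text \<open>
  Lower bounds for the entropy come from the Young inequality for \<open>x \<mapsto> x ln x + 1 - x\<close> (the
  Donsker-Varadhan bound), so the dual value never exceeds the primal one. For the converse, let
  \<open>F\<^sub>n\<close> be a maximizing sequence of \<open>\<ell>(F) - ln E exp F\<close> over the linear class of functionals
  \<open>\<integral> p(t, X\<^sub>t) \<alpha>(dt) + \<eta>(X\<^sub>0, X\<^sub>1)\<close>, normalized by \<open>E exp F\<^sub>n = 1\<close>. Comparing \<open>F\<^sub>n\<close> and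
  \<open>F\<^sub>m\<close> with their midpoint bounds the Hellinger distance of the Gibbs measures with densities
  \<open>exp F\<^sub>n\<close>, so these converge in total variation. Perturbing \<open>F\<^sub>n\<close> in a direction \<open>G\<close> shows that
  the limit \<open>Q\<close> satisfies \<open>E\<^sub>Q G = \<ell>(G)\<close>, and Fatou's lemma bounds its entropy by the dual value.
  Thus \<open>Q\<close> has the prescribed endpoint law and, for almost every time, the prescribed marginal;
  since both \<open>t \<mapsto> Q\<^sub>t\<close> and \<open>t \<mapsto> \<mu>\<^sub>t\<close> are weakly continuous, the full support of \<open>\<alpha>\<close> gives
  every time. The decomposition of the first infimum follows from \<open>R\<^bsup>\<mu>\<^sub>0\<^esup> = (d\<mu>\<^sub>0/dR\<^sub>0)(X\<^sub>0) R\<close>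
  without disintegration.
\<close>

section \<open>Relative entropy\<close>

text \<open>Two functionals are in play. The dual functional of the statement integrates a logarithm
  over the starting point, while the existence argument works with the single logarithm of
  \<open>E exp F\<close> under \<open>R\<^sub>\<mu>\<close>. The lower bound therefore normalizes
  separately for each starting point, and the converse loses only Jensen's inequality, which has the
  right direction.

  Compactness would not suffice: the test functions are merely bounded and measurable, so weak
  limits of measures need not respect the constraints, whereas limits in total variation do.

  Fatou's lemma bounds the entropy only if each \<open>F\<^sub>n\<close> has mean at most
  \<open>\<ell>(F\<^sub>n)\<close> under its own Gibbs measure. A maximizing sequence need not have
  this property, so each term is first rescaled by its best factor in \<open>[0,1]\<close>.

  Feasibility is never presupposed: a finite dual value itself produces an admissible measure.
  Incompatible data, such as a first marginal of \<open>\<pi>\<close> different from a prescribed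
  \<open>\<mu> 0\<close>, make the conditional infimum and its dual value infinite without a
  separate argument.\<close>

lemma AE_entropy_density:
  fixes q :: "'a \<Rightarrow> real"
  assumes "sigma_finite_measure M" and [measurable]: "q \<in> borel_measurable M" and "\<And>x. 0 \<le> q x"
  shows "AE x in M. entropy_density (exp 1) M (density M q) x = ln (q x)"
proof -
  interpret sigma_finite_measure M by fact
  have "AE x in M. ennreal (q x) = RN_deriv M (density M q) x"
    by (rule RN_deriv_unique) auto
  then show ?thesis
  proof eventually_elim
    case (elim x)
    then have "enn2real (RN_deriv M (density M q) x) = q x"
      using assms(3)[of x] by (metis enn2real_ennreal)
    then show ?case by (simp add: entropy_density_def log_def)
  qed
qed

lemma AE_density_of_AE:
  assumes "f \<in> borel_measurable M" "AE x in M. P x"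
  shows "AE x in density M f. P x"
  using assms by (subst AE_density) auto

lemma entropy_density_integrals:
  fixes q :: "'a \<Rightarrow> real"
  assumes "sigma_finite_measure M" and [measurable]: "q \<in> borel_measurable M" and "\<And>x. 0 \<le> q x"
  shows "(\<integral>\<^sup>+x. ennreal (entropy_density (exp 1) M (density M q) x) \<partial>density M q)
           = (\<integral>\<^sup>+x. ennreal (ln (q x)) \<partial>density M q)"
    and "(\<integral>\<^sup>+x. ennreal (- entropy_density (exp 1) M (density M q) x) \<partial>density M q)
           = (\<integral>\<^sup>+x. ennreal (- ln (q x)) \<partial>density M q)"
  by (rule nn_integral_cong_AE, rule AE_density_of_AE[OF _ AE_mp[OF AE_entropy_density[OF assms]]],
      simp, simp)+

text \<open>Sigma-finiteness is the natural generality here: over Euclidean space the reference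
  measure \<open>R\<close> has infinite mass.\<close>

lemma rel_entropy_density:
  fixes q :: "'a \<Rightarrow> real"
  assumes "sigma_finite_measure M" and [measurable]: "q \<in> borel_measurable M" and "\<And>x. 0 \<le> q x"
  shows "rel_entropy (density M q) M
    = enn2ereal (\<integral>\<^sup>+x. ennreal (ln (q x)) \<partial>density M q)
      - enn2ereal (\<integral>\<^sup>+x. ennreal (- ln (q x)) \<partial>density M q)"
  using absolutely_continuousI_density[of q M] assms
  by (simp add: rel_entropy_def entropy_density_integrals)

lemma (in sigma_finite_measure) obtain_real_density:
  assumes "absolutely_continuous M Q" "sets Q = sets M" "finite_measure Q"
  obtains q :: "'a \<Rightarrow> real" where "q \<in> borel_measurable M" "\<And>x. 0 \<le> q x" "Q = density M q"
proof -
  interpret Q: finite_measure Q by fact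
  let ?D = "RN_deriv M Q"
  have D: "density M ?D = Q"
    by (rule density_RN_deriv) fact+
  have "(\<integral>\<^sup>+x. ?D x \<partial>M) = emeasure (density M ?D) (space M)"
    by (subst emeasure_density) (auto intro!: nn_integral_cong)
  also have "\<dots> \<noteq> \<infinity>"
    unfolding D using Q.emeasure_finite by simp
  finally have "AE x in M. ?D x \<noteq> \<infinity>"
    by (intro nn_integral_PInf_AE) auto
  then have "density M ?D = density M (\<lambda>x. ennreal (enn2real (?D x)))"
    by (intro density_cong) (auto simp: less_top)
  with D show ?thesis
    by (intro that[of "\<lambda>x. enn2real (?D x)"]) auto
qed

text \<open>Between probability measures the extra \<open>1 - x\<close> integrates to zero, and it
  makes the integrand nonnegative, so entropies become \<open>nn_integral\<close>s to which Fatou's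
  lemma applies. The value at \<open>0\<close> is \<open>1\<close>, the limit from the
  right.\<close>

definition entropy_fun :: "real \<Rightarrow> real" where
  "entropy_fun x = x * ln x + 1 - x"

text \<open>The convex conjugate of \<open>entropy_fun\<close> is \<open>exp y - 1\<close>. For
  positive \<open>x\<close> the inequality is \<open>1 + z \<le> exp z\<close> at
  \<open>z = y - ln x\<close>, multiplied by \<open>x\<close>.\<close>

lemma entropy_fun_young:
  assumes "0 \<le> x"
  shows "x * y \<le> entropy_fun x + exp y - 1"
proof (cases "x = 0")
  case False
  then have x: "x > 0" using assms by simp
  have "1 + (y - ln x) \<le> exp (y - ln x)" by (rule exp_ge_add_one_self)
  also have "\<dots> = exp y / x" using x by (simp add: exp_diff)
  finally have "x * (1 + (y - ln x)) \<le> exp y" using x by (simp add: field_simps)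
  then show ?thesis by (simp add: entropy_fun_def algebra_simps)
qed (simp add: entropy_fun_def)

lemma entropy_fun_nonneg: "0 \<le> x \<Longrightarrow> 0 \<le> entropy_fun x"
  using entropy_fun_young[of x 0] by simp

lemma measurable_entropy_fun [measurable]: "entropy_fun \<in> borel_measurable borel"
  unfolding entropy_fun_def by measurable

lemma isCont_entropy_fun: "0 < x \<Longrightarrow> isCont entropy_fun x"
  unfolding entropy_fun_def by (intro continuous_intros) auto

text \<open>Convergence of Gibbs densities has to survive where the limit density vanishes; there
  \<open>x ln x\<close> tending to \<open>0\<close> replaces continuity of \<open>ln\<close>. The
  terms are positive because they will be exponentials.\<close>

lemma tendsto_entropy_fun:
  assumes "u \<longlonglongrightarrow> x" "\<And>n. 0 < u n"
  shows "(\<lambda>n. entropy_fun (u n)) \<longlonglongrightarrow> entropy_fun x"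
proof (cases "x = 0")
  case True
  have lim1: "(entropy_fun \<longlongrightarrow> 1) (at_right 0)"
    unfolding entropy_fun_def by real_asymp
  have "u n \<noteq> 0" for n using assms(2)[of n] by simp
  then have lim2: "filterlim u (at_right 0) sequentially"
    using assms True by (auto simp: filterlim_at)
  show ?thesis
    using filterlim_compose[OF lim1 lim2] True by (simp add: entropy_fun_def)
next
  case False
  have "0 \<le> x" using assms by (intro LIMSEQ_le_const) (auto intro: less_imp_le)
  with False have "isCont entropy_fun x" by (intro isCont_entropy_fun) auto
  then show ?thesis using assms isCont_tendsto_compose by blast
qed

text \<open>Pointwise \<open>- q ln q \<le> 1 - q \<le> 1\<close>. Relative to a probability measure
  the negative part is thus finite, and \<open>rel_entropy\<close> never reads infinity minus
  infinity.\<close>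

lemma nn_integral_neg_ln_le_1:
  fixes q :: "'a \<Rightarrow> real"
  assumes "prob_space M" and [measurable]: "q \<in> borel_measurable M" and q: "\<And>x. 0 \<le> q x"
  shows "(\<integral>\<^sup>+x. ennreal (- ln (q x)) \<partial>density M q) \<le> 1"
proof -
  interpret prob_space M by fact
  have N: "(\<integral>\<^sup>+x. ennreal (- ln (q x)) \<partial>density M q) = (\<integral>\<^sup>+x. ennreal (q x * - ln (q x)) \<partial>M)"
    by (simp add: nn_integral_density) (intro nn_integral_cong, metis ennreal_mult'[OF q] mult_minus_right)
  have "q x * - ln (q x) \<le> 1" for x
    using entropy_fun_nonneg[OF q[of x]] q[of x] by (simp add: entropy_fun_def)
  then have "(\<integral>\<^sup>+x. ennreal (- ln (q x)) \<partial>density M q) \<le> (\<integral>\<^sup>+x. 1 \<partial>M)"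
    unfolding N by (intro nn_integral_mono) (metis ennreal_1 ennreal_leI)
  then show ?thesis by (simp add: emeasure_space_1)
qed

lemma rel_entropy_prob_density:
  fixes q :: "'a \<Rightarrow> real"
  assumes "prob_space M" and [measurable]: "q \<in> borel_measurable M" and q: "\<And>x. 0 \<le> q x"
    and prob: "prob_space (density M q)"
  shows "rel_entropy (density M q) M = enn2ereal (\<integral>\<^sup>+x. ennreal (entropy_fun (q x)) \<partial>M)"
proof -
  interpret prob_space M by fact
  let ?P = "\<integral>\<^sup>+x. ennreal (ln (q x)) \<partial>density M q" and ?N = "\<integral>\<^sup>+x. ennreal (- ln (q x)) \<partial>density M q"
  let ?E = "\<integral>\<^sup>+x. ennreal (entropy_fun (q x)) \<partial>M"
  have P: "?P = (\<integral>\<^sup>+x. ennreal (q x * ln (q x)) \<partial>M)"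
    by (subst nn_integral_density) (auto simp: ennreal_mult' q)
  have N: "?N = (\<integral>\<^sup>+x. ennreal (q x * - ln (q x)) \<partial>M)"
    by (simp add: nn_integral_density) (intro nn_integral_cong, metis ennreal_mult'[OF q] mult_minus_right)
  have N_fin: "?N \<le> 1"
    by (rule nn_integral_neg_ln_le_1) (use assms in auto)
  have q1: "(\<integral>\<^sup>+x. ennreal (q x) \<partial>M) = 1"
    using prob_space.emeasure_space_1[OF prob] by (simp add: emeasure_density cong: nn_integral_cong)
  \<comment> \<open>Subtraction is postponed: positive part, negative part and masses are balanced
    by addition in \<open>ennreal\<close>, and only the finiteness of \<open>?N\<close> lets it be
    moved to the other side.\<close>
  have "?E + (?N + 1) = (\<integral>\<^sup>+x. ennreal (entropy_fun (q x)) + (ennreal (q x * - ln (q x)) + ennreal (q x)) \<partial>M)"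
    unfolding N q1[symmetric] by (simp add: nn_integral_add)
  also have "\<dots> = (\<integral>\<^sup>+x. ennreal (q x * ln (q x)) + 1 \<partial>M)"
  proof (intro nn_integral_cong)
    fix x
    have mx: "ennreal (max 0 y) = ennreal y" for y :: real
      by (simp add: max_def ennreal_neg)
    have "ennreal (entropy_fun (q x)) + (ennreal (q x * - ln (q x)) + ennreal (q x))
      = ennreal (entropy_fun (q x) + (max 0 (q x * - ln (q x)) + q x))"
      using entropy_fun_nonneg[OF q[of x]] q[of x] by (simp add: mx del: max.absorb1 max.absorb2)
    also have "entropy_fun (q x) + (max 0 (q x * - ln (q x)) + q x) = max 0 (q x * ln (q x)) + 1"
      by (auto simp: entropy_fun_def max_def)
    also have "ennreal \<dots> = ennreal (q x * ln (q x)) + 1"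
      by (simp add: max_def ennreal_neg)
    finally show "ennreal (entropy_fun (q x)) + (ennreal (q x * - ln (q x)) + ennreal (q x))
       = ennreal (q x * ln (q x)) + 1" .
  qed
  also have "\<dots> = ?P + 1"
    unfolding P by (subst nn_integral_add) (auto simp: emeasure_space_1)
  finally have "(?E + ?N) + 1 = ?P + 1" by (simp add: add.assoc)
  then have *: "?E + ?N = ?P" by (metis ennreal_add_diff_cancel_right ennreal_one_neq_top)
  have "?N \<noteq> \<infinity>" using N_fin by (auto simp: top_unique)
  then obtain n where n: "0 \<le> n" "?N = ennreal n" by (metis ennreal_cases infinity_ennreal_def)
  have "enn2ereal ?P - enn2ereal ?N = enn2ereal ?E"
    unfolding *[symmetric] n(2) using n(1)
    by (cases ?E rule: ennreal_cases) (auto simp: plus_ennreal.rep_eq)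
  then show ?thesis
    by (subst rel_entropy_density) (auto simp: q intro: sigma_finite_measure_axioms)
qed

section \<open>Lower bounds for the entropy\<close>

lemma integrable_mult_bounded:
  fixes w G :: "'a \<Rightarrow> real"
  assumes w: "integrable M w" and [measurable]: "G \<in> borel_measurable M"
    and K: "\<And>x. x \<in> space M \<Longrightarrow> \<bar>G x\<bar> \<le> K"
  shows "integrable M (\<lambda>x. w x * G x)"
proof (rule Bochner_Integration.integrable_bound[where f="\<lambda>x. K * w x"])
  show "AE x in M. norm (w x * G x) \<le> norm (K * w x)"
  proof (rule AE_I2)
    fix x assume "x \<in> space M"
    then have "\<bar>w x\<bar> * \<bar>G x\<bar> \<le> \<bar>w x\<bar> * \<bar>K\<bar>"
      using K[of x] by (intro mult_left_mono) auto
    then show "norm (w x * G x) \<le> norm (K * w x)"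
      by (simp add: abs_mult mult.commute)
  qed
qed (use w in auto)

text \<open>Integrate Young's inequality with \<open>x\<close> the density of \<open>Q\<close> and
  \<open>y = F\<close>; the normalization \<open>le\<close> disposes of the exponential term. If
  there is no density or the entropy is infinite, the right-hand side is
  \<open>\<infinity>\<close>.\<close>

lemma donsker_varadhan:
  fixes F :: "'a \<Rightarrow> real"
  assumes "prob_space Q" "prob_space M" "sets Q = sets M"
    and [measurable]: "F \<in> borel_measurable M" and K: "\<And>x. x \<in> space M \<Longrightarrow> \<bar>F x\<bar> \<le> K"
    and le: "(\<integral>x. exp (F x) \<partial>M) \<le> 1"
  shows "ereal (\<integral>x. F x \<partial>Q) \<le> rel_entropy Q M"
proof (cases "absolutely_continuous M Q")
  case True
  interpret M: prob_space M by fact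
  interpret Q: prob_space Q by fact
  obtain q :: "'a \<Rightarrow> real" where q: "q \<in> borel_measurable M" "\<And>x. 0 \<le> q x" "Q = density M q"
    using M.obtain_real_density[OF True assms(3)] Q.finite_measure_axioms by blast
  note [measurable] = q(1)
  let ?E = "\<integral>\<^sup>+x. ennreal (entropy_fun (q x)) \<partial>M"
  have ent: "rel_entropy Q M = enn2ereal ?E"
    unfolding q(3) by (rule rel_entropy_prob_density)
      (use assms q in auto)
  show ?thesis
  proof (cases "?E = \<infinity>")
    case False
    have int_E: "integrable M (\<lambda>x. entropy_fun (q x))"
      using False by (intro integrableI_nonneg) (auto simp: entropy_fun_nonneg q less_top)
    have int_exp: "integrable M (\<lambda>x. exp (F x))"
      by (rule M.integrable_const_bound[where B="exp K"]) (use K in \<open>auto simp: abs_le_iff\<close>)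
    have "(\<integral>\<^sup>+x. ennreal (q x) \<partial>M) = emeasure Q (space M)"
      unfolding q(3) by (auto simp: emeasure_density intro!: nn_integral_cong)
    then have q1: "(\<integral>\<^sup>+x. ennreal (q x) \<partial>M) = 1"
      using Q.emeasure_space_1 assms(3) by (metis sets_eq_imp_space_eq)
    have int_q: "integrable M q"
      using q1 by (intro integrableI_nonneg) (auto simp: q)
    have int_qF: "integrable M (\<lambda>x. q x * F x)"
      by (rule integrable_mult_bounded[OF int_q _ K]) auto
    have "(\<integral>x. F x \<partial>Q) = (\<integral>x. q x * F x \<partial>M)"
      unfolding q(3) by (subst integral_density) (auto simp: q)
    also have "\<dots> \<le> (\<integral>x. entropy_fun (q x) + exp (F x) - 1 \<partial>M)"
      using int_E int_exp int_qF by (intro integral_mono) (auto intro: entropy_fun_young q)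
    also have "\<dots> = (\<integral>x. entropy_fun (q x) \<partial>M) + (\<integral>x. exp (F x) \<partial>M) - 1"
      using int_E int_exp by (simp add: M.prob_space)
    also have "\<dots> \<le> (\<integral>x. entropy_fun (q x) \<partial>M)" using le by simp
    also have "ereal \<dots> = enn2ereal ?E"
      using int_E by (subst nn_integral_eq_integral) (auto simp: entropy_fun_nonneg q)
    finally show ?thesis unfolding ent by simp
  qed (simp add: ent)
qed (simp add: rel_entropy_def)

lemma rel_entropy_nonneg:
  assumes "prob_space Q" "prob_space M" "sets Q = sets M"
  shows "0 \<le> rel_entropy Q M"
  using donsker_varadhan[OF assms, of "\<lambda>_. 0" 0] prob_space.prob_space[OF assms(2)]
  by (simp add: zero_ereal_def)

text \<open>Pointwise, the positive part of \<open>U + V\<close> plus the negative parts of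
  \<open>U\<close> and \<open>V\<close> equals the negative part of \<open>U + V\<close> plus the
  positive parts of \<open>U\<close> and \<open>V\<close>. Finite negative parts permit the
  subtraction even when positive parts are infinite.\<close>

lemma extended_integral_add:
  fixes U V :: "'a \<Rightarrow> real"
  assumes [measurable]: "U \<in> borel_measurable M" "V \<in> borel_measurable M"
    and U: "(\<integral>\<^sup>+x. ennreal (- U x) \<partial>M) < \<infinity>" and V: "(\<integral>\<^sup>+x. ennreal (- V x) \<partial>M) < \<infinity>"
  shows "enn2ereal (\<integral>\<^sup>+x. ennreal (U x + V x) \<partial>M) - enn2ereal (\<integral>\<^sup>+x. ennreal (- (U x + V x)) \<partial>M)
    = (enn2ereal (\<integral>\<^sup>+x. ennreal (U x) \<partial>M) - enn2ereal (\<integral>\<^sup>+x. ennreal (- U x) \<partial>M))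
    + (enn2ereal (\<integral>\<^sup>+x. ennreal (V x) \<partial>M) - enn2ereal (\<integral>\<^sup>+x. ennreal (- V x) \<partial>M))"
    (is "enn2ereal ?W1 - enn2ereal ?W2 = (enn2ereal ?U1 - enn2ereal ?U2) + (enn2ereal ?V1 - enn2ereal ?V2)")
proof -
  have plus: "ennreal a + ennreal b = ennreal (max 0 a + max 0 b)" for a b :: real
    by (simp add: max_def ennreal_neg)
  have "?W1 + (?U2 + ?V2) = (\<integral>\<^sup>+x. ennreal (U x + V x) + (ennreal (- U x) + ennreal (- V x)) \<partial>M)"
    by (simp add: nn_integral_add)
  also have "\<dots> = (\<integral>\<^sup>+x. ennreal (- (U x + V x)) + (ennreal (U x) + ennreal (V x)) \<partial>M)"
    unfolding plus by (intro nn_integral_cong arg_cong[where f=ennreal]) (auto simp: max_def)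
  also have "\<dots> = ?W2 + (?U1 + ?V1)"
    by (simp add: nn_integral_add)
  finally have eq: "?W1 + (?U2 + ?V2) = ?W2 + (?U1 + ?V1)" .
  have "?W2 \<le> (\<integral>\<^sup>+x. ennreal (- U x) + ennreal (- V x) \<partial>M)"
    unfolding plus by (intro nn_integral_mono ennreal_leI) (auto simp: max_def)
  also have "\<dots> = ?U2 + ?V2" by (simp add: nn_integral_add)
  also have "\<dots> < \<infinity>" using U V by simp
  finally have W: "?W2 < \<infinity>" .
  obtain u where u: "0 \<le> u" "?U2 = ennreal u"
    using U by (cases ?U2 rule: ennreal_cases) auto
  obtain v where v: "0 \<le> v" "?V2 = ennreal v"
    using V by (cases ?V2 rule: ennreal_cases) auto
  obtain w where w: "0 \<le> w" "?W2 = ennreal w"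
    using W by (cases ?W2 rule: ennreal_cases) auto
  show ?thesis
    using eq unfolding u(2) v(2) w(2) using u(1) v(1) w(1)
    by (cases ?W1 rule: ennreal_cases; cases ?U1 rule: ennreal_cases; cases ?V1 rule: ennreal_cases)
      (auto simp flip: ennreal_plus)
qed

text \<open>The chain rule of entropy along \<open>X0\<close>: the density of \<open>Q\<close> with
  respect to \<open>R\<close> is \<open>f(X0)\<close> times the one with respect to
  \<open>P\<close>, and its logarithm splits. \<open>meaningful\<close> keeps the first summand away
  from \<open>-\<infinity>\<close>.\<close>

lemma rel_entropy_reweighted_marginal:
  fixes f :: "'b \<Rightarrow> real"
  assumes [measurable]: "X0 \<in> R \<rightarrow>\<^sub>M N"
    and R: "sigma_finite_measure R" and R0: "sigma_finite_measure (distr R N X0)"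
    and Q: "prob_space Q" "sets Q = sets R" "distr Q N X0 = m"
    and [measurable]: "f \<in> borel_measurable N" and f: "\<And>x. 0 \<le> f x"
    and m: "m = density (distr R N X0) f"
    and P: "P = density R (\<lambda>\<omega>. f (X0 \<omega>))" "prob_space P"
    and meaningful: "entropy_meaningful m (distr R N X0)"
  shows "rel_entropy Q R = rel_entropy m (distr R N X0) + rel_entropy Q P"
proof -
  interpret R: sigma_finite_measure R by fact
  interpret P: prob_space P by fact
  interpret Q: prob_space Q by fact
  have sets_P [simp]: "sets P = sets R" by (simp add: P)
  have meas_Q [measurable_cong]: "sets Q = sets R" by fact
  have X0_Q [measurable]: "X0 \<in> Q \<rightarrow>\<^sub>M N" by measurable
  have ac_m: "absolutely_continuous (distr R N X0) m"
    unfolding m by (rule absolutely_continuousI_density) simp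
  have ent_m: "rel_entropy m (distr R N X0)
      = enn2ereal (\<integral>\<^sup>+\<omega>. ennreal (ln (f (X0 \<omega>))) \<partial>Q) - enn2ereal (\<integral>\<^sup>+\<omega>. ennreal (- ln (f (X0 \<omega>))) \<partial>Q)"
    unfolding m by (subst rel_entropy_density[OF R0])
      (auto simp: f m[symmetric] Q(3)[symmetric] nn_integral_distr)
  have fin_m: "(\<integral>\<^sup>+\<omega>. ennreal (- ln (f (X0 \<omega>))) \<partial>Q) < \<infinity>"
    using meaningful ac_m entropy_density_integrals(2)[OF R0, of f]
    by (simp add: entropy_meaningful_def f m[symmetric])
      (simp add: Q(3)[symmetric] nn_integral_distr)
  have not_MInf: "rel_entropy m (distr R N X0) \<noteq> -\<infinity>"
    unfolding ent_m using fin_m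
    by (cases "\<integral>\<^sup>+\<omega>. ennreal (ln (f (X0 \<omega>))) \<partial>Q" rule: ennreal_cases;
        cases "\<integral>\<^sup>+\<omega>. ennreal (- ln (f (X0 \<omega>))) \<partial>Q" rule: ennreal_cases) auto
  show ?thesis
  proof (cases "absolutely_continuous P Q")
    case True
    obtain q :: "'a \<Rightarrow> real" where q: "q \<in> borel_measurable P" "\<And>x. 0 \<le> q x" "Q = density P q"
      using P.obtain_real_density[OF True] Q.finite_measure_axioms Q(2) by auto
    have [measurable]: "q \<in> borel_measurable R"
      using q(1) by (simp cong: measurable_cong_sets)
    define g where "g \<omega> = f (X0 \<omega>) * q \<omega>" for \<omega>
    have [measurable]: "g \<in> borel_measurable R" unfolding g_def by measurable
    have g: "0 \<le> g \<omega>" for \<omega> by (simp add: g_def f q)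
    have Qg: "Q = density R g"
      unfolding q(3) P(1) g_def by (subst density_density_eq) (auto simp: ennreal_mult' f)
    \<comment> \<open>Since \<open>ln 0 = 0\<close>, the product rule can fail where a factor
      vanishes, but \<open>Q\<close> has density \<open>g\<close> and does not charge
      \<open>g = 0\<close>.\<close>
    have ln_g: "AE \<omega> in Q. ln (g \<omega>) = ln (f (X0 \<omega>)) + ln (q \<omega>)"
      unfolding Qg
    proof (subst AE_density, simp, intro AE_I2 impI)
      fix \<omega> assume "0 < ennreal (g \<omega>)"
      then have "f (X0 \<omega>) \<noteq> 0" "q \<omega> \<noteq> 0" by (auto simp: g_def)
      then have "f (X0 \<omega>) > 0" "q \<omega> > 0" using f q by (auto simp: less_le)
      then show "ln (g \<omega>) = ln (f (X0 \<omega>)) + ln (q \<omega>)" by (simp add: g_def ln_mult)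
    qed
    have "rel_entropy Q R = enn2ereal (\<integral>\<^sup>+x. ennreal (ln (g x)) \<partial>Q) - enn2ereal (\<integral>\<^sup>+x. ennreal (- ln (g x)) \<partial>Q)"
      unfolding Qg by (rule rel_entropy_density[OF R]) (auto simp: g)
    also have "(\<integral>\<^sup>+x. ennreal (ln (g x)) \<partial>Q) = (\<integral>\<^sup>+x. ennreal (ln (f (X0 x)) + ln (q x)) \<partial>Q)"
      by (rule nn_integral_cong_AE, rule AE_mp[OF ln_g]) auto
    also have "(\<integral>\<^sup>+x. ennreal (- ln (g x)) \<partial>Q) = (\<integral>\<^sup>+x. ennreal (- (ln (f (X0 x)) + ln (q x))) \<partial>Q)"
      by (rule nn_integral_cong_AE, rule AE_mp[OF ln_g]) auto
    also have "enn2ereal (\<integral>\<^sup>+x. ennreal (ln (f (X0 x)) + ln (q x)) \<partial>Q) - enn2ereal \<dots>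
       = (enn2ereal (\<integral>\<^sup>+x. ennreal (ln (f (X0 x))) \<partial>Q) - enn2ereal (\<integral>\<^sup>+x. ennreal (- ln (f (X0 x))) \<partial>Q))
         + (enn2ereal (\<integral>\<^sup>+x. ennreal (ln (q x)) \<partial>Q) - enn2ereal (\<integral>\<^sup>+x. ennreal (- ln (q x)) \<partial>Q))"
    proof (rule extended_integral_add)
      show "(\<integral>\<^sup>+x. ennreal (- ln (q x)) \<partial>Q) < \<infinity>"
        using nn_integral_neg_ln_le_1[OF P.prob_space_axioms q(1,2)] q(3)
        by (metis ennreal_one_less_top infinity_ennreal_def order_le_less_trans)
    qed (use fin_m in auto)
    also have "(enn2ereal (\<integral>\<^sup>+x. ennreal (ln (q x)) \<partial>Q) - enn2ereal (\<integral>\<^sup>+x. ennreal (- ln (q x)) \<partial>Q))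
        = rel_entropy Q P"
      using rel_entropy_density[OF P.sigma_finite_measure_axioms q(1,2)] q(3) by simp
    finally show ?thesis by (simp only: ent_m)
  next
    case False
    have "\<not> absolutely_continuous R Q"
    proof
      assume ac: "absolutely_continuous R Q"
      \<comment> \<open>A \<open>P\<close>-null set carries \<open>R\<close>-mass only where
        \<open>f(X0) = 0\<close>, and \<open>Q\<close> does not charge that event because its
        \<open>X0\<close>-law has density \<open>f\<close>.\<close>
      have "null_sets P \<subseteq> null_sets Q"
      proof
        fix A assume A: "A \<in> null_sets P"
        then have [measurable]: "A \<in> sets R" by (auto dest: null_setsD2)
        have "AE \<omega> in R. \<omega> \<in> A \<longrightarrow> ennreal (f (X0 \<omega>)) = 0"
          using A unfolding P(1) by (subst (asm) null_sets_density_iff) auto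
        then have "AE \<omega> in Q. \<omega> \<in> A \<longrightarrow> ennreal (f (X0 \<omega>)) = 0"
          by (rule absolutely_continuous_AE[OF Q(2) ac])
        moreover have "AE x in m. f x \<noteq> 0"
          unfolding m by (subst AE_density) auto
        then have "AE \<omega> in Q. f (X0 \<omega>) \<noteq> 0"
          unfolding Q(3)[symmetric] by (subst (asm) AE_distr_iff) auto
        ultimately have "AE \<omega> in Q. \<omega> \<notin> A"
          by eventually_elim (use f in \<open>auto simp: ennreal_eq_0_iff antisym\<close>)
        then show "A \<in> null_sets Q"
          using AE_iff_null_sets[of A Q] Q(2) by auto
      qed
      with False show False by (simp add: absolutely_continuous_def)
    qed
    with False not_MInf show ?thesis by (simp add: rel_entropy_def)
  qed
qed

section \<open>Entropy minimization under linear constraints\<close>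

text \<open>For \<open>y = - z\<close> negative, \<open>exp z\<close> is at least its second Taylor
  polynomial, whose product with \<open>1 - z + z\<^sup>2\<close> is \<open>1\<close> plus positive
  terms.\<close>

lemma exp_le_quadratic:
  fixes y :: real
  assumes "y \<le> 1"
  shows "exp y \<le> 1 + y + y\<^sup>2"
proof (cases "0 \<le> y")
  case False
  define z where "z = - y"
  have z: "z > 0" using False by (simp add: z_def)
  have "1 + z + z\<^sup>2 / 2 \<le> exp z" using z by (intro exp_lower_Taylor_quadratic) simp
  moreover have "1 \<le> (1 - z + z\<^sup>2) * (1 + z + z\<^sup>2 / 2)"
  proof -
    have "(1 - z + z\<^sup>2) * (1 + z + z\<^sup>2 / 2) = 1 + (z\<^sup>2 / 2 + z ^ 3 / 2 + z ^ 4 / 2)"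
      by (simp add: field_simps power2_eq_square power3_eq_cube power4_eq_xxxx)
    then show ?thesis using z by simp
  qed
  moreover have "0 \<le> 1 - z + z\<^sup>2"
    using zero_le_power2[of "z - 1/2"] by (simp add: power2_eq_square algebra_simps)
  ultimately have "1 \<le> (1 - z + z\<^sup>2) * exp z"
    by (meson mult_left_mono order_trans)
  then have "exp (- z) \<le> (1 - z + z\<^sup>2)"
    by (simp add: exp_minus field_simps)
  then show ?thesis by (simp add: z_def)
qed (use assms exp_bound in auto)

context prob_space
begin

text \<open>A one-sided derivative at \<open>u = 0\<close>: the weighted mean of
  \<open>exp (- u * G)\<close> is at most \<open>1 - u * E G + u\<^sup>2 * K\<^sup>2\<close>, so
  dividing the hypothesis by \<open>u\<close> and letting \<open>u\<close> tend to \<open>0\<close>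
  gives the claim. It extracts first order information both from a best multiple and from the limit
  measure.\<close>

lemma expectation_le_of_exp_bounds:
  fixes w G :: "'a \<Rightarrow> real"
  assumes w: "integrable M w" "\<And>x. 0 \<le> w x" "(\<integral>x. w x \<partial>M) = 1"
    and [measurable]: "G \<in> borel_measurable M" and K: "\<And>x. x \<in> space M \<Longrightarrow> \<bar>G x\<bar> \<le> K"
    and \<delta>: "0 < \<delta>"
    and le: "\<And>u. 0 < u \<Longrightarrow> u \<le> \<delta> \<Longrightarrow> 1 - (\<integral>x. w x * exp (- u * G x) \<partial>M) \<le> u * m"
  shows "(\<integral>x. w x * G x \<partial>M) \<le> m"
proof -
  have [measurable]: "w \<in> borel_measurable M" using w(1) by auto
  have K0: "0 \<le> K" using K not_empty by (meson abs_ge_zero equals0I order_trans)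
  have int_G: "integrable M (\<lambda>x. w x * G x)"
    using w(1) K by (intro integrable_mult_bounded) auto
  \<comment> \<open>Keeps \<open>u * G\<close> at most \<open>1\<close>, as
    \<open>exp_le_quadratic\<close> demands; \<open>K + 1\<close> avoids a division by zero.\<close>
  define d where "d = min \<delta> (1 / (K + 1))"
  have d: "0 < d" "d \<le> \<delta>" "d * K \<le> 1" using \<delta> K0 by (auto simp: d_def min_def field_simps)
  have "(\<integral>x. w x * G x \<partial>M) \<le> m + u * K\<^sup>2" if u: "0 < u" "u \<le> d" for u
  proof -
    have bnd: "\<bar>u * G x\<bar> \<le> u * K" if "x \<in> space M" for x
      using K[OF that] u by (simp add: abs_mult mult_left_mono)
    have uK: "u * K \<le> 1" using u d K0 by (meson mult_right_mono order_trans)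
    have int_e: "integrable M (\<lambda>x. w x * exp (- u * G x))"
    proof (rule integrable_mult_bounded[OF w(1), where K="exp (u * K)"])
      fix x assume "x \<in> space M"
      then show "\<bar>exp (- u * G x)\<bar> \<le> exp (u * K)" using bnd[of x] by (simp add: abs_le_iff)
    qed auto
    have "(\<integral>x. w x * exp (- u * G x) \<partial>M) \<le> (\<integral>x. w x * (1 + (u * K)\<^sup>2) - u * (w x * G x) \<partial>M)"
    proof (rule integral_mono[OF int_e])
      fix x assume x: "x \<in> space M"
      have "exp (- u * G x) \<le> 1 + (- u * G x) + (- u * G x)\<^sup>2"
        using bnd[OF x] uK by (intro exp_le_quadratic) (auto simp: abs_le_iff)
      also have "(- u * G x)\<^sup>2 \<le> (u * K)\<^sup>2"
        using bnd[OF x] u K0 by (subst abs_le_square_iff[symmetric]) auto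
      finally have "w x * exp (- u * G x) \<le> w x * (1 + (- u * G x) + (u * K)\<^sup>2)"
        using w(2)[of x] by (intro mult_left_mono) auto
      then show "w x * exp (- u * G x) \<le> w x * (1 + (u * K)\<^sup>2) - u * (w x * G x)"
        by (simp add: algebra_simps)
    qed (use w(1) int_G in auto)
    also have "\<dots> = 1 + (u * K)\<^sup>2 - u * (\<integral>x. w x * G x \<partial>M)"
      using w int_G by simp
    finally have "1 - (1 + (u * K)\<^sup>2 - u * (\<integral>x. w x * G x \<partial>M)) \<le> u * m"
      using le[of u] u d by linarith
    then have "u * (\<integral>x. w x * G x \<partial>M) \<le> u * (m + u * K\<^sup>2)"
      by (simp add: algebra_simps power2_eq_square)
    then show ?thesis using u by simp
  qed
  then have "eventually (\<lambda>u. (\<integral>x. w x * G x \<partial>M) \<le> m + u * K\<^sup>2) (at_right 0)"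
    using d(1) by (intro eventually_at_rightI[of 0 d]) auto
  moreover have "((\<lambda>u. m + u * K\<^sup>2) \<longlongrightarrow> m + 0 * K\<^sup>2) (at_right 0)"
    by (intro tendsto_intros)
  ultimately show ?thesis
    by (intro tendsto_le[OF _ _ tendsto_const, of "at_right 0"]) auto
qed

end

text \<open>A pair \<open>(F, l)\<close> prescribes the mean \<open>l\<close> for \<open>F\<close>.
  Pairs are used because different \<open>(p, \<eta>)\<close> may induce the same path functional.
  Contradictory prescriptions are excluded by \<open>upper\<close>: two values \<open>l\<close> and
  \<open>m\<close> for one \<open>F\<close> would put every multiple of \<open>(0, l - m)\<close>
  into \<open>C\<close>. The constants allow normalizing \<open>E exp F = 1\<close> without changing
  the functional.\<close>

locale entropic_dual = prob_space M for M :: "'a measure" +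
  fixes C :: "(('a \<Rightarrow> real) \<times> real) set" and S :: real
  assumes meas: "(F, l) \<in> C \<Longrightarrow> F \<in> borel_measurable M"
    and bounded: "(F, l) \<in> C \<Longrightarrow> \<exists>K. \<forall>x\<in>space M. \<bar>F x\<bar> \<le> K"
    and const: "(\<lambda>_. c, c) \<in> C"
    and linear: "(F, l) \<in> C \<Longrightarrow> (G, m) \<in> C \<Longrightarrow> (\<lambda>x. c * F x + d * G x, c * l + d * m) \<in> C"
    and upper: "(F, l) \<in> C \<Longrightarrow> l - ln (\<integral>x. exp (F x) \<partial>M) \<le> S"
begin

section \<open>The dual value and its nearly optimal competitors\<close>

lemma integrable_exp: "(F, l) \<in> C \<Longrightarrow> integrable M (\<lambda>x. exp (F x))"
proof -
  assume F: "(F, l) \<in> C"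
  obtain K where "\<forall>x\<in>space M. \<bar>F x\<bar> \<le> K" using bounded[OF F] by auto
  then show ?thesis
    using meas[OF F] by (intro integrable_const_bound[where B="exp K"]) (auto simp: abs_le_iff)
qed

lemma exp_expectation_pos: "(F, l) \<in> C \<Longrightarrow> 0 < (\<integral>x. exp (F x) \<partial>M)"
proof -
  assume F: "(F, l) \<in> C"
  have "(\<integral>x. 0 \<partial>M) < (\<integral>x. exp (F x) \<partial>M)"
    by (rule integral_less_AE_space) (use integrable_exp[OF F] emeasure_space_1 in auto)
  then show ?thesis by simp
qed

definition dual_value :: real where
  "dual_value = (SUP (F, l)\<in>C. l - ln (\<integral>x. exp (F x) \<partial>M))"

lemma bdd_above_dual: "bdd_above ((\<lambda>(F, l). l - ln (\<integral>x. exp (F x) \<partial>M)) ` C)"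
  by (rule bdd_aboveI2[of _ _ S]) (auto intro: upper)

lemma dual_value_upper: "(F, l) \<in> C \<Longrightarrow> l - ln (\<integral>x. exp (F x) \<partial>M) \<le> dual_value"
  unfolding dual_value_def by (rule cSUP_upper2[OF bdd_above_dual, of "(F, l)"]) auto

lemma dual_value_le: "dual_value \<le> S"
  unfolding dual_value_def using const by (intro cSUP_least) (auto intro: upper)

text \<open>Supplies the continuity that makes a best multiple in \<open>[0,1]\<close>
  exist.\<close>

lemma continuous_exp_scaled:
  assumes G: "(G, m) \<in> C"
  shows "continuous_on {0..1} (\<lambda>c. \<integral>x. exp (c * G x) \<partial>M)"
proof (rule continuous_on_sequentiallyI)
  fix u :: "nat \<Rightarrow> real" and c assume u: "\<forall>n. u n \<in> {0..1}" "u \<longlonglongrightarrow> c"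
  obtain K where K: "\<forall>x\<in>space M. \<bar>G x\<bar> \<le> K" using bounded[OF G] by auto
  have [measurable]: "G \<in> borel_measurable M" by (rule meas[OF G])
  show "(\<lambda>n. \<integral>x. exp (u n * G x) \<partial>M) \<longlonglongrightarrow> (\<integral>x. exp (c * G x) \<partial>M)"
  proof (rule integral_dominated_convergence[where w="\<lambda>_. exp K"])
    show "AE x in M. (\<lambda>n. exp (u n * G x)) \<longlonglongrightarrow> exp (c * G x)"
      using u by (intro AE_I2 tendsto_intros)
    fix n
    have "u n * G x \<le> K" if "x \<in> space M" for x
    proof -
      have "u n * G x \<le> u n * \<bar>G x\<bar>" using u by (intro mult_left_mono) auto
      also have "\<dots> \<le> 1 * \<bar>G x\<bar>" using u by (intro mult_right_mono) auto
      finally show ?thesis using K that by force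
    qed
    then show "AE x in M. norm (exp (u n * G x)) \<le> exp K" by (intro AE_I2) auto
  qed auto
qed

text \<open>Rescaling a competitor to the best multiple in \<open>[0,1]\<close> bounds the entropy of its Gibbs measure
  by the value of the dual problem.\<close>

lemma good_competitor:
  assumes "0 < e"
  obtains F l where "(F, l) \<in> C" "(\<integral>x. exp (F x) \<partial>M) = 1" "dual_value - e < l"
    "(\<integral>x. exp (F x) * F x \<partial>M) \<le> l"
proof -
  have "\<exists>p\<in>C. dual_value - e < (case p of (F, l) \<Rightarrow> l - ln (\<integral>x. exp (F x) \<partial>M))"
    using assms const by (subst less_cSUP_iff[OF _ bdd_above_dual, symmetric])
      (auto simp: dual_value_def[symmetric])
  then obtain G m where G: "(G, m) \<in> C" and m: "dual_value - e < m - ln (\<integral>x. exp (G x) \<partial>M)"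
    by auto
  have [measurable]: "G \<in> borel_measurable M" by (rule meas[OF G])
  obtain K where K: "\<forall>x\<in>space M. \<bar>G x\<bar> \<le> K" using bounded[OF G] by auto
  define Z where "Z c = (\<integral>x. exp (c * G x) \<partial>M)" for c
  have cG: "(\<lambda>x. c * G x, c * m) \<in> C" for c
    using linear[OF G G, of c 0] by simp
  have Z: "0 < Z c" for c unfolding Z_def by (rule exp_expectation_pos[OF cG])
  have "continuous_on {0..1} (\<lambda>c. c * m - ln (Z c))"
    using continuous_exp_scaled[OF G] Z unfolding Z_def[symmetric]
    by (intro continuous_intros) (auto simp: less_imp_neq[symmetric])
  \<comment> \<open>Comparing \<open>c\<close> with \<open>b = 1\<close> preserves the
    near-optimality of \<open>G\<close>; comparing it with \<open>b = c - u\<close> is the first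
    order condition used below.\<close>
  then obtain c where c: "c \<in> {0..1}" and max: "\<And>b. b \<in> {0..1} \<Longrightarrow> b * m - ln (Z b) \<le> c * m - ln (Z c)"
    using continuous_attains_sup[of "{0..1::real}" "\<lambda>c. c * m - ln (Z c)"] by auto
  \<comment> \<open>Subtracting the constant \<open>ln (Z c)\<close> in both components leaves the
    functional unchanged and turns \<open>exp F\<close> into a probability density.\<close>
  define k where "k = ln (Z c)"
  define F where "F x = c * G x - k" for x
  define l where "l = c * m - k"
  have F: "(F, l) \<in> C"
    using linear[OF cG[of c] const[of k], of 1 "-1"] by (simp add: F_def[abs_def] l_def)
  have exp_F: "exp (F x) = exp (c * G x) / Z c" for x
    using Z[of c] by (simp add: F_def exp_diff k_def)
  have F1: "(\<integral>x. exp (F x) \<partial>M) = 1"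
    using Z[of c] by (simp add: exp_F Z_def)
  have "dual_value - e < l"
    using m max[of 1] by (simp add: l_def k_def Z_def)
  moreover have "(\<integral>x. exp (F x) * F x \<partial>M) \<le> l"
  proof -
    \<comment> \<open>Only a decrease of the multiple is sure to stay in \<open>[0,1]\<close>, so an
      inequality is all that optimality yields; for \<open>c = 0\<close> both sides vanish.\<close>
    have le: "c * (\<integral>x. exp (F x) * G x \<partial>M) \<le> c * m"
    proof (cases "c = 0")
      case False
      with c have c: "0 < c" "c \<le> 1" by auto
      have "(\<integral>x. exp (F x) * G x \<partial>M) \<le> m"
      proof (rule expectation_le_of_exp_bounds[OF integrable_exp[OF F] _ F1 _ _ c(1)])
        fix u assume u: "0 < u" "u \<le> c"
        have "(\<integral>x. exp (F x) * exp (- u * G x) \<partial>M) = (\<integral>x. exp ((c - u) * G x) / Z c \<partial>M)"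
          by (intro Bochner_Integration.integral_cong refl)
            (simp add: exp_F exp_add[symmetric] algebra_simps flip: exp_add)
        then have q: "(\<integral>x. exp (F x) * exp (- u * G x) \<partial>M) = Z (c - u) / Z c"
          by (simp add: Z_def)
        have "(c - u) * m - ln (Z (c - u)) \<le> c * m - ln (Z c)"
          using u c by (intro max) auto
        then have "- ln (Z (c - u) / Z c) \<le> u * m"
          using Z[of c] Z[of "c - u"] by (simp add: ln_divide_pos algebra_simps)
        moreover have "ln (Z (c - u) / Z c) \<le> Z (c - u) / Z c - 1"
          using Z by (intro ln_le_minus_one) auto
        ultimately show "1 - (\<integral>x. exp (F x) * exp (- u * G x) \<partial>M) \<le> u * m"
          unfolding q by linarith
      qed (use K in auto)
      then show ?thesis using c by simp
    qed simp
    have int: "integrable M (\<lambda>x. exp (F x) * G x)"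
      by (rule integrable_mult_bounded[OF integrable_exp[OF F]]) (use K in auto)
    have "(\<integral>x. exp (F x) * F x \<partial>M) = c * (\<integral>x. exp (F x) * G x \<partial>M) - k"
    proof -
      have "(\<integral>x. exp (F x) * F x \<partial>M) = (\<integral>x. c * (exp (F x) * G x) - k * exp (F x) \<partial>M)"
        by (intro Bochner_Integration.integral_cong refl) (simp add: F_def algebra_simps)
      then show ?thesis
        using integrable_exp[OF F] F1 int by simp
    qed
    with le show ?thesis by (simp add: l_def)
  qed
  ultimately show ?thesis using that F F1 by blast
qed

text \<open>The square roots of the densities of a maximizing sequence form a Cauchy sequence in \<open>L\<^sup>2\<close>:
  the midpoint of two good competitors cannot exceed the dual value.\<close>

lemma hellinger_bound:
  assumes F: "(F, l) \<in> C" "(\<integral>x. exp (F x) \<partial>M) = 1" "dual_value - e < l"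
    and G: "(G, m) \<in> C" "(\<integral>x. exp (G x) \<partial>M) = 1" "dual_value - e < m"
  shows "integrable M (\<lambda>x. (exp (F x / 2) - exp (G x / 2))\<^sup>2)"
    and "(\<integral>x. (exp (F x / 2) - exp (G x / 2))\<^sup>2 \<partial>M) \<le> 2 * e"
proof -
  have FG: "(\<lambda>x. 1/2 * F x + 1/2 * G x, 1/2 * l + 1/2 * m) \<in> C"
    by (rule linear[OF F(1) G(1)])
  let ?A = "\<integral>x. exp (1/2 * F x + 1/2 * G x) \<partial>M"
  have "1/2 * l + 1/2 * m - ln ?A \<le> dual_value"
    by (rule dual_value_upper[OF FG])
  then have "- e \<le> ln ?A" using F(3) G(3) by simp
  also have "\<dots> \<le> ?A - 1" by (rule ln_le_minus_one[OF exp_expectation_pos[OF FG]])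
  finally have A: "1 - e \<le> ?A" by simp
  have eq: "(exp (F x / 2) - exp (G x / 2))\<^sup>2 = exp (F x) + exp (G x) - 2 * exp (1/2 * F x + 1/2 * G x)" for x
  proof -
    have "exp (F x) = (exp (F x / 2))\<^sup>2" "exp (G x) = (exp (G x / 2))\<^sup>2"
      by (simp_all add: power2_eq_square flip: exp_add)
    moreover have "exp (1/2 * F x + 1/2 * G x) = exp (F x / 2) * exp (G x / 2)"
      by (simp flip: exp_add)
    ultimately show ?thesis by (simp add: power2_diff)
  qed
  note int = integrable_exp[OF F(1)] integrable_exp[OF G(1)] integrable_exp[OF FG]
  show "integrable M (\<lambda>x. (exp (F x / 2) - exp (G x / 2))\<^sup>2)"
    unfolding eq using int by simp
  have "(\<integral>x. (exp (F x / 2) - exp (G x / 2))\<^sup>2 \<partial>M) = 2 - 2 * ?A"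
    unfolding eq using int F(2) G(2) by simp
  with A show "(\<integral>x. (exp (F x / 2) - exp (G x / 2))\<^sup>2 \<partial>M) \<le> 2 * e" by simp
qed

text \<open>With the gap \<open>(1/4) ^ n\<close>, consecutive square roots of densities differ by
  order \<open>(1/2) ^ n\<close> in mean. This is summable, so the whole sequence converges almost
  everywhere and no subsequence has to be chosen.\<close>

lemma minimizing_sequence:
  obtains F :: "nat \<Rightarrow> 'a \<Rightarrow> real" and l :: "nat \<Rightarrow> real" and h :: "'a \<Rightarrow> real"
  where "\<And>n. (F n, l n) \<in> C" "\<And>n. (\<integral>x. exp (F n x) \<partial>M) = 1" "\<And>n. dual_value - (1/4) ^ n < l n"
    "\<And>n. (\<integral>x. exp (F n x) * F n x \<partial>M) \<le> l n"
    "h \<in> borel_measurable M" "AE x in M. (\<lambda>n. exp (F n x / 2)) \<longlonglongrightarrow> h x"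
proof -
  have "\<exists>F l. (F, l) \<in> C \<and> (\<integral>x. exp (F x) \<partial>M) = 1 \<and> dual_value - (1/4) ^ n < l
      \<and> (\<integral>x. exp (F x) * F x \<partial>M) \<le> l" for n :: nat
    using good_competitor[of "(1/4) ^ n"] by (metis zero_less_divide_1_iff zero_less_numeral zero_less_power)
  then obtain F l where F: "\<And>n. (F n, l n) \<in> C" "\<And>n. (\<integral>x. exp (F n x) \<partial>M) = 1"
    "\<And>n. dual_value - (1/4) ^ n < l n" "\<And>n. (\<integral>x. exp (F n x) * F n x \<partial>M) \<le> l n"
    by metis
  have [measurable]: "F n \<in> borel_measurable M" for n by (rule meas[OF F(1)])
  define g where "g n x = exp (F n x / 2)" for n x
  have [measurable]: "g n \<in> borel_measurable M" for n unfolding g_def by measurable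
  have L1: "(\<integral>\<^sup>+x. ennreal \<bar>g (Suc n) x - g n x\<bar> \<partial>M) \<le> ennreal (2 * (1/2) ^ n)" for n
  proof -
    have "dual_value - (1/4) ^ n < l (Suc n)"
      using F(3)[of "Suc n"] by (simp add: field_simps)
    note H = hellinger_bound[OF F(1,2) this F(1,2,3), folded g_def]
    \<comment> \<open>The arithmetic-geometric mean inequality with weight \<open>2 ^ n\<close>: the
      squared term has integral of order \<open>(1/4) ^ n\<close>, so both summands come out of
      order \<open>(1/2) ^ n\<close>.\<close>
    have amgm: "\<bar>y\<bar> \<le> (2 ^ n * y\<^sup>2 + (1/2) ^ n) / 2" for y :: real
    proof -
      have "0 \<le> (2 ^ n * \<bar>y\<bar> - 1)\<^sup>2 * (1/2) ^ n" by simp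
      also have "\<dots> = 2 ^ n * y\<^sup>2 - 2 * \<bar>y\<bar> + (1/2) ^ n"
        by (simp add: power2_eq_square algebra_simps power_one_over)
      finally show ?thesis by simp
    qed
    have "(\<integral>\<^sup>+x. ennreal \<bar>g (Suc n) x - g n x\<bar> \<partial>M)
        \<le> (\<integral>\<^sup>+x. ennreal ((2 ^ n * (g (Suc n) x - g n x)\<^sup>2 + (1/2) ^ n) / 2) \<partial>M)"
      by (intro nn_integral_mono ennreal_leI amgm)
    also have "\<dots> = ennreal (\<integral>x. (2 ^ n * (g (Suc n) x - g n x)\<^sup>2 + (1/2) ^ n) / 2 \<partial>M)"
      using H(1) by (intro nn_integral_eq_integral) auto
    also have "\<dots> \<le> ennreal (2 * (1/2) ^ n)"
    proof (rule ennreal_leI)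
      have "(\<integral>x. (2 ^ n * (g (Suc n) x - g n x)\<^sup>2 + (1/2) ^ n) / 2 \<partial>M)
        = (2 ^ n * (\<integral>x. (g (Suc n) x - g n x)\<^sup>2 \<partial>M) + (1/2) ^ n) / 2"
        using H(1) by (simp add: prob_space)
      also have "\<dots> \<le> (2 ^ n * (2 * (1/4) ^ n) + (1/2) ^ n) / 2"
        using H(2) by (intro divide_right_mono add_right_mono mult_left_mono) auto
      also have "\<dots> = 3 / 2 * (1/2) ^ n"
      proof -
        have "2 ^ n * (1/4) ^ n = (1/2 :: real) ^ n"
          by (simp flip: power_mult_distrib)
        then show ?thesis by simp
      qed
      also have "\<dots> \<le> 2 * (1/2) ^ n" by simp
      finally show "(\<integral>x. (2 ^ n * (g (Suc n) x - g n x)\<^sup>2 + (1/2) ^ n) / 2 \<partial>M) \<le> 2 * (1/2) ^ n" .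
    qed
    finally show ?thesis .
  qed
  have "(\<integral>\<^sup>+x. (\<Sum>n. ennreal \<bar>g (Suc n) x - g n x\<bar>) \<partial>M) = (\<Sum>n. \<integral>\<^sup>+x. ennreal \<bar>g (Suc n) x - g n x\<bar> \<partial>M)"
    by (rule nn_integral_suminf) simp
  also have "\<dots> \<le> (\<Sum>n. ennreal (2 * (1/2) ^ n))"
    by (intro suminf_le L1) auto
  also have "\<dots> = ennreal (\<Sum>n. 2 * (1/2) ^ n)"
    by (intro suminf_ennreal2) (auto intro!: summable_mult summable_geometric)
  also have "\<dots> < \<infinity>" by simp
  finally have "AE x in M. (\<Sum>n. ennreal \<bar>g (Suc n) x - g n x\<bar>) \<noteq> \<infinity>"
    by (intro nn_integral_PInf_AE) auto
  then have conv: "AE x in M. convergent (\<lambda>n. g n x)"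
  proof eventually_elim
    case (elim x)
    then have "summable (\<lambda>n. \<bar>g (Suc n) x - g n x\<bar>)"
      by (intro summable_suminf_not_top) auto
    then have "summable (\<lambda>n. g (Suc n) x - g n x)"
      by (rule summable_rabs_cancel)
    then have "convergent (\<lambda>n. \<Sum>k<n. g (Suc k) x - g k x)"
      by (simp add: summable_iff_convergent)
    then have "convergent (\<lambda>n. (g n x - g 0 x) + g 0 x)"
      unfolding sum_lessThan_telescope[of "\<lambda>n. g n x"] by (intro convergent_add convergent_const)
    then show ?case by simp
  qed
  define h where "h x = lim (\<lambda>n. g n x)" for x
  have "h \<in> borel_measurable M" unfolding h_def by measurable
  moreover have "AE x in M. (\<lambda>n. g n x) \<longlonglongrightarrow> h x"
    using conv by eventually_elim (simp add: h_def convergent_LIMSEQ_iff)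
  ultimately show ?thesis
    using that[OF F] by (simp add: g_def)
qed

theorem exists_prob_with_expectations:
  "\<exists>Q. prob_space Q \<and> sets Q = sets M \<and> rel_entropy Q M \<le> ereal S
    \<and> (\<forall>F l. (F, l) \<in> C \<longrightarrow> (\<integral>x. F x \<partial>Q) = l)"
proof -
  obtain F l h where F: "\<And>n. (F n, l n) \<in> C" and F1: "\<And>n. (\<integral>x. exp (F n x) \<partial>M) = 1"
    and l: "\<And>n. dual_value - (1/4) ^ n < l n" and Fl: "\<And>n. (\<integral>x. exp (F n x) * F n x \<partial>M) \<le> l n"
    and [measurable]: "h \<in> borel_measurable M" and conv: "AE x in M. (\<lambda>n. exp (F n x / 2)) \<longlonglongrightarrow> h x"
    by (rule minimizing_sequence) blast
  have [measurable]: "F n \<in> borel_measurable M" for n by (rule meas[OF F(1)])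
  define g where "g n x = exp (F n x / 2)" for n x
  have [measurable]: "g n \<in> borel_measurable M" for n unfolding g_def by measurable
  have g2: "(g n x)\<^sup>2 = exp (F n x)" for n x
    by (simp add: g_def power2_eq_square flip: exp_add)
  have int_g2: "integrable M (\<lambda>x. (g n x)\<^sup>2)" for n
    unfolding g2 by (rule integrable_exp[OF F])
  have lim_g: "AE x in M. (\<lambda>n. g n x) \<longlonglongrightarrow> h x"
    using conv by (simp add: g_def)
  \<comment> \<open>Fatou's lemma in \<open>m\<close> passes from pairs of the sequence to the
    limit; for \<open>m \<ge> n\<close> both gaps are at most \<open>(1/4) ^ n\<close>.\<close>
  have nn_L2: "(\<integral>\<^sup>+x. ennreal ((g n x - h x)\<^sup>2) \<partial>M) \<le> ennreal (2 * (1/4) ^ n)" for n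
  proof -
    have "AE x in M. ennreal ((g n x - h x)\<^sup>2) = liminf (\<lambda>m. ennreal ((g n x - g m x)\<^sup>2))"
      using lim_g
    proof eventually_elim
      case (elim x)
      then have "(\<lambda>m. ennreal ((g n x - g m x)\<^sup>2)) \<longlonglongrightarrow> ennreal ((g n x - h x)\<^sup>2)"
        by (intro tendsto_ennrealI tendsto_intros)
      then show ?case by (intro lim_imp_Liminf[symmetric]) auto
    qed
    then have "(\<integral>\<^sup>+x. ennreal ((g n x - h x)\<^sup>2) \<partial>M) = (\<integral>\<^sup>+x. liminf (\<lambda>m. ennreal ((g n x - g m x)\<^sup>2)) \<partial>M)"
      by (rule nn_integral_cong_AE)
    also have "\<dots> \<le> liminf (\<lambda>m. \<integral>\<^sup>+x. ennreal ((g n x - g m x)\<^sup>2) \<partial>M)"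
      by (rule nn_integral_liminf) simp
    also have "\<dots> \<le> ennreal (2 * (1/4) ^ n)"
    proof (rule Liminf_le[OF sequentially_bot])
      show "\<forall>\<^sub>F m in sequentially. (\<integral>\<^sup>+x. ennreal ((g n x - g m x)\<^sup>2) \<partial>M) \<le> ennreal (2 * (1/4) ^ n)"
        using eventually_ge_at_top[of n]
      proof eventually_elim
        case (elim m)
        have "(1/4) ^ m \<le> (1/4 :: real) ^ n" using elim by (intro power_decreasing) auto
        then have "dual_value - (1/4) ^ n < l m" using l[of m] by linarith
        note H = hellinger_bound[OF F F1 l[of n] F F1 this, folded g_def]
        then show ?case by (subst nn_integral_eq_integral) (auto intro: ennreal_leI)
      qed
    qed
    finally show ?thesis .
  qed
  have int_d: "integrable M (\<lambda>x. (g n x - h x)\<^sup>2)" for n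
    using nn_L2[of n] by (intro integrableI_nonneg) (auto intro: order_le_less_trans)
  have L2: "(\<integral>x. (g n x - h x)\<^sup>2 \<partial>M) \<le> 2 * (1/4) ^ n" for n
    using nn_L2[of n] int_d[of n] by (subst (asm) nn_integral_eq_integral) (auto simp: ennreal_le_iff)
  define q where "q x = (h x)\<^sup>2" for x
  have [measurable]: "q \<in> borel_measurable M" unfolding q_def by measurable
  have q: "0 \<le> q x" for x by (simp add: q_def)
  have int_q: "integrable M q"
  proof (rule Bochner_Integration.integrable_bound[where f="\<lambda>x. 2 * (g 0 x)\<^sup>2 + 2 * (g 0 x - h x)\<^sup>2"])
    show "AE x in M. norm (q x) \<le> norm (2 * (g 0 x)\<^sup>2 + 2 * (g 0 x - h x)\<^sup>2)"
    proof (rule AE_I2)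
      fix x
      have "0 \<le> (2 * g 0 x - h x)\<^sup>2" by simp
      then show "norm (q x) \<le> norm (2 * (g 0 x)\<^sup>2 + 2 * (g 0 x - h x)\<^sup>2)"
        by (simp add: q_def power2_eq_square algebra_simps)
    qed
  qed (use int_d int_g2 in auto)
  \<comment> \<open>The difference of squares is \<open>(g - h) * (g + h)\<close>; split the product
    with weight \<open>2 ^ n\<close>. The \<open>7\<close> is \<open>(2 + 12) / 2\<close>, where
    \<open>12 = 2 * 2 + 8\<close> stems from
    \<open>(g + h)\<^sup>2 \<le> 2 * (g - h)\<^sup>2 + 8 * g\<^sup>2\<close>.\<close>
  have L1: "(\<integral>x. \<bar>(g n x)\<^sup>2 - q x\<bar> \<partial>M) \<le> 7 * (1/2) ^ n" for n
  proof -
    let ?r = "(1/2 :: real) ^ n"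
    have "\<bar>(g n x)\<^sup>2 - q x\<bar> \<le> (2 ^ n * (g n x - h x)\<^sup>2 + ?r * (2 * (g n x - h x)\<^sup>2 + 8 * (g n x)\<^sup>2)) / 2" for x
    proof -
      let ?a = "g n x" and ?d = "g n x - h x"
      have "0 \<le> (2 ^ n * \<bar>?d\<bar> - \<bar>?a + h x\<bar>)\<^sup>2 * ?r" by simp
      also have "\<dots> = 2 ^ n * \<bar>?d\<bar>\<^sup>2 - 2 * (\<bar>?d\<bar> * \<bar>?a + h x\<bar>) + ?r * \<bar>?a + h x\<bar>\<^sup>2"
      proof -
        have *: "2 ^ n * ?r = 1" by (simp add: power_one_over)
        have "(2 ^ n * y - z)\<^sup>2 * ?r = (2 ^ n * ?r) * (2 ^ n * y\<^sup>2 - 2 * (y * z)) + ?r * z\<^sup>2" for y z :: real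
          by (simp only: power2_eq_square) (simp only: algebra_simps)
        then show ?thesis unfolding * by simp
      qed
      also have "\<bar>?d\<bar> * \<bar>?a + h x\<bar> = \<bar>?a\<^sup>2 - q x\<bar>"
        by (simp add: q_def power2_eq_square algebra_simps flip: abs_mult)
      finally have "2 * \<bar>?a\<^sup>2 - q x\<bar> \<le> 2 ^ n * ?d\<^sup>2 + ?r * (?a + h x)\<^sup>2" by simp
      also have "(?a + h x)\<^sup>2 \<le> 2 * ?d\<^sup>2 + 8 * ?a\<^sup>2"
      proof -
        have "0 \<le> (2 * ?a + ?d)\<^sup>2" by simp
        then show ?thesis by (simp add: power2_eq_square algebra_simps)
      qed
      finally show ?thesis by (simp add: mult_left_mono)
    qed
    then have "(\<integral>x. \<bar>(g n x)\<^sup>2 - q x\<bar> \<partial>M)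
        \<le> (\<integral>x. (2 ^ n * (g n x - h x)\<^sup>2 + ?r * (2 * (g n x - h x)\<^sup>2 + 8 * (g n x)\<^sup>2)) / 2 \<partial>M)"
      using int_q int_d[of n] int_g2[of n] by (intro integral_mono) auto
    also have "\<dots> = (2 ^ n * (\<integral>x. (g n x - h x)\<^sup>2 \<partial>M) + ?r * (2 * (\<integral>x. (g n x - h x)\<^sup>2 \<partial>M) + 8)) / 2"
      using int_d[of n] int_g2[of n] F1[of n] by (simp add: g2)
    also have "\<dots> \<le> (2 ^ n * (2 * (1/4) ^ n) + ?r * (2 * 2 + 8)) / 2"
    proof -
      have "(1/4 :: real) ^ n \<le> 1" by (intro power_le_one) auto
      then have "(\<integral>x. (g n x - h x)\<^sup>2 \<partial>M) \<le> 2" using L2[of n] by linarith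
      then show ?thesis
        using L2[of n] by (intro divide_right_mono add_mono mult_left_mono) auto
    qed
    also have "2 ^ n * (2 * (1/4) ^ n) = 2 * ?r"
      by (simp flip: power_mult_distrib)
    finally show ?thesis by simp
  qed
  \<comment> \<open>The densities converge in mean, so every bounded measurable test function passes
    to the limit.\<close>
  have weak: "(\<lambda>n. \<integral>x. exp (F n x) * Y x \<partial>M) \<longlonglongrightarrow> (\<integral>x. q x * Y x \<partial>M)"
    if [measurable]: "Y \<in> borel_measurable M" and K: "\<And>x. x \<in> space M \<Longrightarrow> \<bar>Y x\<bar> \<le> K" for Y K
  proof (rule LIM_zero_cancel, rule Lim_null_comparison)
    have K0: "0 \<le> K" using K not_empty by (meson abs_ge_zero equals0I order_trans)
    have "\<bar>(\<integral>x. exp (F n x) * Y x \<partial>M) - (\<integral>x. q x * Y x \<partial>M)\<bar> \<le> K * (7 * (1/2) ^ n)" for n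
    proof -
      have int: "integrable M (\<lambda>x. exp (F n x) * Y x)" "integrable M (\<lambda>x. q x * Y x)"
        by (rule integrable_mult_bounded[OF integrable_exp[OF F] that(1) K] integrable_mult_bounded[OF int_q that(1) K]; assumption)+
      have "\<bar>(\<integral>x. exp (F n x) * Y x \<partial>M) - (\<integral>x. q x * Y x \<partial>M)\<bar>
          = \<bar>\<integral>x. ((g n x)\<^sup>2 - q x) * Y x \<partial>M\<bar>"
        using int by (simp add: g2 left_diff_distrib)
      also have "\<dots> \<le> (\<integral>x. \<bar>((g n x)\<^sup>2 - q x) * Y x\<bar> \<partial>M)"
        by (rule integral_abs_bound)
      also have "\<dots> \<le> (\<integral>x. K * \<bar>(g n x)\<^sup>2 - q x\<bar> \<partial>M)"
      proof (rule integral_mono)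
        show "integrable M (\<lambda>x. \<bar>((g n x)\<^sup>2 - q x) * Y x\<bar>)"
          using int by (simp add: g2 left_diff_distrib)
        show "\<bar>((g n x)\<^sup>2 - q x) * Y x\<bar> \<le> K * \<bar>(g n x)\<^sup>2 - q x\<bar>" if "x \<in> space M" for x
          using K[OF that] by (simp add: abs_mult mult.commute mult_right_mono)
      qed (use int_q int_g2[of n] in auto)
      also have "\<dots> \<le> K * (7 * (1/2) ^ n)"
        using L1[of n] K0 by (simp add: mult_left_mono)
      finally show ?thesis .
    qed
    then show "\<forall>\<^sub>F n in sequentially. norm ((\<integral>x. exp (F n x) * Y x \<partial>M) - (\<integral>x. q x * Y x \<partial>M))
        \<le> K * (7 * (1/2) ^ n)"
      by simp
    show "(\<lambda>n. K * (7 * (1/2) ^ n)) \<longlonglongrightarrow> 0"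
      by (intro tendsto_mult_right_zero LIMSEQ_power_zero) simp
  qed
  have q1: "(\<integral>x. q x \<partial>M) = 1"
    using weak[of "\<lambda>_. 1" 1] F1 by (simp add: LIMSEQ_const_iff)
  \<comment> \<open>Adding \<open>G\<close> to \<open>F n\<close> can improve on the value
    \<open>l n\<close> by at most the gap \<open>(1/4) ^ n\<close>. This bounds an exponential
    moment of \<open>G\<close> from below, and \<open>weak\<close> carries the bound to the
    limit.\<close>
  have exp_le: "exp m \<le> (\<integral>x. q x * exp (G x) \<partial>M)" if G: "(G, m) \<in> C" for G m
  proof (rule LIMSEQ_le)
    obtain K where K: "\<forall>x\<in>space M. \<bar>G x\<bar> \<le> K" using bounded[OF G] by auto
    have [measurable]: "G \<in> borel_measurable M" by (rule meas[OF G])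
    show "(\<lambda>n. \<integral>x. exp (F n x) * exp (G x) \<partial>M) \<longlonglongrightarrow> (\<integral>x. q x * exp (G x) \<partial>M)"
      by (rule weak[of _ "exp K"]) (use K in \<open>auto simp: abs_le_iff\<close>)
    have "(\<lambda>n. exp (m - (1/4) ^ n)) \<longlonglongrightarrow> exp (m - 0)"
      by (intro tendsto_intros LIMSEQ_power_zero) simp
    then show "(\<lambda>n. exp (m - (1/4) ^ n)) \<longlonglongrightarrow> exp m" by simp
    show "\<exists>N. \<forall>n\<ge>N. exp (m - (1/4) ^ n) \<le> (\<integral>x. exp (F n x) * exp (G x) \<partial>M)"
    proof (intro exI allI impI)
      fix n
      have FG: "(\<lambda>x. F n x + G x, l n + m) \<in> C"
        using linear[OF F[of n] G, of 1 1] by simp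
      have "m - (1/4) ^ n \<le> ln (\<integral>x. exp (F n x + G x) \<partial>M)"
        using dual_value_upper[OF FG] l[of n] by linarith
      then show "exp (m - (1/4) ^ n) \<le> (\<integral>x. exp (F n x) * exp (G x) \<partial>M)"
        using exp_expectation_pos[OF FG] by (simp add: ln_ge_iff exp_add)
    qed
  qed
  \<comment> \<open>Apply \<open>exp_le\<close> to \<open>- u * G\<close>, use
    \<open>exp (- u * m) \<ge> 1 - u * m\<close>, and differentiate at \<open>u = 0\<close>. The
    reverse inequality comes from \<open>- G\<close>.\<close>
  have le: "(\<integral>x. q x * G x \<partial>M) \<le> m" if G: "(G, m) \<in> C" for G m
  proof -
    obtain K where K: "\<forall>x\<in>space M. \<bar>G x\<bar> \<le> K" using bounded[OF G] by auto
    show ?thesis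
    proof (rule expectation_le_of_exp_bounds[OF int_q q q1 meas[OF G], where \<delta>=1])
      fix u :: real
      have "(\<lambda>x. - u * G x, - u * m) \<in> C" using linear[OF G G, of "-u" 0] by simp
      from exp_le[OF this] show "1 - (\<integral>x. q x * exp (- u * G x) \<partial>M) \<le> u * m"
        using exp_ge_add_one_self[of "- u * m"] by simp
    qed (use K in auto)
  qed
  have eq: "(\<integral>x. q x * G x \<partial>M) = m" if G: "(G, m) \<in> C" for G m
  proof -
    have "(\<lambda>x. - G x, - m) \<in> C" using linear[OF G G, of "-1" 0] by simp
    from le[OF this] le[OF G] show ?thesis by simp
  qed
  let ?Q = "density M q"
  have prob: "prob_space ?Q"
    using int_q q q1 by (intro prob_spaceI) (simp add: emeasure_density nn_integral_eq_integral cong: nn_integral_cong)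
  have ent_le: "(\<integral>\<^sup>+x. ennreal (entropy_fun (q x)) \<partial>M) \<le> ennreal S"
  proof -
    have "AE x in M. ennreal (entropy_fun (q x)) = liminf (\<lambda>n. ennreal (entropy_fun (exp (F n x))))"
      using lim_g
    proof eventually_elim
      case (elim x)
      then have "(\<lambda>n. exp (F n x)) \<longlonglongrightarrow> q x"
        unfolding g2[symmetric] q_def by (intro tendsto_intros)
      then have "(\<lambda>n. ennreal (entropy_fun (exp (F n x)))) \<longlonglongrightarrow> ennreal (entropy_fun (q x))"
        by (intro tendsto_ennrealI tendsto_entropy_fun) auto
      then show ?case by (intro lim_imp_Liminf[symmetric]) auto
    qed
    then have "(\<integral>\<^sup>+x. ennreal (entropy_fun (q x)) \<partial>M)
        = (\<integral>\<^sup>+x. liminf (\<lambda>n. ennreal (entropy_fun (exp (F n x)))) \<partial>M)"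
      by (rule nn_integral_cong_AE)
    also have "\<dots> \<le> liminf (\<lambda>n. \<integral>\<^sup>+x. ennreal (entropy_fun (exp (F n x))) \<partial>M)"
      by (rule nn_integral_liminf) simp
    also have "\<dots> \<le> ennreal S"
    proof (rule Liminf_le[OF sequentially_bot], rule always_eventually, rule allI)
      fix n
      obtain K where K: "\<forall>x\<in>space M. \<bar>F n x\<bar> \<le> K" using bounded[OF F] by blast
      have int: "integrable M (\<lambda>x. exp (F n x) * F n x)"
        by (rule integrable_mult_bounded[OF integrable_exp[OF F]]) (use K in auto)
      have "(\<integral>\<^sup>+x. ennreal (entropy_fun (exp (F n x))) \<partial>M) = ennreal (\<integral>x. entropy_fun (exp (F n x)) \<partial>M)"
      proof (rule nn_integral_eq_integral)
        show "AE x in M. 0 \<le> entropy_fun (exp (F n x))" by (simp add: entropy_fun_nonneg)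
      qed (use int integrable_exp[OF F[of n]] in \<open>simp add: entropy_fun_def\<close>)
      also have "(\<integral>x. entropy_fun (exp (F n x)) \<partial>M) = (\<integral>x. exp (F n x) * F n x \<partial>M)"
        using int integrable_exp[OF F[of n]] F1[of n] by (simp add: entropy_fun_def prob_space)
      also have "ennreal \<dots> \<le> ennreal S"
        using Fl[of n] dual_value_upper[OF F[of n]] F1[of n] dual_value_le by (intro ennreal_leI) simp
      finally show "(\<integral>\<^sup>+x. ennreal (entropy_fun (exp (F n x))) \<partial>M) \<le> ennreal S" .
    qed
    finally show ?thesis .
  qed
  \<comment> \<open>\<open>ennreal\<close> truncates negative numbers, so the return to
    \<open>ereal\<close> needs this sign; the zero functional provides it.\<close>
  have "0 \<le> S" using upper[OF const[of 0]] by (simp add: prob_space)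
  then have "rel_entropy ?Q M \<le> ereal S"
    using ent_le rel_entropy_prob_density[OF prob_space_axioms _ q prob]
    by (metis \<open>q \<in> borel_measurable M\<close> enn2ereal_ennreal less_eq_ennreal.rep_eq)
  moreover have "(\<integral>x. G x \<partial>?Q) = m" if "(G, m) \<in> C" for G m
    using eq[OF that] meas[OF that] q by (subst integral_density) auto
  ultimately show ?thesis using prob by (intro exI[of _ ?Q]) auto
qed

end

section \<open>The state space and the path space\<close>

lemma torus_proj_add_eq:
  obtains z :: "real ^ 'n" where "torus_proj x = x + z"
    "\<And>y. torus_proj (y + z) = torus_proj y" "\<And>y. torus_proj (y - z) = torus_proj y"
proof -
  define z :: "real ^ 'n" where "z = (\<chi> i. - of_int \<lfloor>x $ i\<rfloor>)"
  have "frac (a - of_int k) = frac a" "frac (a + of_int k) = frac a" for a :: real and k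
    by (simp_all add: frac_def)
  then show ?thesis
    by (intro that[of z]) (auto simp: z_def torus_proj_def vec_eq_iff frac_def)
qed

text \<open>A common interface to both state spaces: projecting a point translates it by a period of
  the projection. In the Euclidean case the period is \<open>0\<close>.\<close>

lemma proj_add_eq:
  obtains z where "proj X x = x + z"
    "\<And>y. proj X (y + z) = proj X y" "\<And>y. proj X (y - z) = proj X y"
proof (cases X)
  case Torus
  then show ?thesis using torus_proj_add_eq that by (auto simp: proj_def)
next
  case Euclidean
  then show ?thesis using that[of 0] by (simp add: proj_def)
qed

lemma proj_proj [simp]: "proj X (proj X x) = proj X x"
  using proj_add_eq[of X x] by metis

lemma quotient_map_proj: "quotient_map euclidean (topo X) (proj X)"
proof (cases X)
  case Torus
  then show ?thesis using quotient_map_torus_proj by (simp add: topo_def proj_def)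
next
  case Euclidean
  then show ?thesis by (simp add: topo_def proj_def quotient_map_def)
qed

lemma topspace_topo: "topspace (topo X) = range (proj X)"
  using quotient_imp_surjective_map[OF quotient_map_proj, symmetric] by simp

lemma openin_topo_subset: "openin (topo X) U \<Longrightarrow> U \<subseteq> range (proj X)"
  using openin_subset topspace_topo by metis

section \<open>Borel sets and continuous functions on the state space\<close>

lemma space_borelX: "space (borelX X) = range (proj X)"
  unfolding borelX_def topspace_topo by (subst space_measure_of) (auto dest: openin_topo_subset)

lemma sets_borelX: "sets (borelX X) = sigma_sets (range (proj X)) {U. openin (topo X) U}"
  unfolding borelX_def topspace_topo by (subst sets_measure_of) (auto dest: openin_topo_subset)

lemma openin_in_sets_borelX: "openin (topo X) U \<Longrightarrow> U \<in> sets (borelX X)"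
  by (auto simp: sets_borelX)

lemma measurable_borelXI:
  assumes "\<And>x. x \<in> space M \<Longrightarrow> f x \<in> range (proj X)"
    and "\<And>U. openin (topo X) U \<Longrightarrow> f -` U \<inter> space M \<in> sets M"
  shows "f \<in> M \<rightarrow>\<^sub>M borelX X"
  unfolding borelX_def topspace_topo using assms
  by (intro measurable_measure_of) (auto dest: openin_topo_subset)

lemma continuous_map_borelX_measurable:
  assumes "continuous_map (topo X) euclideanreal f"
  shows "f \<in> borel_measurable (borelX X)"
proof (rule borel_measurableI)
  fix S :: "real set" assume "open S"
  then have "openin (topo X) {x \<in> topspace (topo X). f x \<in> S}"
    using assms by (intro openin_continuous_map_preimage) auto
  then show "f -` S \<inter> space (borelX X) \<in> sets (borelX X)"
    by (auto dest!: openin_in_sets_borelX simp: vimage_def Int_def topspace_topo space_borelX conj_commute)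
qed

lemma measurable_proj [measurable]: "proj X \<in> borel \<rightarrow>\<^sub>M borelX X"
proof (rule measurable_borelXI)
  fix U :: "(real ^ 'n) set" assume "openin (topo X) U"
  then have "openin euclidean {x \<in> topspace euclidean. proj X x \<in> U}"
    using quotient_imp_continuous_map[OF quotient_map_proj] by (intro openin_continuous_map_preimage)
  then show "proj X -` U \<inter> space borel \<in> sets borel"
    by (auto simp: vimage_def)
qed auto

text \<open>On the torus a coordinate jumps from \<open>1\<close> to \<open>0\<close>, so its
  sublevel sets are not open. The slab \<open>0 < x $ i < d\<close> is open, though, and the face
  \<open>x $ i = 0\<close> is the complement of the slab with \<open>d = 1\<close>.\<close>

lemma measurable_torus_coordinate:
  "(\<lambda>x :: real ^ 'n. x $ i) \<in> borel_measurable (borelX Torus)"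
proof (subst borel_measurable_iff_less, rule allI)
  fix c :: real
  have *: "openin flat_torus {x \<in> range torus_proj. 0 < x $ i \<and> x $ i < d}" if "d \<le> 1" for d :: real
  proof -
    have "torus_proj -` {x \<in> range torus_proj. 0 < x $ i \<and> x $ i < d}
        = (\<Union>k. {x :: real ^ 'n. of_int k < x $ i} \<inter> {x. x $ i < of_int k + d})" (is "?L = ?R")
    proof (intro set_eqI iffI)
      fix x assume "x \<in> ?L"
      then show "x \<in> ?R"
        by (auto simp: torus_proj_def frac_def intro!: exI[of _ "\<lfloor>x $ i\<rfloor>"])
    next
      fix x assume "x \<in> ?R"
      then obtain k where k: "of_int k < x $ i" "x $ i < of_int k + d" by auto
      then have "\<lfloor>x $ i\<rfloor> = k" using that by (intro floor_unique) auto
      with k show "x \<in> ?L" by (auto simp: torus_proj_def frac_def)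
    qed
    moreover have "open ?R"
      by (intro open_UN open_Int ballI open_halfspace_component_gt_cart open_halfspace_component_lt_cart)
    ultimately show ?thesis by (auto simp: openin_flat_torus)
  qed
  let ?A = "\<lambda>d. {x \<in> range torus_proj. 0 < (x :: real ^ 'n) $ i \<and> x $ i < d}"
  have A: "?A (min c 1) \<in> sets (borelX Torus)" "?A 1 \<in> sets (borelX Torus)"
    using *[of "min c 1"] *[of 1] by (auto intro!: openin_in_sets_borelX simp: topo_def)
  have sp: "space (borelX Torus) = range torus_proj" by (simp add: space_borelX proj_def)
  have "{x \<in> space (borelX Torus). x $ i < c} = (if c > 0 then ?A (min c 1) \<union> (space (borelX Torus) - ?A 1) else {})"
  proof (intro set_eqI)
    fix x :: "real ^ 'n"
    have "x \<in> range torus_proj \<Longrightarrow> 0 \<le> x $ i \<and> x $ i < 1"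
      by (simp add: range_torus_proj)
    then show "x \<in> {x \<in> space (borelX Torus). x $ i < c}
        \<longleftrightarrow> x \<in> (if c > 0 then ?A (min c 1) \<union> (space (borelX Torus) - ?A 1) else {})"
      unfolding sp by (cases "x \<in> range torus_proj") auto
  qed
  then show "{x \<in> space (borelX Torus). x $ i < c} \<in> sets (borelX Torus)"
    using A by (cases "c > 0") (simp_all only: if_True if_False sets.Un sets.Diff sets.top sets.empty_sets)
qed

text \<open>Transfers Euclidean Borel sets, singletons among them, to the state space, and lets a
  point of it be added to a Brownian increment.\<close>

lemma measurable_ident_borelX [measurable]: "(\<lambda>x. x) \<in> borelX X \<rightarrow>\<^sub>M borel"
proof (cases X)
  case Torus
  have "(\<lambda>x :: real ^ 'n. x) \<in> borel_measurable (borelX Torus)"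
    by (subst borel_measurable_euclidean_space)
      (auto simp: Basis_vec_def inner_axis measurable_torus_coordinate)
  with Torus show ?thesis by simp
next
  case Euclidean
  have "sets (borelX Euclidean) = sets (borel :: (real ^ 'n) measure)"
    by (simp add: borelX_def topo_def borel_def)
  then show ?thesis using Euclidean measurable_ident_sets by blast
qed

text \<open>The distance to the complement of the preimage of \<open>U\<close> is invariant under the lattice, hence
  a function on the quotient.\<close>

lemma openin_positivity_set:
  fixes U :: "(real ^ 'n) set"
  assumes U: "openin (topo X) U"
  obtains f :: "real ^ 'n \<Rightarrow> real" where "continuous_map (topo X) euclideanreal f" "\<And>x. 0 \<le> f x" "\<And>x. f x \<le> 1"
    "U = {x \<in> range (proj X). 0 < f x}"
proof -
  define V where "V = - (proj X -` U)"
  have U_sub: "U \<subseteq> range (proj X)" by (rule openin_topo_subset[OF U])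
  have "openin euclidean {x \<in> topspace euclidean. proj X x \<in> U}"
    using quotient_imp_continuous_map[OF quotient_map_proj] U by (intro openin_continuous_map_preimage)
  then have "open (proj X -` U)" by (simp add: vimage_def)
  then have closed: "closed V" by (simp add: V_def closed_def)
  \<comment> \<open>\<open>infdist\<close> to the empty set is \<open>0\<close>, so the case where
    \<open>U\<close> is the whole space is set to the constant \<open>1\<close>.\<close>
  define f where "f x = (if V = {} then 1 else min 1 (infdist x V))" for x
  have V_le: "infdist (proj X x) V \<le> infdist x V" "infdist x V \<le> infdist (proj X x) V" if V: "V \<noteq> {}" for x
  proof -
    obtain z where z: "proj X x = x + z" "\<And>y. proj X (y + z) = proj X y" "\<And>y. proj X (y - z) = proj X y"
      by (rule proj_add_eq) blast
    have "infdist (x + z) V \<le> dist x y" if "y \<in> V" for y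
      using infdist_le[of "y + z" V "x + z"] that z by (auto simp: V_def)
    then show "infdist (proj X x) V \<le> infdist x V"
      using V by (subst (2) infdist_notempty) (auto intro!: cINF_greatest simp: z)
    have "infdist x V \<le> dist (x + z) y" if "y \<in> V" for y
    proof -
      have "dist x (y - z) = dist (x + z) y" by (simp add: dist_norm algebra_simps)
      then show ?thesis using infdist_le[of "y - z" V x] that z by (auto simp: V_def)
    qed
    then show "infdist x V \<le> infdist (proj X x) V"
      using V by (subst (2) infdist_notempty) (auto intro!: cINF_greatest simp: z)
  qed
  then have f_proj: "f (proj X x) = f x" for x
    using antisym[OF V_le[of x]] by (cases "V = {}") (simp_all add: f_def)
  have f_pos: "0 < f x \<longleftrightarrow> proj X x \<in> U" for x
    using in_closed_iff_infdist_zero[OF closed, of x] infdist_nonneg[of x V]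
    by (cases "V = {}") (auto simp: f_def V_def less_le min_def split: if_splits)
  show ?thesis
  proof (rule that[of f])
    have "continuous_on UNIV f"
      unfolding f_def by (cases "V = {}") (auto intro!: continuous_intros)
    then have "continuous_map euclidean euclideanreal (f \<circ> proj X)"
      by (simp add: o_def f_proj)
    then show "continuous_map (topo X) euclideanreal f"
      using continuous_compose_quotient_map_eq[OF quotient_map_proj] by blast
    show "U = {x \<in> range (proj X). 0 < f x}"
      using U_sub f_pos by (auto simp: f_proj)
  qed (auto simp: f_def infdist_nonneg)
qed

text \<open>The functions \<open>min 1 (k * f)\<close> increase to the indicator. Open sets generate
  the sigma-algebra, so facts about continuous functions become facts about measures.\<close>

lemma openin_indicator_limit:
  fixes U :: "(real ^ 'n) set"
  assumes U: "openin (topo X) U"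
  obtains \<phi> :: "nat \<Rightarrow> real ^ 'n \<Rightarrow> real" where "\<And>k. continuous_map (topo X) euclideanreal (\<phi> k)"
    "\<And>k x. 0 \<le> \<phi> k x" "\<And>k x. \<phi> k x \<le> 1"
    "\<And>x. x \<in> range (proj X) \<Longrightarrow> (\<lambda>k. \<phi> k x) \<longlonglongrightarrow> indicator U x"
proof -
  obtain f :: "real ^ 'n \<Rightarrow> real" where f: "continuous_map (topo X) euclideanreal f" "\<And>x. 0 \<le> f x" "\<And>x. f x \<le> 1"
    "U = {x \<in> range (proj X). 0 < f x}"
    using openin_positivity_set[OF U] by blast
  show ?thesis
  proof (rule that[of "\<lambda>k x. min 1 (real k * f x)"])
    fix x :: "real ^ 'n" assume x: "x \<in> range (proj X)"
    show "(\<lambda>k. min 1 (real k * f x)) \<longlonglongrightarrow> indicator U x"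
    proof (cases "f x > 0")
      case True
      have "\<forall>\<^sub>F k in sequentially. 1 / f x \<le> real k"
        using eventually_ge_at_top[of "nat \<lceil>1 / f x\<rceil>"] by eventually_elim linarith
      then have "\<forall>\<^sub>F k in sequentially. min 1 (real k * f x) = indicator U x"
        by eventually_elim (use True x in \<open>auto simp: f(4) field_simps min_def\<close>)
      then show ?thesis by (rule tendsto_eventually)
    next
      case False
      then have "f x = 0" using f(2)[of x] by simp
      then show ?thesis by (simp add: f(4))
    qed
  qed (use f in \<open>auto intro!: continuous_map_real_min continuous_map_real_mult\<close>)
qed

lemma borelX_measure_eqI:
  fixes M N :: "(real ^ 'n) measure"
  assumes M: "prob_space M" "sets M = sets (borelX X)" and N: "prob_space N" "sets N = sets (borelX X)"
    and eq: "\<And>f. continuous_map (topo X) euclideanreal f \<Longrightarrow> (\<And>x. 0 \<le> f x) \<Longrightarrow> (\<And>x. f x \<le> 1) \<Longrightarrow>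
      (\<integral>x. f x \<partial>M) = (\<integral>x. f x \<partial>N)"
  shows "M = N"
proof -
  interpret M: prob_space M by fact
  interpret N: prob_space N by fact
  note [measurable_cong] = M(2) N(2)
  have sp: "space M = range (proj X)" "space N = range (proj X)"
    using sets_eq_imp_space_eq[OF M(2)] sets_eq_imp_space_eq[OF N(2)] by (simp_all add: space_borelX)
  show ?thesis
  proof (rule measure_eqI_generator_eq[where E="{U. openin (topo X) U}" and \<Omega>="range (proj X)" and A="\<lambda>_. range (proj X)"])
    show "Int_stable {U. openin (topo X) U}" by (auto simp: Int_stable_def)
    show "{U. openin (topo X) U} \<subseteq> Pow (range (proj X))" by (auto dest: openin_topo_subset)
    show "sets M = sigma_sets (range (proj X)) {U. openin (topo X) U}" "sets N = sigma_sets (range (proj X)) {U. openin (topo X) U}"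
      by (simp_all add: M(2) N(2) sets_borelX)
    show "range (\<lambda>_. range (proj X)) \<subseteq> {U. openin (topo X) U}"
      using openin_topspace[of "topo X"] by (auto simp: topspace_topo)
    fix U :: "(real ^ 'n) set" assume "U \<in> {U. openin (topo X) U}"
    then have U: "openin (topo X) U" by simp
    then have [measurable]: "U \<in> sets M" "U \<in> sets N" by (auto simp: M(2) N(2) openin_in_sets_borelX)
    obtain \<phi> :: "nat \<Rightarrow> real ^ 'n \<Rightarrow> real" where \<phi>: "\<And>k. continuous_map (topo X) euclideanreal (\<phi> k)"
      "\<And>k x. 0 \<le> \<phi> k x" "\<And>k x. \<phi> k x \<le> 1" "\<And>x. x \<in> range (proj X) \<Longrightarrow> (\<lambda>k. \<phi> k x :: real) \<longlonglongrightarrow> indicator U x"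
      using openin_indicator_limit[OF U] by blast
    have [measurable]: "\<phi> k \<in> borel_measurable (borelX X)" for k
      by (rule continuous_map_borelX_measurable[OF \<phi>(1)])
    have "(\<lambda>k. \<integral>x. \<phi> k x \<partial>M) \<longlonglongrightarrow> (\<integral>x. indicator U x \<partial>M)"
      by (rule integral_dominated_convergence[where w="\<lambda>_. 1"]) (use \<phi> sp in auto)
    moreover have "(\<lambda>k. \<integral>x. \<phi> k x \<partial>N) \<longlonglongrightarrow> (\<integral>x. indicator U x \<partial>N)"
      by (rule integral_dominated_convergence[where w="\<lambda>_. 1"]) (use \<phi> sp in auto)
    moreover have "(\<integral>x. \<phi> k x \<partial>M) = (\<integral>x. \<phi> k x \<partial>N)" for k
      by (rule eq) (use \<phi> in auto)
    ultimately have "(\<integral>x. indicator U x \<partial>M) = (\<integral>x. indicator U x \<partial>N :: real)"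
      using LIMSEQ_unique by fastforce
    then show "emeasure M U = emeasure N U"
      by (simp add: M.emeasure_eq_measure N.emeasure_eq_measure)
  qed auto
qed

text \<open>Makes \<open>\<mu>\<close> a kernel, so that the mixture \<open>mu_alpha\<close> has its
  intended meaning: the mass of an open set is, as a function of \<open>t\<close>, a pointwise limit
  of continuous functions.\<close>

lemma weakly_continuous_on_measurable:
  fixes \<mu> :: "real \<Rightarrow> (real ^ 'n) measure"
  assumes wc: "weakly_continuous_on X T \<mu>" and \<mu>: "\<forall>t\<in>T. \<mu> t \<in> space (prob_algebra (borelX X))"
  shows "\<mu> \<in> restrict_space borel T \<rightarrow>\<^sub>M prob_algebra (borelX X)"
proof (rule measurable_prob_algebra_generated[OF sets_borelX])
  show "Int_stable {U. openin (topo X) U}" by (auto simp: Int_stable_def)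
  show "{U. openin (topo X) U} \<subseteq> Pow (range (proj X))" by (auto dest: openin_topo_subset)
  show "prob_space (\<mu> t)" "sets (\<mu> t) = sets (borelX X)" if "t \<in> space (restrict_space borel T)" for t
    using \<mu> that by (auto simp: space_prob_algebra space_restrict_space)
  fix U :: "(real ^ 'n) set" assume "U \<in> {U. openin (topo X) U}"
  then have U: "openin (topo X) U" by simp
  obtain \<phi> :: "nat \<Rightarrow> real ^ 'n \<Rightarrow> real" where \<phi>: "\<And>k. continuous_map (topo X) euclideanreal (\<phi> k)"
    "\<And>k x. 0 \<le> \<phi> k x" "\<And>k x. \<phi> k x \<le> 1" "\<And>x. x \<in> range (proj X) \<Longrightarrow> (\<lambda>k. \<phi> k x :: real) \<longlonglongrightarrow> indicator U x"
    using openin_indicator_limit[OF U] by blast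
  have [measurable]: "\<phi> k \<in> borel_measurable (borelX X)" for k
    by (rule continuous_map_borelX_measurable[OF \<phi>(1)])
  have lim: "(\<lambda>k. \<integral>x. \<phi> k x \<partial>\<mu> t) \<longlonglongrightarrow> measure (\<mu> t) U" if t: "t \<in> T" for t
  proof -
    interpret prob_space "\<mu> t" using \<mu> t by (auto simp: space_prob_algebra)
    have s [measurable_cong]: "sets (\<mu> t) = sets (borelX X)" using \<mu> t by (auto simp: space_prob_algebra)
    have [measurable]: "U \<in> sets (\<mu> t)" using U by (simp add: s openin_in_sets_borelX)
    have "(\<lambda>k. \<integral>x. \<phi> k x \<partial>\<mu> t) \<longlonglongrightarrow> (\<integral>x. indicator U x \<partial>\<mu> t)"
      by (rule integral_dominated_convergence[where w="\<lambda>_. 1"])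
        (use \<phi> sets_eq_imp_space_eq[OF s] in \<open>auto simp: space_borelX\<close>)
    then show ?thesis by simp
  qed
  have "bounded (\<phi> k ` topspace (topo X))" for k
    using \<phi> by (intro boundedI[of _ 1]) auto
  then have cont: "continuous_on T (\<lambda>t. \<integral>x. \<phi> k x \<partial>\<mu> t)" for k
    using wc \<phi>(1) by (auto simp: weakly_continuous_on_def)
  have "(\<lambda>t. measure (\<mu> t) U) \<in> borel_measurable (restrict_space borel T)"
  proof (rule borel_measurable_LIMSEQ_real)
    show "(\<lambda>t. \<integral>x. \<phi> k x \<partial>\<mu> t) \<in> borel_measurable (restrict_space borel T)" for k
      by (rule borel_measurable_continuous_on_restrict[OF cont])
    show "(\<lambda>k. \<integral>x. \<phi> k x \<partial>\<mu> t) \<longlonglongrightarrow> measure (\<mu> t) U" if "t \<in> space (restrict_space borel T)" for t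
      using that by (intro lim) (simp add: space_restrict_space)
  qed
  then have "(\<lambda>t. ennreal (measure (\<mu> t) U)) \<in> borel_measurable (restrict_space borel T)" by simp
  then show "(\<lambda>t. emeasure (\<mu> t) U) \<in> borel_measurable (restrict_space borel T)"
  proof (subst measurable_cong)
    fix t assume "t \<in> space (restrict_space borel T)"
    then interpret prob_space "\<mu> t" using \<mu> by (auto simp: space_prob_algebra space_restrict_space)
    show "emeasure (\<mu> t) U = ennreal (measure (\<mu> t) U)" by (rule emeasure_eq_measure)
  qed
qed

section \<open>Paths and the measurability of evaluation\<close>

lemma paths_in_range: "\<omega> \<in> paths X \<Longrightarrow> t \<in> {0..1} \<Longrightarrow> \<omega> t \<in> range (proj X)"
  using continuous_map_image_subset_topspace[of "top_of_set {0..1}" "topo X" \<omega>]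
  by (auto simp: paths_def topspace_topo)

lemma space_path_space: "space (path_space X) = (paths X :: (real \<Rightarrow> real ^ 'n) set)"
proof -
  have "paths X \<subseteq> (\<Pi>\<^sub>E t\<in>{0..1}. range (proj X :: real ^ 'n \<Rightarrow> _))"
  proof
    fix \<omega> :: "real \<Rightarrow> real ^ 'n" assume \<omega>: "\<omega> \<in> paths X"
    then have "\<omega> \<in> extensional {0..1}" by (simp add: paths_def)
    then show "\<omega> \<in> (\<Pi>\<^sub>E t\<in>{0..1}. range (proj X))"
      using paths_in_range[OF \<omega>] by (auto simp: PiE_iff)
  qed
  then show ?thesis
    by (auto simp: path_space_def space_restrict_space space_PiM space_borelX)
qed

lemma measurable_coordinate [measurable]:
  "t \<in> {0..1} \<Longrightarrow> (\<lambda>\<omega>. \<omega> t) \<in> path_space X \<rightarrow>\<^sub>M borelX X"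
  unfolding path_space_def by (intro measurable_restrict_space1 measurable_component_singleton)

lemma path_continuous_on:
  assumes "\<omega> \<in> paths X" "continuous_map (topo X) euclideanreal f"
  shows "continuous_on {0..1} (\<lambda>t. f (\<omega> t))"
  using continuous_map_compose[of "top_of_set {0..1}" "topo X" \<omega> euclideanreal f] assms
  by (simp add: paths_def o_def)

text \<open>The sigma-algebra on paths comes from single coordinates, so joint measurability has to
  come from continuity: rounding the time down to a grid involves countably many coordinates, and
  the grid is refined. A real function positive exactly on \<open>U\<close> reduces the limit to
  real-valued functions.\<close>

lemma measurable_evaluation:
  assumes "T \<subseteq> {0..1}"
  shows "(\<lambda>p. snd p (fst p)) \<in> restrict_space borel T \<Otimes>\<^sub>M path_space X \<rightarrow>\<^sub>M (borelX X :: (real ^ 'n) measure)"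
    (is "_ \<in> ?N \<rightarrow>\<^sub>M _")
proof (rule measurable_borelXI)
  have sp: "space ?N = T \<times> paths X"
    by (simp add: space_pair_measure space_path_space space_restrict_space)
  show range: "snd p (fst p) \<in> range (proj X)" if "p \<in> space ?N" for p
    using that assms by (auto simp: sp intro!: paths_in_range)
  fix U :: "(real ^ 'n) set" assume U: "openin (topo X) U"
  obtain f :: "real ^ 'n \<Rightarrow> real" where f: "continuous_map (topo X) euclideanreal f"
    "\<And>x. 0 \<le> f x" "\<And>x. f x \<le> 1" "U = {x \<in> range (proj X). 0 < f x}"
    using openin_positivity_set[OF U] by blast
  note [measurable] = continuous_map_borelX_measurable[OF f(1)]
  \<comment> \<open>Clamping to \<open>[0,1]\<close> makes the coordinate at \<open>c n i\<close>
    measurable for every integer \<open>i\<close>; for grid points of times in \<open>[0,1]\<close>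
    it changes nothing.\<close>
  define c where "c n i = max 0 (min 1 (real_of_int i / real (Suc n)))" for n :: nat and i :: int
  define g where "g n p = f (snd p (c n \<lfloor>real (Suc n) * fst p\<rfloor>))" for n and p :: "real \<times> (real \<Rightarrow> real ^ 'n)"
  have [measurable]: "fst \<in> borel_measurable ?N"
    using measurable_fst[of "restrict_space borel T" "path_space X"]
      measurable_restrict_space1[OF measurable_ident, of borel T]
      measurable_compose by (fastforce simp: id_def)
  have "g n \<in> borel_measurable ?N" for n
    unfolding g_def
  proof (rule measurable_compose_countable[where f="\<lambda>i p. f (snd p (c n i))"])
    show "(\<lambda>p. f (snd p (c n i))) \<in> borel_measurable ?N" for i
    proof -
      have "c n i \<in> {0..1}" by (auto simp: c_def)
      note [measurable] = measurable_coordinate[OF this, of X]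
      show ?thesis by measurable
    qed
  qed measurable
  moreover have "(\<lambda>n. g n p) \<longlonglongrightarrow> f (snd p (fst p))" if p: "p \<in> space ?N" for p
  proof -
    have t: "fst p \<in> {0..1}" and \<omega>: "snd p \<in> paths X" using p assms by (auto simp: sp)
    let ?t = "fst p"
    have lim: "(\<lambda>n. c n \<lfloor>real (Suc n) * ?t\<rfloor>) \<longlonglongrightarrow> ?t"
    proof (rule tendsto_sandwich)
      have "real_of_int \<lfloor>real (Suc n) * ?t\<rfloor> / real (Suc n) \<ge> ?t - 1 / real (Suc n)" for n
      proof -
        have "(real (Suc n) * ?t - 1) / real (Suc n) \<le> real_of_int \<lfloor>real (Suc n) * ?t\<rfloor> / real (Suc n)" for n
          by (intro divide_right_mono) linarith+
        then show ?thesis by (simp add: diff_divide_distrib)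
      qed
      then show "\<forall>\<^sub>F n in sequentially. ?t - 1 / real (Suc n) \<le> c n \<lfloor>real (Suc n) * ?t\<rfloor>"
        using t by (auto simp: c_def le_max_iff_disj intro!: always_eventually intro: order_trans[of _ ?t])
      have "real_of_int \<lfloor>real (Suc n) * ?t\<rfloor> / real (Suc n) \<le> ?t" for n
        using floor_correct[of "real (Suc n) * ?t"] by (simp add: field_simps)
      then show "\<forall>\<^sub>F n in sequentially. c n \<lfloor>real (Suc n) * ?t\<rfloor> \<le> ?t"
        using t by (auto simp: c_def min_le_iff_disj intro!: always_eventually)
      have "(\<lambda>n. ?t - 1 / real (Suc n)) \<longlonglongrightarrow> ?t - 0"
        by (intro tendsto_intros LIMSEQ_Suc lim_1_over_n)
      then show "(\<lambda>n. ?t - 1 / real (Suc n)) \<longlonglongrightarrow> ?t" by simp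
    qed simp
    show ?thesis
      unfolding g_def
      by (rule continuous_on_tendsto_compose[OF path_continuous_on[OF \<omega> f(1)] lim t]) (simp add: c_def)
  qed
  ultimately have "(\<lambda>p. f (snd p (fst p))) \<in> borel_measurable ?N"
    by (rule borel_measurable_LIMSEQ_real[rotated])
  then have "{p \<in> space ?N. 0 < f (snd p (fst p))} \<in> sets ?N" by measurable
  also have "{p \<in> space ?N. 0 < f (snd p (fst p))} = (\<lambda>p. snd p (fst p)) -` U \<inter> space ?N"
    using range by (auto simp: f(4))
  finally show "(\<lambda>p. snd p (fst p)) -` U \<inter> space ?N \<in> sets ?N" .
qed

lemma measurable_time_space_path:
  assumes "T \<subseteq> {0..1}"
  shows "(\<lambda>(t, \<omega>). (t, \<omega> t)) \<in> restrict_space borel T \<Otimes>\<^sub>M path_space X \<rightarrow>\<^sub>M time_space X T"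
  unfolding time_space_def split_beta by (intro measurable_Pair measurable_fst measurable_evaluation assms)

section \<open>Laws of Brownian motion\<close>

definition bm_path ::
    "flat_space \<Rightarrow> real \<Rightarrow> (real \<Rightarrow> 'w \<Rightarrow> real ^ 'n) \<Rightarrow> real ^ 'n \<Rightarrow> 'w \<Rightarrow> real \<Rightarrow> real ^ 'n" where
  "bm_path X a B x \<omega> = (\<lambda>t\<in>{0..1}. proj X (x + sqrt a *\<^sub>R B t \<omega>))"

lemma bm_law_eq: "bm_law X a M B x = distr M (path_space X) (bm_path X a B x)"
  by (simp add: bm_law_def bm_path_def[abs_def])

context
  fixes M :: "'w measure" and B :: "real \<Rightarrow> 'w \<Rightarrow> real ^ 'n"
  assumes bm: "standard_bm M B"
begin

lemma prob_space_bm: "prob_space M"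
  using bm by (simp add: standard_bm_def)

text \<open>Measurability jointly in the starting point and the sample is what turns
  \<open>bm_law\<close> into a kernel.\<close>

lemma measurable_bm_path: "(\<lambda>(x, \<omega>). bm_path X a B x \<omega>) \<in> borelX X \<Otimes>\<^sub>M M \<rightarrow>\<^sub>M path_space X"
  unfolding path_space_def
proof (rule measurable_restrict_space2)
  show "(\<lambda>(x, \<omega>). bm_path X a B x \<omega>) \<in> space (borelX X \<Otimes>\<^sub>M M) \<rightarrow> paths X"
  proof safe
    fix x :: "real ^ 'n" and \<omega> assume "(x, \<omega>) \<in> space (borelX X \<Otimes>\<^sub>M M)"
    then have "\<omega> \<in> space M" by (simp add: space_pair_measure)
    then have "continuous_on {0..1} (\<lambda>t. x + sqrt a *\<^sub>R B t \<omega>)"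
      using bm by (auto simp: standard_bm_def intro!: continuous_intros)
    then have "continuous_map (top_of_set {0..1}) (topo X) (proj X \<circ> (\<lambda>t. x + sqrt a *\<^sub>R B t \<omega>))"
      using quotient_imp_continuous_map[OF quotient_map_proj]
      by (intro continuous_map_compose[where X'=euclidean]) auto
    then have "continuous_map (top_of_set {0..1}) (topo X) (bm_path X a B x \<omega>)"
      by (rule continuous_map_eq) (auto simp: bm_path_def)
    then show "bm_path X a B x \<omega> \<in> paths X" by (simp add: paths_def bm_path_def)
  qed
  have "B t \<in> borel_measurable M" if "t \<in> {0..1}" for t
    using bm that by (simp add: standard_bm_def)
  then show "(\<lambda>(x, \<omega>). bm_path X a B x \<omega>) \<in> borelX X \<Otimes>\<^sub>M M \<rightarrow>\<^sub>M Pi\<^sub>M {0..1} (\<lambda>t. borelX X)"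
    unfolding bm_path_def split_beta
  proof (intro measurable_restrict)
    fix t :: real assume "t \<in> {0..1}"
    with \<open>\<And>t. t \<in> {0..1} \<Longrightarrow> B t \<in> borel_measurable M\<close> have [measurable]: "B t \<in> borel_measurable M" .
    have [measurable]: "fst \<in> borel_measurable (borelX X \<Otimes>\<^sub>M M)"
      using measurable_compose[OF measurable_fst measurable_ident_borelX] by simp
    show "(\<lambda>p. proj X (fst p + sqrt a *\<^sub>R B t (snd p))) \<in> borelX X \<Otimes>\<^sub>M M \<rightarrow>\<^sub>M borelX X"
      by (rule measurable_compose[OF _ measurable_proj]) measurable
  qed
qed

lemma measurable_bm_path_section:
  "x \<in> range (proj X) \<Longrightarrow> bm_path X a B x \<in> M \<rightarrow>\<^sub>M path_space X"
  using measurable_Pair2[OF measurable_bm_path, of x] by (simp add: space_borelX)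

lemma measurable_bm_law: "bm_law X a M B \<in> borelX X \<rightarrow>\<^sub>M prob_algebra (path_space X)"
proof -
  have "M \<in> space (prob_algebra M)" using prob_space_bm by (simp add: space_prob_algebra)
  then show ?thesis
    unfolding bm_law_eq[abs_def]
    by (rule measurable_distr_prob_space2[OF measurable_const measurable_bm_path])
qed

lemma prob_space_bm_law: "x \<in> range (proj X) \<Longrightarrow> prob_space (bm_law X a M B x)"
  using measurable_space[OF measurable_bm_law, of x] by (simp add: space_prob_algebra space_borelX)

lemma bm_path_0: "x \<in> range (proj X) \<Longrightarrow> \<omega> \<in> space M \<Longrightarrow> bm_path X a B x \<omega> 0 = x"
  using bm by (auto simp: bm_path_def standard_bm_def)

lemma nn_integral_bm_mix:
  assumes "sets m = sets (borelX X)" and f: "f \<in> borel_measurable (path_space X)"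
  shows "(\<integral>\<^sup>+\<omega>. f \<omega> \<partial>bm_mix X a M B m) = (\<integral>\<^sup>+x. \<integral>\<^sup>+\<omega>. f \<omega> \<partial>bm_law X a M B x \<partial>m)"
  unfolding bm_mix_def
  by (rule nn_integral_bind[OF f])
    (use measurable_prob_algebraD[OF measurable_bm_law] assms(1) in \<open>simp cong: measurable_cong_sets\<close>)

end

text \<open>Shifting by \<open>K\<close> makes \<open>f\<close> nonnegative, so that
  \<open>nn_integral_bind\<close> applies; the shift cancels because all measures involved have mass
  one.\<close>

lemma integral_bind_bounded:
  fixes f :: "'b \<Rightarrow> real"
  assumes "prob_space M" and N: "N \<in> M \<rightarrow>\<^sub>M prob_algebra L"
    and [measurable]: "f \<in> borel_measurable L" and K: "\<And>x. x \<in> space L \<Longrightarrow> \<bar>f x\<bar> \<le> K"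
  shows "(\<integral>y. f y \<partial>(M \<bind> N)) = (\<integral>x. \<integral>y. f y \<partial>N x \<partial>M)"
proof -
  interpret M: prob_space M by fact
  note N' [measurable] = measurable_prob_algebraD[OF N]
  have Nx: "prob_space (N x)" "sets (N x) = sets L" if "x \<in> space M" for x
    using measurable_space[OF N that] by (auto simp: space_prob_algebra)
  have prob: "prob_space (M \<bind> N)"
    using Nx by (intro M.prob_space_bind[OF _ N']) auto
  interpret MN: prob_space "M \<bind> N" by (rule prob)
  have sMN [measurable_cong]: "sets (M \<bind> N) = sets L"
    by (rule sets_bind[OF Nx(2) M.not_empty])
  have spMN: "space (M \<bind> N) = space L" by (rule sets_eq_imp_space_eq[OF sMN])
  have int1: "integrable (M \<bind> N) (\<lambda>y. f y)"
    by (rule MN.integrable_const_bound[where B=K]) (use K spMN in auto)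
  have intx: "integrable (N x) (\<lambda>y. f y)" "\<bar>\<integral>y. f y \<partial>N x\<bar> \<le> K" if "x \<in> space M" for x
  proof -
    interpret Nx: prob_space "N x" by (rule Nx[OF that])
    have [measurable]: "f \<in> borel_measurable (N x)"
      using assms(3) by (simp add: Nx(2)[OF that] cong: measurable_cong_sets)
    have sp: "space (N x) = space L" by (rule sets_eq_imp_space_eq[OF Nx(2)[OF that]])
    show int: "integrable (N x) (\<lambda>y. f y)"
      by (rule Nx.integrable_const_bound[where B=K]) (use K sp in auto)
    have "\<bar>\<integral>y. f y \<partial>N x\<bar> \<le> (\<integral>y. \<bar>f y\<bar> \<partial>N x)" by (rule integral_abs_bound)
    also have "\<dots> \<le> (\<integral>y. K \<partial>N x)" using int K sp by (intro integral_mono) auto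
    finally show "\<bar>\<integral>y. f y \<partial>N x\<bar> \<le> K" by (simp add: Nx.prob_space)
  qed
  have [measurable]: "(\<lambda>x. \<integral>y. f y \<partial>N x) \<in> borel_measurable M"
    by (rule measurable_compose[OF N']) measurable
  have int2: "integrable M (\<lambda>x. \<integral>y. f y \<partial>N x)"
    by (rule M.integrable_const_bound[where B=K]) (use intx in auto)
  have "ennreal ((\<integral>y. f y \<partial>(M \<bind> N)) + K) = ennreal (\<integral>y. f y + K \<partial>(M \<bind> N))"
    using int1 by (simp add: MN.prob_space)
  also have "\<dots> = (\<integral>\<^sup>+y. ennreal (f y + K) \<partial>(M \<bind> N))"
    using int1 K spMN by (intro nn_integral_eq_integral[symmetric]) (auto simp: abs_le_iff intro!: AE_I2 dest!: K)
  also have "\<dots> = (\<integral>\<^sup>+x. \<integral>\<^sup>+y. ennreal (f y + K) \<partial>N x \<partial>M)"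
    by (rule nn_integral_bind[OF _ N']) measurable
  also have "\<dots> = (\<integral>\<^sup>+x. ennreal ((\<integral>y. f y \<partial>N x) + K) \<partial>M)"
  proof (intro nn_integral_cong)
    fix x assume x: "x \<in> space M"
    interpret Nx: prob_space "N x" by (rule Nx[OF x])
    have sp: "space (N x) = space L" by (rule sets_eq_imp_space_eq[OF Nx(2)[OF x]])
    have "(\<integral>\<^sup>+y. ennreal (f y + K) \<partial>N x) = ennreal (\<integral>y. f y + K \<partial>N x)"
      using intx[OF x] sp by (intro nn_integral_eq_integral) (auto intro!: AE_I2 dest!: K)
    then show "(\<integral>\<^sup>+y. ennreal (f y + K) \<partial>N x) = ennreal ((\<integral>y. f y \<partial>N x) + K)"
      using intx[OF x] by (simp add: Nx.prob_space)
  qed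
  also have "\<dots> = ennreal (\<integral>x. (\<integral>y. f y \<partial>N x) + K \<partial>M)"
    using int2 by (intro nn_integral_eq_integral) (auto intro!: AE_I2 dest!: intx(2))
  also have "\<dots> = ennreal ((\<integral>x. \<integral>y. f y \<partial>N x \<partial>M) + K)"
    using int2 by (simp add: M.prob_space)
  finally have eq: "ennreal ((\<integral>y. f y \<partial>(M \<bind> N)) + K) = ennreal ((\<integral>x. \<integral>y. f y \<partial>N x \<partial>M) + K)" .
  have "0 \<le> (\<integral>y. f y + K \<partial>(M \<bind> N))"
    using K spMN by (intro integral_nonneg_AE) (auto intro!: AE_I2 dest!: K)
  moreover have "0 \<le> (\<integral>x. (\<integral>y. f y \<partial>N x) + K \<partial>M)"
    by (intro integral_nonneg_AE) (auto intro!: AE_I2 dest!: intx(2))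
  ultimately show ?thesis
    using eq int1 int2 by (simp add: MN.prob_space M.prob_space)
qed

section \<open>The volume measure and mixtures over the starting point\<close>

lemma sets_vol: "sets (vol X) = sets (borelX X :: (real ^ 'n) measure)"
proof (cases X)
  case Euclidean
  have "sets (borelX Euclidean) = sets (borel :: (real ^ 'n) measure)"
    by (simp add: borelX_def topo_def borel_def)
  with Euclidean show ?thesis by (simp add: vol_def)
qed (simp add: vol_def)

lemma sigma_finite_vol: "sigma_finite_measure (vol X :: (real ^ 'n) measure)"
proof (cases X)
  case Torus
  have 0: "emeasure lborel (cbox 0 1 :: (real ^ 'n) set) = 1"
    by (subst emeasure_lborel_cbox) (auto simp: Basis_vec_def inner_axis intro!: prod.neutral)
  then have "prob_space (uniform_measure lborel (cbox 0 1 :: (real ^ 'n) set))"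
    by (intro prob_space_uniform_measure) auto
  moreover have "torus_proj \<in> uniform_measure lborel (cbox 0 1 :: (real ^ 'n) set) \<rightarrow>\<^sub>M borelX Torus"
    using measurable_proj[of Torus] by (simp add: proj_def cong: measurable_cong_sets)
  ultimately have "prob_space (vol Torus :: (real ^ 'n) measure)"
    by (auto simp: vol_def intro: prob_space.prob_space_distr)
  then show ?thesis using Torus prob_space_imp_sigma_finite by blast
next
  case Euclidean
  then show ?thesis by (simp add: vol_def sigma_finite_lborel)
qed

context
  fixes M :: "'w measure" and B :: "real \<Rightarrow> 'w \<Rightarrow> real ^ 'n"
  assumes bm: "standard_bm M B"
begin

lemma sets_bm_mix:
  assumes "sets m = sets (borelX X)"
  shows "sets (bm_mix X a M B m) = sets (path_space X)"
proof -
  have sp: "space m = range (proj X)"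
    using sets_eq_imp_space_eq[OF assms] by (simp add: space_borelX)
  show ?thesis
    unfolding bm_mix_def using sp by (intro sets_bind) (auto simp: bm_law_def)
qed

text \<open>Under the law started at \<open>x\<close> the factor \<open>f (\<omega> 0)\<close> is
  the constant \<open>f x\<close> and leaves the inner integral. Both the initial marginal of a
  mixture and its change under reweighting are instances.\<close>

lemma nn_integral_bm_mix_start:
  assumes m: "sets m = sets (borelX X)"
    and [measurable]: "f \<in> borel_measurable (borelX X)" "g \<in> borel_measurable (path_space X)"
  shows "(\<integral>\<^sup>+\<omega>. f (\<omega> 0) * g \<omega> \<partial>bm_mix X a M B m) = (\<integral>\<^sup>+x. f x * (\<integral>\<^sup>+\<omega>. g \<omega> \<partial>bm_law X a M B x) \<partial>m)"
proof -
  have [measurable]: "(\<lambda>\<omega>. \<omega> 0) \<in> path_space X \<rightarrow>\<^sub>M borelX X" by (rule measurable_coordinate) simp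
  have "(\<integral>\<^sup>+\<omega>. f (\<omega> 0) * g \<omega> \<partial>bm_mix X a M B m) = (\<integral>\<^sup>+x. \<integral>\<^sup>+\<omega>. f (\<omega> 0) * g \<omega> \<partial>bm_law X a M B x \<partial>m)"
    by (rule nn_integral_bm_mix[OF bm m]) measurable
  also have "\<dots> = (\<integral>\<^sup>+x. f x * (\<integral>\<^sup>+\<omega>. g \<omega> \<partial>bm_law X a M B x) \<partial>m)"
  proof (intro nn_integral_cong)
    fix x assume "x \<in> space m"
    then have x: "x \<in> range (proj X)"
      using sets_eq_imp_space_eq[OF m] by (simp add: space_borelX)
    note [measurable] = measurable_bm_path_section[OF bm x]
    have "(\<integral>\<^sup>+\<omega>. f (\<omega> 0) * g \<omega> \<partial>bm_law X a M B x) = (\<integral>\<^sup>+w. f x * g (bm_path X a B x w) \<partial>M)"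
      unfolding bm_law_eq by (subst nn_integral_distr) (auto intro!: nn_integral_cong simp: bm_path_0[OF bm x])
    also have "\<dots> = f x * (\<integral>\<^sup>+\<omega>. g \<omega> \<partial>bm_law X a M B x)"
      unfolding bm_law_eq by (subst nn_integral_distr) (auto simp: nn_integral_cmult)
    finally show "(\<integral>\<^sup>+\<omega>. f (\<omega> 0) * g \<omega> \<partial>bm_law X a M B x) = f x * (\<integral>\<^sup>+\<omega>. g \<omega> \<partial>bm_law X a M B x)" .
  qed
  finally show ?thesis .
qed

lemma nn_integral_bm_law_1: "x \<in> range (proj X) \<Longrightarrow> (\<integral>\<^sup>+\<omega>. 1 \<partial>bm_law X a M B x) = 1"
  using prob_space.emeasure_space_1[OF prob_space_bm_law[OF bm]] by simp

lemma marg_0_bm_mix: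
  assumes m: "sets m = sets (borelX X)"
  shows "marg X (bm_mix X a M B m) 0 = m"
proof (rule measure_eqI)
  fix A assume "A \<in> sets (marg X (bm_mix X a M B m) 0)"
  then have [measurable]: "A \<in> sets (borelX X)" by (simp add: marg_def)
  have A: "A \<in> sets m" by (simp add: m)
  note [measurable_cong] = sets_bm_mix[OF m]
  have [measurable]: "(\<lambda>\<omega>. \<omega> 0) \<in> path_space X \<rightarrow>\<^sub>M borelX X" by (rule measurable_coordinate) simp
  have "emeasure (marg X (bm_mix X a M B m) 0) A = (\<integral>\<^sup>+\<omega>. indicator A (\<omega> 0) * 1 \<partial>bm_mix X a M B m)"
    unfolding marg_def by (subst nn_integral_indicator[symmetric], simp, subst nn_integral_distr) auto
  also have "\<dots> = (\<integral>\<^sup>+x. indicator A x * (\<integral>\<^sup>+\<omega>. 1 \<partial>bm_law X a M B x) \<partial>m)"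
    by (rule nn_integral_bm_mix_start[OF m]) measurable
  also have "\<dots> = (\<integral>\<^sup>+x. indicator A x \<partial>m)"
    using sets_eq_imp_space_eq[OF m] by (intro nn_integral_cong) (auto simp: space_borelX nn_integral_bm_law_1 simp del: nn_integral_const)
  also have "\<dots> = emeasure m A" using A by simp
  finally show "emeasure (marg X (bm_mix X a M B m) 0) A = emeasure m A" .
qed (simp add: marg_def m)

text \<open>The mixture over Lebesgue measure has infinite mass; sigma-finiteness is pulled back
  from its initial marginal, which is \<open>m\<close>.\<close>

lemma sigma_finite_bm_mix:
  assumes m: "sets m = sets (borelX X)" "sigma_finite_measure m"
  shows "sigma_finite_measure (bm_mix X a M B m)"
proof (rule sigma_finite_measure_distr)
  show "sigma_finite_measure (distr (bm_mix X a M B m) (borelX X) (\<lambda>\<omega>. \<omega> 0))"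
    using m(2) marg_0_bm_mix[OF m(1), of a] by (simp add: marg_def)
  show "(\<lambda>\<omega>. \<omega> 0) \<in> bm_mix X a M B m \<rightarrow>\<^sub>M borelX X"
    using measurable_coordinate[of 0 X] by (simp add: sets_bm_mix[OF m(1)] cong: measurable_cong_sets)
qed

lemma prob_space_bm_mix:
  assumes m: "sets m = sets (borelX X)" "prob_space m"
  shows "prob_space (bm_mix X a M B m)"
proof (rule prob_space_distrD)
  show "prob_space (distr (bm_mix X a M B m) (borelX X) (\<lambda>\<omega>. \<omega> 0))"
    using m(2) marg_0_bm_mix[OF m(1), of a] by (simp add: marg_def)
  show "(\<lambda>\<omega>. \<omega> 0) \<in> bm_mix X a M B m \<rightarrow>\<^sub>M borelX X"
    using measurable_coordinate[of 0 X] by (simp add: sets_bm_mix[OF m(1)] cong: measurable_cong_sets)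
qed

lemma density_bm_mix:
  assumes m: "sets m = sets (borelX X)" and [measurable]: "f \<in> borel_measurable (borelX X)"
  shows "bm_mix X a M B (density m f) = density (bm_mix X a M B m) (\<lambda>\<omega>. f (\<omega> 0))"
proof (rule measure_eqI)
  have m': "sets (density m f) = sets (borelX X)" by (simp add: m)
  note [measurable_cong] = sets_bm_mix[OF m] m
  have [measurable]: "(\<lambda>\<omega>. \<omega> 0) \<in> path_space X \<rightarrow>\<^sub>M borelX X" by (rule measurable_coordinate) simp
  show "sets (bm_mix X a M B (density m f)) = sets (density (bm_mix X a M B m) (\<lambda>\<omega>. f (\<omega> 0)))"
    by (simp add: sets_bm_mix m)
  fix A assume "A \<in> sets (bm_mix X a M B (density m f))"
  then have [measurable]: "A \<in> sets (path_space X)" by (simp add: sets_bm_mix m)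
  have K: "(\<lambda>x. \<integral>\<^sup>+\<omega>. indicator A \<omega> \<partial>bm_law X a M B x) \<in> borel_measurable (borelX X)"
    by (rule measurable_compose[OF measurable_prob_algebraD[OF measurable_bm_law[OF bm]]]) measurable
  have "emeasure (bm_mix X a M B (density m f)) A = (\<integral>\<^sup>+\<omega>. indicator A \<omega> \<partial>bm_mix X a M B (density m f))"
    by (simp add: sets_bm_mix m)
  also have "\<dots> = (\<integral>\<^sup>+x. f x * (\<integral>\<^sup>+\<omega>. indicator A \<omega> \<partial>bm_law X a M B x) \<partial>m)"
    using K by (subst nn_integral_bm_mix[OF bm m'], simp, intro nn_integral_density)
      (simp_all add: m cong: measurable_cong_sets)
  also have "\<dots> = (\<integral>\<^sup>+\<omega>. f (\<omega> 0) * indicator A \<omega> \<partial>bm_mix X a M B m)"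
    by (rule nn_integral_bm_mix_start[OF m, symmetric]) measurable
  also have "\<dots> = emeasure (density (bm_mix X a M B m) (\<lambda>\<omega>. f (\<omega> 0))) A"
    by (subst emeasure_density) auto
  finally show "emeasure (bm_mix X a M B (density m f)) A = emeasure (density (bm_mix X a M B m) (\<lambda>\<omega>. f (\<omega> 0))) A" .
qed

end

section \<open>The dual problem\<close>

lemma bounded_measurableD:
  assumes "f \<in> bounded_measurable N"
  shows "f \<in> borel_measurable N" "\<exists>K. \<forall>x\<in>space N. \<bar>f x\<bar> \<le> K"
  using assms by (auto simp: bounded_measurable_def bounded_iff)

lemma bounded_measurableI:
  assumes "f \<in> borel_measurable N" "\<And>x. x \<in> space N \<Longrightarrow> \<bar>f x\<bar> \<le> K"
  shows "f \<in> bounded_measurable N"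
  using assms by (auto simp: bounded_measurable_def bounded_iff)

lemma bounded_measurable_linear:
  assumes "f \<in> bounded_measurable N" "g \<in> bounded_measurable N"
  shows "(\<lambda>x. c * f x + d * g x) \<in> bounded_measurable N"
proof -
  obtain K L where K: "\<forall>x\<in>space N. \<bar>f x\<bar> \<le> K" and L: "\<forall>x\<in>space N. \<bar>g x\<bar> \<le> L"
    using assms[THEN bounded_measurableD(2)] by blast
  have "\<bar>c * f x + d * g x\<bar> \<le> \<bar>c\<bar> * K + \<bar>d\<bar> * L" if "x \<in> space N" for x
  proof -
    have "\<bar>c * f x + d * g x\<bar> \<le> \<bar>c\<bar> * \<bar>f x\<bar> + \<bar>d\<bar> * \<bar>g x\<bar>"
      by (metis abs_mult abs_triangle_ineq)
    also have "\<dots> \<le> \<bar>c\<bar> * K + \<bar>d\<bar> * L"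
      using K L that by (intro add_mono mult_left_mono) auto
    finally show ?thesis .
  qed
  then show ?thesis
    using assms[THEN bounded_measurableD(1)] by (intro bounded_measurableI) auto
qed

lemma (in prob_space) integrable_bounded_measurable:
  assumes "f \<in> bounded_measurable N" "sets M = sets N"
  shows "integrable M f"
proof -
  obtain K where K: "\<forall>x\<in>space N. \<bar>f x\<bar> \<le> K" using bounded_measurableD(2)[OF assms(1)] by blast
  have "f \<in> borel_measurable M"
    using bounded_measurableD(1)[OF assms(1)] by (simp add: assms(2) cong: measurable_cong_sets)
  then show ?thesis
    by (rule integrable_const_bound[where B=K, rotated])
      (use K sets_eq_imp_space_eq[OF assms(2)] in auto)
qed

lemma (in prob_space) abs_expectation_le:
  fixes f :: "'a \<Rightarrow> real"
  assumes "f \<in> borel_measurable M" "\<And>x. x \<in> space M \<Longrightarrow> \<bar>f x\<bar> \<le> K"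
  shows "\<bar>expectation f\<bar> \<le> K"
proof -
  have int: "integrable M f"
    by (rule integrable_const_bound[where B=K]) (use assms in auto)
  have "\<bar>expectation f\<bar> \<le> (\<integral>x. \<bar>f x\<bar> \<partial>M)" by (rule integral_abs_bound)
  also have "\<dots> \<le> (\<integral>x. K \<partial>M)" using int assms by (intro integral_mono) auto
  finally show ?thesis by (simp add: prob_space)
qed

lemma bp_tendsto_bounded_measurable:
  assumes "\<And>k. fs k \<in> borel_measurable N" "bp_tendsto N fs f"
  shows "f \<in> bounded_measurable N"
proof -
  obtain C where C: "\<And>k x. x \<in> space N \<Longrightarrow> \<bar>fs k x\<bar> \<le> C"
    and lim: "\<And>x. x \<in> space N \<Longrightarrow> (\<lambda>k. fs k x) \<longlonglongrightarrow> f x"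
    using assms(2) by (auto simp: bp_tendsto_def)
  show ?thesis
  proof (rule bounded_measurableI[where K=C])
    show "f \<in> borel_measurable N"
      by (rule borel_measurable_LIMSEQ_real[OF lim assms(1)])
    show "\<bar>f x\<bar> \<le> C" if "x \<in> space N" for x
      using C[OF that] tendsto_rabs[OF lim[OF that]] by (intro LIMSEQ_le_const2) auto
  qed
qed

lemma (in prob_space) bp_tendsto_expectation:
  assumes "\<And>k. fs k \<in> borel_measurable N" "bp_tendsto N fs f" "sets M = sets N"
  shows "(\<lambda>k. expectation (fs k)) \<longlonglongrightarrow> expectation f"
proof -
  have sp: "space M = space N" by (rule sets_eq_imp_space_eq[OF assms(3)])
  obtain C where C: "\<And>k x. x \<in> space N \<Longrightarrow> \<bar>fs k x\<bar> \<le> C"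
    and lim: "\<And>x. x \<in> space N \<Longrightarrow> (\<lambda>k. fs k x) \<longlonglongrightarrow> f x"
    using assms(2) by (auto simp: bp_tendsto_def)
  have f: "f \<in> borel_measurable N"
    by (rule borel_measurable_LIMSEQ_real[OF lim assms(1)])
  show ?thesis
    by (rule integral_dominated_convergence[where w="\<lambda>_. C"])
      (use assms(1) f C lim in \<open>auto simp: sp assms(3) cong: measurable_cong_sets\<close>)
qed

locale entropic_problem =
  fixes X :: flat_space and a :: real and M :: "'w measure" and B :: "real \<Rightarrow> 'w \<Rightarrow> real ^ 'n"
    and T :: "real set" and \<pi> :: "((real ^ 'n) \<times> (real ^ 'n)) measure"
    and \<mu> :: "real \<Rightarrow> (real ^ 'n) measure" and \<alpha> :: "real measure"
  assumes bm: "standard_bm M B" and T: "T \<in> sets borel" "T \<subseteq> {0..1}"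
    and \<pi>: "\<pi> \<in> space (prob_algebra (borelX X \<Otimes>\<^sub>M borelX X))"
    and \<mu>: "\<forall>t\<in>T. \<mu> t \<in> space (prob_algebra (borelX X))"
    and wc: "weakly_continuous_on X T \<mu>"
    and \<alpha>: "\<alpha> \<in> space (prob_algebra (restrict_space borel T))"
    and supp: "msupport \<alpha> = T"
begin

abbreviation "\<mu>\<^sub>0 \<equiv> initial_marginal X T \<mu> \<pi>"
abbreviation "R\<^sub>\<mu> \<equiv> bm_mix X a M B \<mu>\<^sub>0"
abbreviation "p_space \<equiv> time_space X T :: (real \<times> (real ^ 'n)) measure"
abbreviation "\<eta>_space \<equiv> borelX X \<Otimes>\<^sub>M borelX X :: ((real ^ 'n) \<times> (real ^ 'n)) measure"
abbreviation "Bp \<equiv> bounded_measurable p_space"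
abbreviation "B\<eta> \<equiv> bounded_measurable \<eta>_space"

sublocale \<alpha>: prob_space \<alpha>
  using \<alpha> by (simp add: space_prob_algebra)

sublocale \<pi>: prob_space \<pi>
  using \<pi> by (simp add: space_prob_algebra)

lemma sets_\<alpha>: "sets \<alpha> = sets (restrict_space borel T)"
  using \<alpha> by (simp add: space_prob_algebra)

lemma sets_\<pi>: "sets \<pi> = sets \<eta>_space"
  using \<pi> by (simp add: space_prob_algebra)

lemma space_\<alpha>: "space \<alpha> = T"
  using sets_eq_imp_space_eq[OF sets_\<alpha>] T by (simp add: space_restrict_space)

lemma sets_\<mu>: "t \<in> T \<Longrightarrow> sets (\<mu> t) = sets (borelX X)"
  using \<mu> by (auto simp: space_prob_algebra)

lemma prob_space_\<mu>: "t \<in> T \<Longrightarrow> prob_space (\<mu> t)"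
  using \<mu> by (auto simp: space_prob_algebra)

lemma sets_\<mu>\<^sub>0: "sets \<mu>\<^sub>0 = sets (borelX X)"
  by (simp add: initial_marginal_def sets_\<mu>)

lemma space_\<mu>\<^sub>0: "space \<mu>\<^sub>0 = range (proj X)"
  using sets_eq_imp_space_eq[OF sets_\<mu>\<^sub>0] by (simp add: space_borelX)

sublocale \<mu>\<^sub>0: prob_space \<mu>\<^sub>0
proof -
  have "prob_space (distr \<pi> (borelX X) fst)"
    by (intro \<pi>.prob_space_distr) (simp add: sets_\<pi> cong: measurable_cong_sets)
  then show "prob_space \<mu>\<^sub>0"
    by (simp add: initial_marginal_def prob_space_\<mu>)
qed

sublocale R\<^sub>\<mu>: prob_space R\<^sub>\<mu>
  by (rule prob_space_bm_mix[OF bm sets_\<mu>\<^sub>0 \<mu>\<^sub>0.prob_space_axioms])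

lemma sets_R\<^sub>\<mu>: "sets R\<^sub>\<mu> = sets (path_space X)"
  by (rule sets_bm_mix[OF bm sets_\<mu>\<^sub>0])

lemma space_p_space: "space p_space = T \<times> range (proj X)"
  by (simp add: time_space_def space_pair_measure space_restrict_space space_borelX)

lemma space_\<eta>_space: "space \<eta>_space = range (proj X) \<times> range (proj X)"
  by (simp add: space_pair_measure space_borelX)

lemma path_in_p_space: "\<omega> \<in> paths X \<Longrightarrow> t \<in> T \<Longrightarrow> (t, \<omega> t) \<in> space p_space"
  using T by (auto simp: space_p_space intro!: paths_in_range)

lemma path_in_\<eta>_space: "\<omega> \<in> paths X \<Longrightarrow> (\<omega> 0, \<omega> 1) \<in> space \<eta>_space"
  by (auto simp: space_\<eta>_space intro!: paths_in_range)

text \<open>The dual functional has \<open>\<eta> (x, \<omega> 1)\<close>. Writing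
  \<open>\<omega> 0\<close> for \<open>x\<close> gives a single function on path space for all
  starting points; under the law started at \<open>x\<close> the two agree almost surely.\<close>

definition path_fun :: "(real \<times> (real ^ 'n) \<Rightarrow> real) \<Rightarrow> ((real ^ 'n) \<times> (real ^ 'n) \<Rightarrow> real) \<Rightarrow> (real \<Rightarrow> real ^ 'n) \<Rightarrow> real" where
  "path_fun p \<eta> \<omega> = (\<integral>t. p (t, \<omega> t) \<partial>\<alpha>) + \<eta> (\<omega> 0, \<omega> 1)"

text \<open>The mean that every admissible measure gives to
  \<open>path_fun p \<eta>\<close>.\<close>

definition constraint :: "(real \<times> (real ^ 'n) \<Rightarrow> real) \<Rightarrow> ((real ^ 'n) \<times> (real ^ 'n) \<Rightarrow> real) \<Rightarrow> real" where
  "constraint p \<eta> = (\<integral>z. p z \<partial>mu_alpha X T \<mu> \<alpha>) + (\<integral>w. \<eta> w \<partial>\<pi>)"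

definition partition_function :: "(real \<times> (real ^ 'n) \<Rightarrow> real) \<Rightarrow> ((real ^ 'n) \<times> (real ^ 'n) \<Rightarrow> real) \<Rightarrow> real ^ 'n \<Rightarrow> real" where
  "partition_function p \<eta> x = (\<integral>\<omega>. exp (path_fun p \<eta> \<omega>) \<partial>bm_law X a M B x)"

section \<open>Path functionals and the linear constraints\<close>

lemma measurable_path_time:
  fixes p :: "real \<times> (real ^ 'n) \<Rightarrow> real"
  assumes "p \<in> borel_measurable p_space"
  shows "(\<lambda>(\<omega>, t). p (t, \<omega> t)) \<in> borel_measurable (path_space X \<Otimes>\<^sub>M \<alpha>)"
proof -
  have "(\<lambda>(t, \<omega>). p (t, \<omega> t)) \<in> borel_measurable (restrict_space borel T \<Otimes>\<^sub>M path_space X)"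
    using measurable_compose[OF measurable_time_space_path[OF T(2)] assms] by (simp add: split_beta)
  then have "(\<lambda>(\<omega>, t). p (t, \<omega> t)) \<in> borel_measurable (path_space X \<Otimes>\<^sub>M restrict_space borel T)"
    using measurable_compose[OF measurable_pair_swap'[of "path_space X" "restrict_space borel T"],
      of "\<lambda>(t, \<omega>). p (t, \<omega> t)" borel] by (simp add: split_beta)
  moreover have "sets (path_space X \<Otimes>\<^sub>M \<alpha>) = sets (path_space X \<Otimes>\<^sub>M restrict_space borel T)"
    by (intro sets_pair_measure_cong sets_\<alpha> refl)
  ultimately show ?thesis using measurable_cong_sets[OF _ refl] by blast
qed

lemma measurable_along_path:
  fixes p :: "real \<times> (real ^ 'n) \<Rightarrow> real"
  assumes "p \<in> borel_measurable p_space" "\<omega> \<in> paths X"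
  shows "(\<lambda>t. p (t, \<omega> t)) \<in> borel_measurable \<alpha>"
  using measurable_Pair2[OF measurable_path_time[OF assms(1)], of \<omega>] assms(2) by (simp add: space_path_space)

lemma measurable_endpoints: "(\<lambda>\<omega>. (\<omega> 0, \<omega> 1)) \<in> path_space X \<rightarrow>\<^sub>M \<eta>_space"
  by (intro measurable_Pair measurable_coordinate) auto

lemma measurable_path_fun:
  assumes "p \<in> borel_measurable p_space" "\<eta> \<in> borel_measurable \<eta>_space"
  shows "path_fun p \<eta> \<in> borel_measurable (path_space X)"
  unfolding path_fun_def[abs_def]
  using \<alpha>.borel_measurable_lebesgue_integral[OF measurable_path_time[OF assms(1)]]
    measurable_compose[OF measurable_endpoints assms(2)] by simp

lemma path_fun_bound:
  assumes p: "p \<in> borel_measurable p_space" "\<And>z. z \<in> space p_space \<Longrightarrow> \<bar>p z\<bar> \<le> K"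
    and \<eta>: "\<And>w. w \<in> space \<eta>_space \<Longrightarrow> \<bar>\<eta> w\<bar> \<le> L" and \<omega>: "\<omega> \<in> paths X"
  shows "\<bar>path_fun p \<eta> \<omega>\<bar> \<le> K + L"
proof -
  have "\<bar>\<integral>t. p (t, \<omega> t) \<partial>\<alpha>\<bar> \<le> K"
    using path_in_p_space[OF \<omega>] p(2)
    by (intro \<alpha>.abs_expectation_le measurable_along_path[OF p(1) \<omega>]) (auto simp: space_\<alpha>)
  moreover have "\<bar>\<eta> (\<omega> 0, \<omega> 1)\<bar> \<le> L" by (intro \<eta> path_in_\<eta>_space \<omega>)
  ultimately show ?thesis by (simp add: path_fun_def)
qed

lemma path_fun_bounded_measurable:
  assumes "p \<in> Bp" "\<eta> \<in> B\<eta>"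
  shows "path_fun p \<eta> \<in> bounded_measurable (path_space X)"
proof -
  obtain K L where "\<forall>z\<in>space p_space. \<bar>p z\<bar> \<le> K" "\<forall>w\<in>space \<eta>_space. \<bar>\<eta> w\<bar> \<le> L"
    using assms[THEN bounded_measurableD(2)] by blast
  then show ?thesis
    using assms[THEN bounded_measurableD(1)]
    by (intro bounded_measurableI[where K="K+L"] measurable_path_fun path_fun_bound) (auto simp: space_path_space)
qed

lemma path_fun_linear:
  assumes "p \<in> Bp" "p' \<in> Bp" "\<omega> \<in> paths X"
  shows "path_fun (\<lambda>z. c * p z + d * p' z) (\<lambda>w. c * \<eta> w + d * \<eta>' w) \<omega> = c * path_fun p \<eta> \<omega> + d * path_fun p' \<eta>' \<omega>"
proof -
  have int: "integrable \<alpha> (\<lambda>t. q (t, \<omega> t))" if q: "q \<in> Bp" for q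
  proof -
    obtain K where "\<forall>z\<in>space p_space. \<bar>q z\<bar> \<le> K" using bounded_measurableD(2)[OF q] by blast
    then show ?thesis
      using path_in_p_space[OF assms(3)]
      by (intro \<alpha>.integrable_const_bound[where B=K] measurable_along_path[OF bounded_measurableD(1)[OF q] assms(3)])
        (auto simp: space_\<alpha>)
  qed
  then show ?thesis
    using assms by (simp add: path_fun_def algebra_simps)
qed

lemma measurable_\<mu>: "\<mu> \<in> \<alpha> \<rightarrow>\<^sub>M prob_algebra (borelX X)"
  using weakly_continuous_on_measurable[OF wc \<mu>] by (simp add: sets_\<alpha> cong: measurable_cong_sets)

lemma measurable_mu_alpha_kernel:
  "(\<lambda>t. distr (\<mu> t) p_space (\<lambda>x. (t, x))) \<in> \<alpha> \<rightarrow>\<^sub>M prob_algebra p_space"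
proof (rule measurable_distr_prob_space2[OF measurable_\<mu>])
  have "sets (\<alpha> \<Otimes>\<^sub>M borelX X) = sets p_space"
    unfolding time_space_def by (intro sets_pair_measure_cong sets_\<alpha> refl)
  then show "(\<lambda>(t, x). (t, x)) \<in> \<alpha> \<Otimes>\<^sub>M borelX X \<rightarrow>\<^sub>M p_space"
    using measurable_ident_sets by (simp add: id_def split_beta)
qed

lemma integral_mu_alpha:
  assumes p: "p \<in> Bp"
  shows "(\<integral>z. p z \<partial>mu_alpha X T \<mu> \<alpha>) = (\<integral>t. \<integral>x. p (t, x) \<partial>\<mu> t \<partial>\<alpha>)"
proof -
  obtain K where K: "\<forall>z\<in>space p_space. \<bar>p z\<bar> \<le> K" using bounded_measurableD(2)[OF p] by blast
  have "(\<integral>z. p z \<partial>mu_alpha X T \<mu> \<alpha>) = (\<integral>t. \<integral>z. p z \<partial>distr (\<mu> t) p_space (\<lambda>x. (t, x)) \<partial>\<alpha>)"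
    unfolding mu_alpha_def
    by (rule integral_bind_bounded[OF \<alpha>.prob_space_axioms measurable_mu_alpha_kernel bounded_measurableD(1)[OF p]])
      (use K in auto)
  also have "\<dots> = (\<integral>t. \<integral>x. p (t, x) \<partial>\<mu> t \<partial>\<alpha>)"
  proof (intro Bochner_Integration.integral_cong refl)
    fix t assume "t \<in> space \<alpha>"
    then have t: "t \<in> T" by (simp add: space_\<alpha>)
    have "(\<lambda>x. (t, x)) \<in> \<mu> t \<rightarrow>\<^sub>M p_space"
      using t by (simp add: sets_\<mu> time_space_def space_restrict_space cong: measurable_cong_sets)
    then show "(\<integral>z. p z \<partial>distr (\<mu> t) p_space (\<lambda>x. (t, x))) = (\<integral>x. p (t, x) \<partial>\<mu> t)"
      using bounded_measurableD(1)[OF p] by (rule integral_distr)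
  qed
  finally show ?thesis .
qed

lemma mu_alpha_space: "mu_alpha X T \<mu> \<alpha> \<in> space (prob_algebra p_space)"
proof -
  have "sets (mu_alpha X T \<mu> \<alpha>) = sets p_space"
    unfolding mu_alpha_def by (rule sets_bind[OF _ \<alpha>.not_empty]) simp
  moreover have "prob_space (mu_alpha X T \<mu> \<alpha>)"
    unfolding mu_alpha_def using measurable_space[OF measurable_mu_alpha_kernel]
    by (intro \<alpha>.prob_space_bind[OF _ measurable_prob_algebraD[OF measurable_mu_alpha_kernel]])
      (auto simp: space_prob_algebra)
  ultimately show ?thesis by (simp add: space_prob_algebra)
qed

sublocale mu_alpha: prob_space "mu_alpha X T \<mu> \<alpha>"
  using mu_alpha_space by (simp add: space_prob_algebra)

lemma sets_mu_alpha: "sets (mu_alpha X T \<mu> \<alpha>) = sets p_space"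
  using mu_alpha_space by (simp add: space_prob_algebra)

lemma constraint_linear:
  assumes "p \<in> Bp" "p' \<in> Bp" "\<eta> \<in> B\<eta>" "\<eta>' \<in> B\<eta>"
  shows "constraint (\<lambda>z. c * p z + d * p' z) (\<lambda>w. c * \<eta> w + d * \<eta>' w) = c * constraint p \<eta> + d * constraint p' \<eta>'"
  using assms mu_alpha.integrable_bounded_measurable[OF _ sets_mu_alpha]
    \<pi>.integrable_bounded_measurable[OF _ sets_\<pi>]
  by (simp add: constraint_def algebra_simps)

text \<open>Fubini in path and time: the mean of a path functional sees the measure only through its
  constrained marginals.\<close>

lemma integral_path_fun:
  assumes Q: "prob_space Q" "sets Q = sets (path_space X)" and p: "p \<in> Bp" and \<eta>: "\<eta> \<in> B\<eta>"
  shows "(\<integral>\<omega>. path_fun p \<eta> \<omega> \<partial>Q) = (\<integral>t. \<integral>x. p (t, x) \<partial>marg X Q t \<partial>\<alpha>) + (\<integral>w. \<eta> w \<partial>marg01 X Q)"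
proof -
  interpret Q: prob_space Q by fact
  interpret Q\<alpha>: pair_prob_space Q \<alpha> ..
  note [measurable_cong] = Q(2)
  have spQ: "space Q = paths X" using sets_eq_imp_space_eq[OF Q(2)] by (simp add: space_path_space)
  obtain K where K: "\<forall>z\<in>space p_space. \<bar>p z\<bar> \<le> K" using bounded_measurableD(2)[OF p] by blast
  obtain L where L: "\<forall>w\<in>space \<eta>_space. \<bar>\<eta> w\<bar> \<le> L" using bounded_measurableD(2)[OF \<eta>] by blast
  have "sets (Q \<Otimes>\<^sub>M \<alpha>) = sets (path_space X \<Otimes>\<^sub>M \<alpha>)"
    by (intro sets_pair_measure_cong Q refl)
  then have m: "(\<lambda>(\<omega>, t). p (t, \<omega> t)) \<in> borel_measurable (Q \<Otimes>\<^sub>M \<alpha>)"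
    using measurable_path_time[OF bounded_measurableD(1)[OF p]] by (simp cong: measurable_cong_sets)
  have int: "integrable (Q \<Otimes>\<^sub>M \<alpha>) (\<lambda>(\<omega>, t). p (t, \<omega> t))"
    by (rule Q\<alpha>.P.integrable_const_bound[where B=K, OF _ m])
      (use K path_in_p_space in \<open>auto simp: space_pair_measure spQ space_\<alpha> intro!: AE_I2\<close>)
  have int1: "integrable Q (\<lambda>\<omega>. \<integral>t. p (t, \<omega> t) \<partial>\<alpha>)"
    using Q\<alpha>.integrable_fst'[OF int] by simp
  have m\<eta>: "(\<lambda>\<omega>. \<eta> (\<omega> 0, \<omega> 1)) \<in> borel_measurable Q"
    using measurable_compose[OF measurable_endpoints bounded_measurableD(1)[OF \<eta>]] by simp
  have int2: "integrable Q (\<lambda>\<omega>. \<eta> (\<omega> 0, \<omega> 1))"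
    by (rule Q.integrable_const_bound[where B=L, OF _ m\<eta>])
      (use L path_in_\<eta>_space in \<open>auto simp: spQ intro!: AE_I2\<close>)
  have "(\<integral>\<omega>. path_fun p \<eta> \<omega> \<partial>Q) = (\<integral>\<omega>. \<integral>t. p (t, \<omega> t) \<partial>\<alpha> \<partial>Q) + (\<integral>\<omega>. \<eta> (\<omega> 0, \<omega> 1) \<partial>Q)"
    unfolding path_fun_def using int1 int2 by simp
  also have "(\<integral>\<omega>. \<integral>t. p (t, \<omega> t) \<partial>\<alpha> \<partial>Q) = (\<integral>t. \<integral>\<omega>. p (t, \<omega> t) \<partial>Q \<partial>\<alpha>)"
    by (rule Q\<alpha>.Fubini_integral[OF int, symmetric])
  also have "\<dots> = (\<integral>t. \<integral>x. p (t, x) \<partial>marg X Q t \<partial>\<alpha>)"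
  proof (intro Bochner_Integration.integral_cong refl)
    fix t assume "t \<in> space \<alpha>"
    then have t: "t \<in> T" "t \<in> {0..1}" using T by (auto simp: space_\<alpha>)
    have [measurable]: "(\<lambda>\<omega>. \<omega> t) \<in> path_space X \<rightarrow>\<^sub>M borelX X" by (rule measurable_coordinate[OF t(2)])
    have "(\<lambda>x. (t, x)) \<in> borelX X \<rightarrow>\<^sub>M p_space"
      using t by (simp add: time_space_def space_restrict_space)
    then have "(\<lambda>x. p (t, x)) \<in> borel_measurable (borelX X)"
      using bounded_measurableD(1)[OF p] by (rule measurable_compose)
    then show "(\<integral>\<omega>. p (t, \<omega> t) \<partial>Q) = (\<integral>x. p (t, x) \<partial>marg X Q t)"
      unfolding marg_def by (subst integral_distr) auto
  qed
  also have "(\<integral>\<omega>. \<eta> (\<omega> 0, \<omega> 1) \<partial>Q) = (\<integral>w. \<eta> w \<partial>marg01 X Q)"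
    unfolding marg01_def using bounded_measurableD(1)[OF \<eta>] measurable_endpoints
    by (subst integral_distr) (simp_all add: Q(2) cong: measurable_cong_sets)
  finally show ?thesis .
qed

lemma integral_path_fun_admissible:
  assumes Q: "Q \<in> admissible X T \<mu> \<pi>" and p: "p \<in> Bp" and \<eta>: "\<eta> \<in> B\<eta>"
  shows "(\<integral>\<omega>. path_fun p \<eta> \<omega> \<partial>Q) = constraint p \<eta>"
proof -
  have "prob_space Q" "sets Q = sets (path_space X)" and m: "\<forall>t\<in>T. marg X Q t = \<mu> t" "marg01 X Q = \<pi>"
    using Q by (auto simp: admissible_def space_prob_algebra)
  then have "(\<integral>\<omega>. path_fun p \<eta> \<omega> \<partial>Q) = (\<integral>t. \<integral>x. p (t, x) \<partial>marg X Q t \<partial>\<alpha>) + (\<integral>w. \<eta> w \<partial>marg01 X Q)"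
    using p \<eta> by (intro integral_path_fun)
  also have "(\<integral>t. \<integral>x. p (t, x) \<partial>marg X Q t \<partial>\<alpha>) = (\<integral>t. \<integral>x. p (t, x) \<partial>\<mu> t \<partial>\<alpha>)"
    using m by (intro Bochner_Integration.integral_cong) (auto simp: space_\<alpha>)
  finally show ?thesis by (simp add: constraint_def integral_mu_alpha[OF p] m)
qed

text \<open>Indicators as \<open>\<eta>\<close> identify the endpoint law. For the marginals one
  continuous \<open>\<phi>\<close> is treated at a time: the null set of exceptional times depends
  on \<open>\<phi>\<close>, but continuity in time removes it before \<open>\<phi>\<close> varies,
  so no countable family of test functions is chosen.\<close>

lemma admissibleI_expectations:
  assumes Q: "prob_space Q" "sets Q = sets (path_space X)"
    and eq: "\<And>p \<eta>. p \<in> Bp \<Longrightarrow> \<eta> \<in> B\<eta> \<Longrightarrow> (\<integral>\<omega>. path_fun p \<eta> \<omega> \<partial>Q) = constraint p \<eta>"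
  shows "Q \<in> admissible X T \<mu> \<pi>"
proof -
  interpret Q: prob_space Q by fact
  have spQ: "space Q = paths X" using sets_eq_imp_space_eq[OF Q(2)] by (simp add: space_path_space)
  have coord: "(\<lambda>\<omega>. \<omega> t) \<in> Q \<rightarrow>\<^sub>M borelX X" if "t \<in> {0..1}" for t
    using measurable_coordinate[OF that, of X] measurable_cong_sets[OF Q(2) refl] by blast
  have "marg01 X Q = \<pi>"
  proof (rule measure_eqI)
    have ends: "(\<lambda>\<omega>. (\<omega> 0, \<omega> 1)) \<in> Q \<rightarrow>\<^sub>M \<eta>_space"
      by (intro measurable_Pair coord) auto
    interpret m: prob_space "marg01 X Q"
      unfolding marg01_def by (rule Q.prob_space_distr[OF ends])
    fix A assume "A \<in> sets (marg01 X Q)"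
    then have A: "A \<in> sets \<eta>_space" by (simp add: marg01_def)
    have ind: "indicator A \<in> B\<eta>"
      using A by (intro bounded_measurableI[where K=1]) (auto simp: indicator_def)
    have "(\<lambda>_. 0) \<in> Bp" by (intro bounded_measurableI[where K=0]) auto
    from eq[OF this ind] integral_path_fun[OF Q this ind]
    have "measure (marg01 X Q) A = measure \<pi> A"
      using A by (simp add: constraint_def marg01_def sets_\<pi>)
    then show "emeasure (marg01 X Q) A = emeasure \<pi> A"
      by (simp add: m.emeasure_eq_measure \<pi>.emeasure_eq_measure)
  qed (simp add: marg01_def sets_\<pi>)
  moreover have "marg X Q t = \<mu> t" if t: "t \<in> T" for t
  proof (rule borelX_measure_eqI)
    have "t \<in> {0..1}" using t T by auto
    then show "prob_space (marg X Q t)"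
      unfolding marg_def by (rule Q.prob_space_distr[OF coord])
    show "sets (marg X Q t) = sets (borelX X)" by (simp add: marg_def)
    show "prob_space (\<mu> t)" "sets (\<mu> t) = sets (borelX X)"
      using t by (auto simp: prob_space_\<mu> sets_\<mu>)
    fix \<phi> :: "real ^ 'n \<Rightarrow> real" assume \<phi>: "continuous_map (topo X) euclideanreal \<phi>" "\<And>x. 0 \<le> \<phi> x" "\<And>x. \<phi> x \<le> 1"
    have [measurable]: "\<phi> \<in> borel_measurable (borelX X)" by (rule continuous_map_borelX_measurable[OF \<phi>(1)])
    define h where "h s = (\<integral>x. \<phi> x \<partial>marg X Q s) - (\<integral>x. \<phi> x \<partial>\<mu> s)" for s
    have marg_eq: "(\<integral>x. \<phi> x \<partial>marg X Q s) = (\<integral>\<omega>. \<phi> (\<omega> s) \<partial>Q)" if "s \<in> T" for s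
      using that T unfolding marg_def by (subst integral_distr[OF coord]) auto
    \<comment> \<open>Weak continuity of the marginals of \<open>Q\<close>: dominated convergence
      along each continuous path.\<close>
    have "continuous_on T (\<lambda>s. \<integral>\<omega>. \<phi> (\<omega> s) \<partial>Q)"
    proof (rule continuous_on_sequentiallyI)
      fix u :: "nat \<Rightarrow> real" and s assume u: "\<forall>n. u n \<in> T" "s \<in> T" "u \<longlonglongrightarrow> s"
      show "(\<lambda>n. \<integral>\<omega>. \<phi> (\<omega> (u n)) \<partial>Q) \<longlonglongrightarrow> (\<integral>\<omega>. \<phi> (\<omega> s) \<partial>Q)"
      proof (rule integral_dominated_convergence[where w="\<lambda>_. 1"])
        have meas: "(\<lambda>\<omega>. \<phi> (\<omega> r)) \<in> borel_measurable Q" if "r \<in> T" for r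
          using measurable_compose[OF coord, of r \<phi> borel] that T by auto
        show "(\<lambda>\<omega>. \<phi> (\<omega> s)) \<in> borel_measurable Q" "(\<lambda>\<omega>. \<phi> (\<omega> (u n))) \<in> borel_measurable Q" for n
          using u by (auto intro: meas)
        show "AE \<omega> in Q. (\<lambda>n. \<phi> (\<omega> (u n))) \<longlonglongrightarrow> \<phi> (\<omega> s)"
        proof (rule AE_I2)
          fix \<omega> assume "\<omega> \<in> space Q"
          then have "continuous_on {0..1} (\<lambda>t. \<phi> (\<omega> t))"
            using \<phi>(1) spQ by (intro path_continuous_on) auto
          moreover have "s \<in> {0..1}" "\<forall>\<^sub>F n in sequentially. u n \<in> {0..1}"
            using u T(2) by (blast intro: always_eventually)+
          ultimately show "(\<lambda>n. \<phi> (\<omega> (u n))) \<longlonglongrightarrow> \<phi> (\<omega> s)"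
            by (rule continuous_on_tendsto_compose[OF _ u(3)])
        qed
      qed (use \<phi> in auto)
    qed
    then have "continuous_on T (\<lambda>s. \<integral>x. \<phi> x \<partial>marg X Q s)"
      by (subst continuous_on_cong[OF refl marg_eq])
    moreover have "continuous_on T (\<lambda>s. \<integral>x. \<phi> x \<partial>\<mu> s)"
    proof -
      have "bounded (\<phi> ` topspace (topo X))"
        using \<phi> by (intro boundedI[of _ 1]) auto
      then show ?thesis using wc \<phi>(1) by (auto simp: weakly_continuous_on_def)
    qed
    ultimately have cont: "continuous_on T h" unfolding h_def by (intro continuous_on_diff)
    have bnd: "\<bar>\<integral>x. \<phi> x \<partial>N\<bar> \<le> 1" if "prob_space N" "sets N = sets (borelX X)" for N
      using that \<phi> by (intro prob_space.abs_expectation_le) (auto cong: measurable_cong_sets)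
    have h_le: "\<bar>h s\<bar> \<le> 2" if s: "s \<in> T" for s
    proof -
      have "s \<in> {0..1}" using s T by auto
      then have "\<bar>\<integral>x. \<phi> x \<partial>marg X Q s\<bar> \<le> 1"
        unfolding marg_def by (intro bnd Q.prob_space_distr coord) auto
      moreover have "\<bar>\<integral>x. \<phi> x \<partial>\<mu> s\<bar> \<le> 1" using s by (intro bnd prob_space_\<mu> sets_\<mu>)
      ultimately show ?thesis unfolding h_def by linarith
    qed
    have h_meas: "h \<in> borel_measurable (restrict_space borel T)"
      by (rule borel_measurable_continuous_on_restrict[OF cont])
    \<comment> \<open>Tested against this \<open>p\<close>, the constraint reads \<open>\<integral> h\<^sup>2 d\<alpha> = 0\<close>.\<close>
    define p where "p z = h (fst z) * \<phi> (snd z)" for z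
    have p: "p \<in> Bp"
    proof (rule bounded_measurableI[where K=2])
      show "p \<in> borel_measurable p_space"
        unfolding p_def time_space_def
        using h_meas by measurable
      fix z assume "z \<in> space p_space"
      then have "\<bar>h (fst z)\<bar> * \<bar>\<phi> (snd z)\<bar> \<le> 2 * 1"
        using \<phi> by (intro mult_mono h_le) (auto simp: space_p_space)
      then show "\<bar>p z\<bar> \<le> 2" by (simp add: p_def abs_mult)
    qed
    have 0: "(\<lambda>_. 0) \<in> B\<eta>" by (intro bounded_measurableI[where K=0]) auto
    have int: "integrable \<alpha> (\<lambda>s. h s * c s)"
      if "\<And>s. s \<in> T \<Longrightarrow> \<bar>c s\<bar> \<le> 1" "c \<in> borel_measurable (restrict_space borel T)" for c
    proof (rule \<alpha>.integrable_const_bound[where B=2])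
      show "(\<lambda>s. h s * c s) \<in> borel_measurable \<alpha>"
        using h_meas that(2) by (simp add: sets_\<alpha> cong: measurable_cong_sets)
      have "\<bar>h s\<bar> * \<bar>c s\<bar> \<le> 2 * 1" if "s \<in> T" for s
        using that \<open>\<And>s. s \<in> T \<Longrightarrow> \<bar>c s\<bar> \<le> 1\<close> by (intro mult_mono h_le) auto
      then show "AE s in \<alpha>. norm (h s * c s) \<le> 2" by (intro AE_I2) (auto simp: abs_mult space_\<alpha>)
    qed
    have "(\<integral>t. \<integral>x. p (t, x) \<partial>marg X Q t \<partial>\<alpha>) = (\<integral>t. \<integral>x. p (t, x) \<partial>\<mu> t \<partial>\<alpha>)"
      using eq[OF p 0] integral_path_fun[OF Q p 0] by (simp add: constraint_def integral_mu_alpha[OF p])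
    then have "(\<integral>s. h s * (\<integral>x. \<phi> x \<partial>marg X Q s) \<partial>\<alpha>) = (\<integral>s. h s * (\<integral>x. \<phi> x \<partial>\<mu> s) \<partial>\<alpha>)"
      by (simp add: p_def)
    moreover have "(\<integral>s. h s * h s \<partial>\<alpha>)
        = (\<integral>s. h s * (\<integral>x. \<phi> x \<partial>marg X Q s) \<partial>\<alpha>) - (\<integral>s. h s * (\<integral>x. \<phi> x \<partial>\<mu> s) \<partial>\<alpha>)"
    proof -
      have "integrable \<alpha> (\<lambda>s. h s * (\<integral>x. \<phi> x \<partial>marg X Q s))"
      proof (rule int)
        show "\<bar>\<integral>x. \<phi> x \<partial>marg X Q s\<bar> \<le> 1" if "s \<in> T" for s
          unfolding marg_def using that T by (intro bnd Q.prob_space_distr coord) auto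
      qed (rule borel_measurable_continuous_on_restrict, fact)
      moreover have "integrable \<alpha> (\<lambda>s. h s * (\<integral>x. \<phi> x \<partial>\<mu> s))"
      proof (rule int)
        show "\<bar>\<integral>x. \<phi> x \<partial>\<mu> s\<bar> \<le> 1" if "s \<in> T" for s
          using that by (intro bnd prob_space_\<mu> sets_\<mu>)
      qed (rule borel_measurable_continuous_on_restrict, fact)
      ultimately have "(\<integral>s. h s * (\<integral>x. \<phi> x \<partial>marg X Q s) - h s * (\<integral>x. \<phi> x \<partial>\<mu> s) \<partial>\<alpha>)
        = (\<integral>s. h s * (\<integral>x. \<phi> x \<partial>marg X Q s) \<partial>\<alpha>) - (\<integral>s. h s * (\<integral>x. \<phi> x \<partial>\<mu> s) \<partial>\<alpha>)"
        by (rule Bochner_Integration.integral_diff)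
      then show ?thesis by (simp add: h_def right_diff_distrib)
    qed
    ultimately have "(\<integral>s. (h s)\<^sup>2 \<partial>\<alpha>) = 0" by (simp add: power2_eq_square)
    moreover have "integrable \<alpha> (\<lambda>s. (h s)\<^sup>2)"
    proof (rule \<alpha>.integrable_const_bound[where B=4])
      show "(\<lambda>s. (h s)\<^sup>2) \<in> borel_measurable \<alpha>"
        using h_meas by (simp add: sets_\<alpha> cong: measurable_cong_sets)
      have "(h s)\<^sup>2 \<le> 2\<^sup>2" if "s \<in> T" for s
        using h_le[OF that] by (subst abs_le_square_iff[symmetric]) auto
      then show "AE s in \<alpha>. norm ((h s)\<^sup>2) \<le> 4" by (intro AE_I2) (auto simp: space_\<alpha>)
    qed
    ultimately have ae: "AE s in \<alpha>. h s = 0"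
      using integral_nonneg_eq_0_iff_AE[of \<alpha> "\<lambda>s. (h s)\<^sup>2"] by simp
    have "h t = 0"
    proof (rule ccontr)
      assume "h t \<noteq> 0"
      \<comment> \<open>By continuity \<open>h\<close> would be nonzero on a relative neighbourhood
        of \<open>t\<close> in \<open>T\<close>, and this has positive \<open>\<alpha>\<close>-mass
        because \<open>t\<close> lies in the support.\<close>
      obtain U where U: "open U" "U \<inter> T = h -` (- {0}) \<inter> T"
        using cont open_Compl[OF closed_singleton] continuous_on_open_invariant by (metis)
      have "t \<in> U" using U t \<open>h t \<noteq> 0\<close> by auto
      then have "emeasure \<alpha> (U \<inter> space \<alpha>) > 0"
        using supp t U(1) by (auto simp: msupport_def)
      moreover have "emeasure \<alpha> (U \<inter> space \<alpha>) = 0"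
      proof -
        have "U \<inter> space \<alpha> \<in> sets \<alpha>"
          using U(1) T by (auto simp: space_\<alpha> sets_\<alpha> sets_restrict_space)
        moreover have "AE s in \<alpha>. s \<notin> U \<inter> space \<alpha>"
          using ae by eventually_elim (use U(2) in \<open>auto simp: space_\<alpha>\<close>)
        ultimately show ?thesis by (simp add: AE_iff_measurable[OF _ refl] AE_iff_null_sets null_setsD1)
      qed
      ultimately show False by simp
    qed
    then show "(\<integral>x. \<phi> x \<partial>marg X Q t) = (\<integral>x. \<phi> x \<partial>\<mu> t)" by (simp add: h_def)
  qed
  ultimately show ?thesis
    using Q by (auto simp: admissible_def space_prob_algebra)
qed

section \<open>Partition functions\<close>

lemma bm_law_space: "x \<in> range (proj X) \<Longrightarrow> prob_space (bm_law X a M B x)"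
    "x \<in> range (proj X) \<Longrightarrow> sets (bm_law X a M B x) = sets (path_space X)"
  by (rule prob_space_bm_law[OF bm]) (simp_all add: bm_law_def)

lemma path_fun_bounded:
  assumes "p \<in> Bp" "\<eta> \<in> B\<eta>"
  shows "\<exists>C. \<forall>\<omega>\<in>paths X. \<bar>path_fun p \<eta> \<omega>\<bar> \<le> C"
  using bounded_measurableD(2)[OF path_fun_bounded_measurable[OF assms]] by (simp add: space_path_space)

lemma exp_path_fun_bounded_measurable:
  assumes p: "p \<in> Bp" and \<eta>: "\<eta> \<in> B\<eta>"
  shows "(\<lambda>\<omega>. exp (path_fun p \<eta> \<omega>)) \<in> bounded_measurable (path_space X)"
proof -
  obtain C where C: "\<forall>\<omega>\<in>paths X. \<bar>path_fun p \<eta> \<omega>\<bar> \<le> C" using path_fun_bounded[OF p \<eta>] ..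
  show ?thesis
  proof (rule bounded_measurableI[where K="exp C"])
    show "(\<lambda>\<omega>. exp (path_fun p \<eta> \<omega>)) \<in> borel_measurable (path_space X)"
      using bounded_measurableD(1)[OF path_fun_bounded_measurable[OF p \<eta>]] by simp
    show "\<bar>exp (path_fun p \<eta> \<omega>)\<bar> \<le> exp C" if "\<omega> \<in> space (path_space X)" for \<omega>
      using C[rule_format, of \<omega>] that by (simp add: space_path_space)
  qed
qed

lemma partition_function_bounds:
  assumes p: "p \<in> Bp" and \<eta>: "\<eta> \<in> B\<eta>" and C: "\<And>\<omega>. \<omega> \<in> paths X \<Longrightarrow> \<bar>path_fun p \<eta> \<omega>\<bar> \<le> C"
    and x: "x \<in> range (proj X)"
  shows "exp (- C) \<le> partition_function p \<eta> x" "partition_function p \<eta> x \<le> exp C"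
proof -
  interpret K: prob_space "bm_law X a M B x" by (rule bm_law_space(1)[OF x])
  have sp: "space (bm_law X a M B x) = paths X"
    using sets_eq_imp_space_eq[OF bm_law_space(2)[OF x]] by (simp add: space_path_space)
  have int: "integrable (bm_law X a M B x) (\<lambda>\<omega>. exp (path_fun p \<eta> \<omega>))"
    by (rule K.integrable_bounded_measurable[OF exp_path_fun_bounded_measurable[OF p \<eta>] bm_law_space(2)[OF x]])
  have le: "- C \<le> path_fun p \<eta> \<omega>" "path_fun p \<eta> \<omega> \<le> C" if "\<omega> \<in> paths X" for \<omega>
    using C[OF that] by auto
  have "(\<integral>\<omega>. exp (- C) \<partial>bm_law X a M B x) \<le> partition_function p \<eta> x"
    unfolding partition_function_def by (rule integral_mono[OF _ int]) (simp_all add: le sp)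
  then show "exp (- C) \<le> partition_function p \<eta> x" by (simp add: K.prob_space)
  have "partition_function p \<eta> x \<le> (\<integral>\<omega>. exp C \<partial>bm_law X a M B x)"
    unfolding partition_function_def by (rule integral_mono[OF int]) (simp_all add: le sp)
  then show "partition_function p \<eta> x \<le> exp C" by (simp add: K.prob_space)
qed

lemma partition_pos:
  assumes "p \<in> Bp" "\<eta> \<in> B\<eta>" "x \<in> range (proj X)"
  shows "0 < partition_function p \<eta> x"
proof -
  obtain C where C: "\<forall>\<omega>\<in>paths X. \<bar>path_fun p \<eta> \<omega>\<bar> \<le> C" using path_fun_bounded[OF assms(1,2)] ..
  show ?thesis
    by (rule less_le_trans[OF exp_gt_zero partition_function_bounds(1)[OF assms(1,2) C[rule_format] assms(3)]])
qed

lemma abs_ln_partition_le: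
  assumes "p \<in> Bp" "\<eta> \<in> B\<eta>" "\<And>\<omega>. \<omega> \<in> paths X \<Longrightarrow> \<bar>path_fun p \<eta> \<omega>\<bar> \<le> C" "x \<in> range (proj X)"
  shows "\<bar>ln (partition_function p \<eta> x)\<bar> \<le> C"
proof -
  note pos = partition_pos[OF assms(1,2,4)]
  have "ln (exp (- C)) \<le> ln (partition_function p \<eta> x)"
    using pos partition_function_bounds(1)[OF assms] by (subst ln_le_cancel_iff) auto
  moreover have "ln (partition_function p \<eta> x) \<le> ln (exp C)"
    using pos partition_function_bounds(2)[OF assms] by (subst ln_le_cancel_iff) auto
  ultimately show ?thesis by simp
qed

lemma measurable_kernel_integral:
  fixes f :: "(real \<Rightarrow> real ^ 'n) \<Rightarrow> real"
  assumes "f \<in> borel_measurable (path_space X)"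
  shows "(\<lambda>x. \<integral>\<omega>. f \<omega> \<partial>bm_law X a M B x) \<in> borel_measurable (borelX X)"
  by (rule measurable_compose[OF measurable_prob_algebraD[OF measurable_bm_law[OF bm]]
      integral_measurable_subprob_algebra[OF assms]])

lemma measurable_partition:
  assumes "p \<in> Bp" "\<eta> \<in> B\<eta>"
  shows "partition_function p \<eta> \<in> borel_measurable (borelX X)"
  unfolding partition_function_def[abs_def]
  using bounded_measurableD(1)[OF path_fun_bounded_measurable[OF assms]]
  by (intro measurable_kernel_integral) simp

lemma ln_partition_bounded_measurable:
  assumes "p \<in> Bp" "\<eta> \<in> B\<eta>"
  shows "(\<lambda>x. ln (partition_function p \<eta> x)) \<in> bounded_measurable (borelX X)"
proof -
  obtain C where C: "\<forall>\<omega>\<in>paths X. \<bar>path_fun p \<eta> \<omega>\<bar> \<le> C" using path_fun_bounded[OF assms] ..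
  show ?thesis
  proof (rule bounded_measurableI[where K=C])
    show "\<bar>ln (partition_function p \<eta> x)\<bar> \<le> C" if "x \<in> space (borelX X)" for x
      by (rule abs_ln_partition_le[OF assms C[rule_format]]) (use that in \<open>simp_all add: space_borelX\<close>)
  qed (use measurable_partition[OF assms] in simp)
qed

lemma AE_bm_law_start:
  assumes x: "x \<in> range (proj X)"
  shows "AE \<omega> in bm_law X a M B x. \<omega> 0 = x"
proof -
  have "{y \<in> space (borelX X). y = x} \<in> sets (borelX X)"
    using measurable_sets[OF measurable_ident_borelX[of X], of "{x}"] by (simp add: vimage_def Int_def conj_commute)
  then have "{\<omega> \<in> space (path_space X). \<omega> 0 \<in> {y \<in> space (borelX X). y = x}} \<in> sets (path_space X)"
    using measurable_sets[OF measurable_coordinate[of 0 X]] by (simp add: vimage_def Int_def conj_commute)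
  moreover have "{\<omega> \<in> space (path_space X). \<omega> 0 \<in> {y \<in> space (borelX X). y = x}} = {\<omega> \<in> space (path_space X). \<omega> 0 = x}"
    using x by (auto simp: space_borelX)
  ultimately show ?thesis
    unfolding bm_law_eq
    by (subst AE_distr_iff[OF measurable_bm_path_section[OF bm x]]) (auto simp: bm_path_0[OF bm x])
qed

text \<open>Almost every path under the law started at \<open>x\<close> has
  \<open>\<omega> 0 = x\<close>, so \<open>\<eta> (x, \<omega> 1)\<close> may be replaced inside the
  expectation.\<close>

lemma dual_functional_eq:
  assumes p: "p \<in> Bp" and \<eta>: "\<eta> \<in> B\<eta>"
  shows "dual_functional X a M B T \<alpha> \<mu> \<pi> p \<eta> = constraint p \<eta> - (\<integral>x. ln (partition_function p \<eta> x) \<partial>\<mu>\<^sub>0)"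
proof -
  have "(\<integral>\<omega>. exp ((\<integral>t. p (t, \<omega> t) \<partial>\<alpha>) + \<eta> (x, \<omega> 1)) \<partial>bm_law X a M B x) = partition_function p \<eta> x"
    if x: "x \<in> range (proj X)" for x
    unfolding partition_function_def path_fun_def
  proof (rule integral_cong_AE)
    have s: "sets (bm_law X a M B x) = sets (path_space X)" by (rule bm_law_space(2)[OF x])
    have "(\<lambda>\<omega>. \<integral>t. p (t, \<omega> t) \<partial>\<alpha>) \<in> borel_measurable (path_space X)"
      by (rule \<alpha>.borel_measurable_lebesgue_integral[OF measurable_path_time[OF bounded_measurableD(1)[OF p]]])
    moreover have "(\<lambda>\<omega>. (x, \<omega> 1)) \<in> path_space X \<rightarrow>\<^sub>M \<eta>_space"
      using x by (intro measurable_Pair measurable_coordinate measurable_const) (auto simp: space_borelX)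
    then have "(\<lambda>\<omega>. \<eta> (x, \<omega> 1)) \<in> borel_measurable (path_space X)"
      by (rule measurable_compose[OF _ bounded_measurableD(1)[OF \<eta>]])
    ultimately show "(\<lambda>\<omega>. exp ((\<integral>t. p (t, \<omega> t) \<partial>\<alpha>) + \<eta> (x, \<omega> 1))) \<in> borel_measurable (bm_law X a M B x)"
      by (simp add: s cong: measurable_cong_sets)
    show "(\<lambda>\<omega>. exp ((\<integral>t. p (t, \<omega> t) \<partial>\<alpha>) + \<eta> (\<omega> 0, \<omega> 1))) \<in> borel_measurable (bm_law X a M B x)"
      using measurable_path_fun[OF p[THEN bounded_measurableD(1)] \<eta>[THEN bounded_measurableD(1)]]
      by (simp add: s path_fun_def[abs_def] cong: measurable_cong_sets)
    show "AE \<omega> in bm_law X a M B x. exp ((\<integral>t. p (t, \<omega> t) \<partial>\<alpha>) + \<eta> (x, \<omega> 1))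
        = exp ((\<integral>t. p (t, \<omega> t) \<partial>\<alpha>) + \<eta> (\<omega> 0, \<omega> 1))"
      using AE_bm_law_start[OF x] by eventually_elim simp
  qed
  then have "(\<integral>x. ln (\<integral>\<omega>. exp ((\<integral>t. p (t, \<omega> t) \<partial>\<alpha>) + \<eta> (x, \<omega> 1)) \<partial>bm_law X a M B x) \<partial>\<mu>\<^sub>0)
      = (\<integral>x. ln (partition_function p \<eta> x) \<partial>\<mu>\<^sub>0)"
    by (intro Bochner_Integration.integral_cong) (auto simp: space_\<mu>\<^sub>0)
  then show ?thesis by (simp add: dual_functional_def constraint_def)
qed

section \<open>The two inequalities of the duality\<close>

lemma integral_R\<^sub>\<mu>:
  assumes "f \<in> bounded_measurable (path_space X)"
  shows "(\<integral>\<omega>. f \<omega> \<partial>R\<^sub>\<mu>) = (\<integral>x. \<integral>\<omega>. f \<omega> \<partial>bm_law X a M B x \<partial>\<mu>\<^sub>0)"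
proof -
  obtain K where K: "\<forall>\<omega>\<in>space (path_space X). \<bar>f \<omega>\<bar> \<le> K" using bounded_measurableD(2)[OF assms] by blast
  have "bm_law X a M B \<in> \<mu>\<^sub>0 \<rightarrow>\<^sub>M prob_algebra (path_space X)"
    using measurable_bm_law[OF bm] by (simp add: sets_\<mu>\<^sub>0 cong: measurable_cong_sets)
  then show ?thesis
    unfolding bm_mix_def
    by (rule integral_bind_bounded[OF \<mu>\<^sub>0.prob_space_axioms _ bounded_measurableD(1)[OF assms]]) (use K in auto)
qed

text \<open>Reconciles the two definitions of the initial law: it is a constraint at time
  \<open>0\<close> when \<open>0 \<in> T\<close>, and is read off the endpoint law
  otherwise.\<close>

lemma admissible_marg_0:
  assumes "Q \<in> admissible X T \<mu> \<pi>"
  shows "marg X Q 0 = \<mu>\<^sub>0"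
proof (cases "0 \<in> T")
  case True
  then show ?thesis using assms by (auto simp: admissible_def initial_marginal_def)
next
  case False
  have "sets Q = sets (path_space X)" and \<pi>_eq: "\<pi> = marg01 X Q"
    using assms by (auto simp: admissible_def space_prob_algebra)
  then have "(\<lambda>\<omega>. (\<omega> 0, \<omega> 1)) \<in> Q \<rightarrow>\<^sub>M \<eta>_space"
    using measurable_endpoints measurable_cong_sets[OF _ refl] by blast
  then have "distr (marg01 X Q) (borelX X) fst = marg X Q 0"
    unfolding marg01_def marg_def by (subst distr_distr) (auto simp: o_def)
  then show ?thesis using False by (simp add: initial_marginal_def \<pi>_eq)
qed

text \<open>Subtracting the logarithm of the partition function at \<open>\<omega> 0\<close>
  normalizes \<open>exp G\<close> under each starting point separately. Under \<open>Q\<close> the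
  subtracted term has mean equal to the integral of that logarithm over the initial law, which puts
  the logarithm inside the integral; normalizing by one constant would give only the weaker bound
  with a single logarithm.\<close>

lemma dual_functional_le_cond_entropy_inf:
  assumes p: "p \<in> Bp" and \<eta>: "\<eta> \<in> B\<eta>"
  shows "ereal (dual_functional X a M B T \<alpha> \<mu> \<pi> p \<eta>) \<le> cond_entropy_inf X a M B T \<mu> \<pi>"
  unfolding cond_entropy_inf_def
proof (rule INF_greatest)
  fix Q assume adm: "Q \<in> admissible X T \<mu> \<pi>"
  then have Q: "prob_space Q" "sets Q = sets (path_space X)"
    by (auto simp: admissible_def space_prob_algebra)
  interpret Q: prob_space Q by fact
  have Q0: "marg X Q 0 = \<mu>\<^sub>0"
    using adm by (rule admissible_marg_0)
  define G where "G \<omega> = path_fun p \<eta> \<omega> - ln (partition_function p \<eta> (\<omega> 0))" for \<omega>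
  obtain L where L: "\<forall>x\<in>space (borelX X). \<bar>ln (partition_function p \<eta> x)\<bar> \<le> L"
    using bounded_measurableD(2)[OF ln_partition_bounded_measurable[OF p \<eta>]] by blast
  have start: "(\<lambda>\<omega>. ln (partition_function p \<eta> (\<omega> 0))) \<in> bounded_measurable (path_space X)"
  proof (rule bounded_measurableI)
    show "(\<lambda>\<omega>. ln (partition_function p \<eta> (\<omega> 0))) \<in> borel_measurable (path_space X)"
      using measurable_compose[OF measurable_coordinate[of 0 X] bounded_measurableD(1)[OF ln_partition_bounded_measurable[OF p \<eta>]]]
      by simp
    show "\<bar>ln (partition_function p \<eta> (\<omega> 0))\<bar> \<le> L" if "\<omega> \<in> space (path_space X)" for \<omega>
      using that by (intro L[rule_format]) (simp add: space_path_space space_borelX paths_in_range)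
  qed
  have G: "G \<in> bounded_measurable (path_space X)"
    using bounded_measurable_linear[OF path_fun_bounded_measurable[OF p \<eta>] start, of 1 "-1"] by (simp add: G_def[abs_def])
  obtain C where C: "\<forall>\<omega>\<in>space (path_space X). \<bar>G \<omega>\<bar> \<le> C" using bounded_measurableD(2)[OF G] by blast
  have expG: "(\<lambda>\<omega>. exp (G \<omega>)) \<in> bounded_measurable (path_space X)"
    using bounded_measurableD(1)[OF G] C by (intro bounded_measurableI[where K="exp C"]) (auto simp: abs_le_iff)
  have "(\<integral>\<omega>. exp (G \<omega>) \<partial>R\<^sub>\<mu>) = (\<integral>x. \<integral>\<omega>. exp (G \<omega>) \<partial>bm_law X a M B x \<partial>\<mu>\<^sub>0)"
    by (rule integral_R\<^sub>\<mu>[OF expG])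
  also have "\<dots> = (\<integral>x. 1 \<partial>\<mu>\<^sub>0)"
  proof (intro Bochner_Integration.integral_cong refl)
    fix x assume "x \<in> space \<mu>\<^sub>0"
    then have x: "x \<in> range (proj X)" by (simp add: space_\<mu>\<^sub>0)
    have s: "sets (bm_law X a M B x) = sets (path_space X)" by (rule bm_law_space(2)[OF x])
    have "(\<integral>\<omega>. exp (G \<omega>) \<partial>bm_law X a M B x) = (\<integral>\<omega>. exp (path_fun p \<eta> \<omega>) / partition_function p \<eta> x \<partial>bm_law X a M B x)"
    proof (rule integral_cong_AE)
      show "(\<lambda>\<omega>. exp (G \<omega>)) \<in> borel_measurable (bm_law X a M B x)"
        "(\<lambda>\<omega>. exp (path_fun p \<eta> \<omega>) / partition_function p \<eta> x) \<in> borel_measurable (bm_law X a M B x)"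
        using bounded_measurableD(1)[OF expG] bounded_measurableD(1)[OF exp_path_fun_bounded_measurable[OF p \<eta>]]
        by (simp_all add: s cong: measurable_cong_sets)
      show "AE \<omega> in bm_law X a M B x. exp (G \<omega>) = exp (path_fun p \<eta> \<omega>) / partition_function p \<eta> x"
        using AE_bm_law_start[OF x]
        by eventually_elim (simp add: G_def exp_diff partition_pos[OF p \<eta> x])
    qed
    then show "(\<integral>\<omega>. exp (G \<omega>) \<partial>bm_law X a M B x) = 1"
      using partition_pos[OF p \<eta> x] by (simp add: partition_function_def)
  qed
  finally have expG1: "(\<integral>\<omega>. exp (G \<omega>) \<partial>R\<^sub>\<mu>) \<le> 1" by (simp add: \<mu>\<^sub>0.prob_space)
  have "(\<integral>\<omega>. G \<omega> \<partial>Q) = (\<integral>\<omega>. path_fun p \<eta> \<omega> \<partial>Q) - (\<integral>\<omega>. ln (partition_function p \<eta> (\<omega> 0)) \<partial>Q)"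
    unfolding G_def
    using Q.integrable_bounded_measurable[OF path_fun_bounded_measurable[OF p \<eta>] Q(2)]
      Q.integrable_bounded_measurable[OF start Q(2)] by simp
  also have "(\<integral>\<omega>. ln (partition_function p \<eta> (\<omega> 0)) \<partial>Q) = (\<integral>x. ln (partition_function p \<eta> x) \<partial>\<mu>\<^sub>0)"
    unfolding Q0[symmetric] marg_def
    using measurable_coordinate[of 0 X] bounded_measurableD(1)[OF ln_partition_bounded_measurable[OF p \<eta>]]
    by (subst integral_distr) (simp_all add: Q(2) cong: measurable_cong_sets)
  finally have "(\<integral>\<omega>. G \<omega> \<partial>Q) = dual_functional X a M B T \<alpha> \<mu> \<pi> p \<eta>"
    by (simp add: integral_path_fun_admissible[OF adm p \<eta>] dual_functional_eq[OF p \<eta>])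
  moreover have "ereal (\<integral>\<omega>. G \<omega> \<partial>Q) \<le> rel_entropy Q R\<^sub>\<mu>"
  proof (rule donsker_varadhan[OF Q(1) R\<^sub>\<mu>.prob_space_axioms _ _ _ expG1])
    show "sets Q = sets R\<^sub>\<mu>" by (simp add: Q(2) sets_R\<^sub>\<mu>)
    show "G \<in> borel_measurable R\<^sub>\<mu>"
      using bounded_measurableD(1)[OF G] by (simp add: sets_R\<^sub>\<mu> cong: measurable_cong_sets)
    show "\<bar>G \<omega>\<bar> \<le> C" if "\<omega> \<in> space R\<^sub>\<mu>" for \<omega>
      using C that sets_eq_imp_space_eq[OF sets_R\<^sub>\<mu>] by simp
  qed
  ultimately show "ereal (dual_functional X a M B T \<alpha> \<mu> \<pi> p \<eta>) \<le> rel_entropy Q R\<^sub>\<mu>" by simp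
qed

text \<open>By Jensen's inequality, a bound on the dual functional also bounds the functional with a single
  logarithm, to which the abstract existence theorem applies.\<close>

lemma cond_entropy_inf_le:
  assumes s: "\<And>p \<eta>. p \<in> Bp \<Longrightarrow> \<eta> \<in> B\<eta> \<Longrightarrow> dual_functional X a M B T \<alpha> \<mu> \<pi> p \<eta> \<le> s"
  shows "cond_entropy_inf X a M B T \<mu> \<pi> \<le> ereal s"
proof -
  have sp: "space R\<^sub>\<mu> = paths X" using sets_eq_imp_space_eq[OF sets_R\<^sub>\<mu>] by (simp add: space_path_space)
  \<comment> \<open>Equality is only required on paths: off the path space the integrals in \<open>path_fun\<close> may take
    junk values, which spoils linearity.\<close>
  define C where "C = {(F, constraint p \<eta>) |F p \<eta>. p \<in> Bp \<and> \<eta> \<in> B\<eta> \<and> (\<forall>\<omega>\<in>paths X. F \<omega> = path_fun p \<eta> \<omega>)}"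
  have C_I: "(path_fun p \<eta>, constraint p \<eta>) \<in> C" if "p \<in> Bp" "\<eta> \<in> B\<eta>" for p \<eta>
    using that by (auto simp: C_def)
  interpret entropic_dual R\<^sub>\<mu> C s
  proof unfold_locales
    fix F l assume "(F, l) \<in> C"
    then obtain p \<eta> where p: "p \<in> Bp" and \<eta>: "\<eta> \<in> B\<eta>" and F: "\<forall>\<omega>\<in>paths X. F \<omega> = path_fun p \<eta> \<omega>" and l: "l = constraint p \<eta>"
      by (auto simp: C_def)
    have "path_fun p \<eta> \<in> borel_measurable R\<^sub>\<mu>"
      using bounded_measurableD(1)[OF path_fun_bounded_measurable[OF p \<eta>]] by (simp add: sets_R\<^sub>\<mu> cong: measurable_cong_sets)
    then show "F \<in> borel_measurable R\<^sub>\<mu>"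
      using F sp by (subst measurable_cong) auto
    obtain K where bnd: "\<forall>\<omega>\<in>paths X. \<bar>path_fun p \<eta> \<omega>\<bar> \<le> K" using path_fun_bounded[OF p \<eta>] ..
    have K: "exp (- K) \<le> partition_function p \<eta> x" "partition_function p \<eta> x \<le> exp K"
      if "x \<in> range (proj X)" for x
      using partition_function_bounds[OF p \<eta> _ that] bnd by auto
    from bnd show "\<exists>K. \<forall>\<omega>\<in>space R\<^sub>\<mu>. \<bar>F \<omega>\<bar> \<le> K" using F sp by auto
    let ?E = "\<integral>\<omega>. exp (F \<omega>) \<partial>R\<^sub>\<mu>"
    have "?E = (\<integral>\<omega>. exp (path_fun p \<eta> \<omega>) \<partial>R\<^sub>\<mu>)"
      using F sp by (intro Bochner_Integration.integral_cong) auto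
    then have E: "?E = (\<integral>x. partition_function p \<eta> x \<partial>\<mu>\<^sub>0)"
      by (simp add: integral_R\<^sub>\<mu>[OF exp_path_fun_bounded_measurable[OF p \<eta>]] partition_function_def)
    have int: "integrable \<mu>\<^sub>0 (partition_function p \<eta>)"
    proof (rule \<mu>\<^sub>0.integrable_bounded_measurable[OF _ sets_\<mu>\<^sub>0], rule bounded_measurableI)
      fix x :: "real ^ 'n" assume "x \<in> space (borelX X)"
      then have x: "x \<in> range (proj X)" by (simp add: space_borelX)
      then show "\<bar>partition_function p \<eta> x\<bar> \<le> exp K" using K[OF x] partition_pos[OF p \<eta> x] by simp
    qed (rule measurable_partition[OF p \<eta>])
    have int_ln: "integrable \<mu>\<^sub>0 (\<lambda>x. ln (partition_function p \<eta> x))"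
      by (rule \<mu>\<^sub>0.integrable_bounded_measurable[OF ln_partition_bounded_measurable[OF p \<eta>] sets_\<mu>\<^sub>0])
    have "(\<integral>x. exp (- K) \<partial>\<mu>\<^sub>0) \<le> ?E"
      unfolding E using int K by (intro integral_mono) (auto simp: space_\<mu>\<^sub>0)
    then have E_pos: "0 < ?E" by (simp add: \<mu>\<^sub>0.prob_space less_le_trans[OF exp_gt_zero])
    \<comment> \<open>Jensen's inequality by the tangent line of \<open>ln\<close> at
      \<open>?E\<close>: as \<open>?E\<close> is the mean of the partition function, the linear
      correction integrates to zero.\<close>
    have "(\<integral>x. ln (partition_function p \<eta> x) \<partial>\<mu>\<^sub>0) \<le> (\<integral>x. ln ?E + (partition_function p \<eta> x / ?E - 1) \<partial>\<mu>\<^sub>0)"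
    proof (rule integral_mono[OF int_ln])
      fix x assume "x \<in> space \<mu>\<^sub>0"
      then have Z: "0 < partition_function p \<eta> x" using partition_pos[OF p \<eta>] by (simp add: space_\<mu>\<^sub>0)
      have "ln (partition_function p \<eta> x / ?E) \<le> partition_function p \<eta> x / ?E - 1"
        using Z E_pos by (intro ln_le_minus_one) simp
      then show "ln (partition_function p \<eta> x) \<le> ln ?E + (partition_function p \<eta> x / ?E - 1)"
        using Z E_pos by (simp add: ln_divide_pos)
    qed (use int in auto)
    also have "\<dots> = ln ?E"
      using int E_pos by (simp add: \<mu>\<^sub>0.prob_space E[symmetric])
    finally show "l - ln ?E \<le> s"
      using s[OF p \<eta>] by (simp add: dual_functional_eq[OF p \<eta>] l)
  next
    fix c :: real
    have p: "(\<lambda>_. 0) \<in> Bp" and \<eta>: "(\<lambda>_. c) \<in> B\<eta>"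
      by (auto intro!: bounded_measurableI[where K=0] bounded_measurableI[where K="\<bar>c\<bar>"])
    have "path_fun (\<lambda>_. 0) (\<lambda>_. c) = (\<lambda>_. c)" "constraint (\<lambda>_. 0) (\<lambda>_. c) = c"
      by (auto simp: path_fun_def constraint_def \<pi>.prob_space)
    with C_I[OF p \<eta>] show "(\<lambda>_. c, c) \<in> C" by simp
  next
    fix F l G m and c d :: real assume F: "(F, l) \<in> C" and G: "(G, m) \<in> C"
    obtain p \<eta> where p: "p \<in> Bp" "\<eta> \<in> B\<eta>" "\<forall>\<omega>\<in>paths X. F \<omega> = path_fun p \<eta> \<omega>" "l = constraint p \<eta>"
      using F by (auto simp: C_def)
    obtain p' \<eta>' where p': "p' \<in> Bp" "\<eta>' \<in> B\<eta>" "\<forall>\<omega>\<in>paths X. G \<omega> = path_fun p' \<eta>' \<omega>" "m = constraint p' \<eta>'"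
      using G by (auto simp: C_def)
    show "(\<lambda>\<omega>. c * F \<omega> + d * G \<omega>, c * l + d * m) \<in> C"
      unfolding C_def
      using p p' bounded_measurable_linear[OF p(1) p'(1), of c d] bounded_measurable_linear[OF p(2) p'(2), of c d]
        path_fun_linear[OF p(1) p'(1)] constraint_linear[OF p(1) p'(1) p(2) p'(2)]
      by (intro CollectI exI[of _ "\<lambda>z. c * p z + d * p' z"] exI[of _ "\<lambda>w. c * \<eta> w + d * \<eta>' w"] exI conjI) auto
  qed
  obtain Q where Q: "prob_space Q" "sets Q = sets R\<^sub>\<mu>" "rel_entropy Q R\<^sub>\<mu> \<le> ereal s"
    "\<And>F l. (F, l) \<in> C \<Longrightarrow> (\<integral>\<omega>. F \<omega> \<partial>Q) = l"
    using exists_prob_with_expectations by blast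
  \<comment> \<open>In particular, the finite bound \<open>s\<close> forces the admissible set to be
    nonempty.\<close>
  have "Q \<in> admissible X T \<mu> \<pi>"
    using Q(1,2) Q(4)[OF C_I] sets_R\<^sub>\<mu> by (intro admissibleI_expectations) auto
  then show ?thesis
    unfolding cond_entropy_inf_def using Q(3) by (rule INF_lower2)
qed

text \<open>Dominated convergence at three levels: in time, in the path and in the starting point.
  The common bound \<open>K + L\<close> keeps the partition functions between
  \<open>exp (- (K + L))\<close> and \<open>exp (K + L)\<close>, so their logarithms stay bounded
  too.\<close>

lemma bp_tendsto_dual_functional:
  assumes p: "\<And>k. ps k \<in> Bp" "bp_tendsto p_space ps p" and \<eta>: "\<And>k. \<eta>s k \<in> B\<eta>" "bp_tendsto \<eta>_space \<eta>s \<eta>"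
  shows "(\<lambda>k. dual_functional X a M B T \<alpha> \<mu> \<pi> (ps k) (\<eta>s k)) \<longlonglongrightarrow> dual_functional X a M B T \<alpha> \<mu> \<pi> p \<eta>"
proof -
  note pm = p(1)[THEN bounded_measurableD(1)] and \<eta>m = \<eta>(1)[THEN bounded_measurableD(1)]
  have pB: "p \<in> Bp" by (rule bp_tendsto_bounded_measurable[OF pm p(2)])
  have \<eta>B: "\<eta> \<in> B\<eta>" by (rule bp_tendsto_bounded_measurable[OF \<eta>m \<eta>(2)])
  obtain K where K: "\<And>k z. z \<in> space p_space \<Longrightarrow> \<bar>ps k z\<bar> \<le> K" and p_lim: "\<And>z. z \<in> space p_space \<Longrightarrow> (\<lambda>k. ps k z) \<longlonglongrightarrow> p z"
    using p(2) by (auto simp: bp_tendsto_def)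
  obtain L where L: "\<And>k w. w \<in> space \<eta>_space \<Longrightarrow> \<bar>\<eta>s k w\<bar> \<le> L" and \<eta>_lim: "\<And>w. w \<in> space \<eta>_space \<Longrightarrow> (\<lambda>k. \<eta>s k w) \<longlonglongrightarrow> \<eta> w"
    using \<eta>(2) by (auto simp: bp_tendsto_def)
  have pf_bound: "\<bar>path_fun (ps k) (\<eta>s k) \<omega>\<bar> \<le> K + L" if "\<omega> \<in> paths X" for k \<omega>
    by (rule path_fun_bound[OF pm K L that])
  have pf_lim: "(\<lambda>k. path_fun (ps k) (\<eta>s k) \<omega>) \<longlonglongrightarrow> path_fun p \<eta> \<omega>" if \<omega>: "\<omega> \<in> paths X" for \<omega>
    unfolding path_fun_def
  proof (rule tendsto_add)
    show "(\<lambda>k. \<integral>t. ps k (t, \<omega> t) \<partial>\<alpha>) \<longlonglongrightarrow> (\<integral>t. p (t, \<omega> t) \<partial>\<alpha>)"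
    proof (rule integral_dominated_convergence[where w="\<lambda>_. K"])
      show "(\<lambda>t. p (t, \<omega> t)) \<in> borel_measurable \<alpha>" "(\<lambda>t. ps k (t, \<omega> t)) \<in> borel_measurable \<alpha>" for k
        using measurable_along_path[OF _ \<omega>] pm bounded_measurableD(1)[OF pB] by auto
    qed (use K p_lim path_in_p_space[OF \<omega>] in \<open>auto simp: space_\<alpha>\<close>)
    show "(\<lambda>k. \<eta>s k (\<omega> 0, \<omega> 1)) \<longlonglongrightarrow> \<eta> (\<omega> 0, \<omega> 1)" by (rule \<eta>_lim[OF path_in_\<eta>_space[OF \<omega>]])
  qed
  have exp_bp: "bp_tendsto (path_space X) (\<lambda>k \<omega>. exp (path_fun (ps k) (\<eta>s k) \<omega>)) (\<lambda>\<omega>. exp (path_fun p \<eta> \<omega>))"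
    unfolding bp_tendsto_def using pf_bound pf_lim
    by (intro conjI exI[of _ "exp (K + L)"]) (auto simp: space_path_space abs_le_iff intro!: tendsto_exp)
  have Z_lim: "(\<lambda>k. partition_function (ps k) (\<eta>s k) x) \<longlonglongrightarrow> partition_function p \<eta> x" if x: "x \<in> range (proj X)" for x
    unfolding partition_function_def
    by (rule prob_space.bp_tendsto_expectation[OF bm_law_space(1)[OF x] _ exp_bp bm_law_space(2)[OF x]])
      (rule bounded_measurableD(1)[OF exp_path_fun_bounded_measurable[OF p(1) \<eta>(1)]])
  have ln_bp: "bp_tendsto (borelX X) (\<lambda>k x. ln (partition_function (ps k) (\<eta>s k) x)) (\<lambda>x. ln (partition_function p \<eta> x))"
    unfolding bp_tendsto_def
  proof (intro conjI exI[of _ "K + L"] allI ballI)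
    fix x :: "real ^ 'n" assume "x \<in> space (borelX X)"
    then have x: "x \<in> range (proj X)" by (simp add: space_borelX)
    show "(\<lambda>k. ln (partition_function (ps k) (\<eta>s k) x)) \<longlonglongrightarrow> ln (partition_function p \<eta> x)"
      using Z_lim[OF x] partition_pos[OF pB \<eta>B x] by (intro tendsto_ln) auto
    fix k
    show "\<bar>ln (partition_function (ps k) (\<eta>s k) x)\<bar> \<le> K + L"
      by (rule abs_ln_partition_le[OF p(1) \<eta>(1) pf_bound x])
  qed
  have "(\<lambda>k. \<integral>x. ln (partition_function (ps k) (\<eta>s k) x) \<partial>\<mu>\<^sub>0) \<longlonglongrightarrow> (\<integral>x. ln (partition_function p \<eta> x) \<partial>\<mu>\<^sub>0)"
    by (rule \<mu>\<^sub>0.bp_tendsto_expectation[OF _ ln_bp sets_\<mu>\<^sub>0])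
      (rule bounded_measurableD(1)[OF ln_partition_bounded_measurable[OF p(1) \<eta>(1)]])
  moreover have "(\<lambda>k. constraint (ps k) (\<eta>s k)) \<longlonglongrightarrow> constraint p \<eta>"
    unfolding constraint_def
    by (intro tendsto_add mu_alpha.bp_tendsto_expectation[OF pm p(2) sets_mu_alpha]
        \<pi>.bp_tendsto_expectation[OF \<eta>m \<eta>(2) sets_\<pi>])
  ultimately show ?thesis
    unfolding dual_functional_eq[OF p(1) \<eta>(1)] dual_functional_eq[OF pB \<eta>B] by (intro tendsto_diff)
qed

text \<open>A bound on the dual functional over \<open>A\<close> extends to all bounded measurable
  pairs, because its sublevel sets are \<open>bp_closed\<close>; \<open>cond_entropy_inf_le\<close>
  then turns it into a bound on the infimum.\<close>

theorem dual_equality: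
  assumes A: "bp_dense p_space \<eta>_space A"
  shows "cond_entropy_inf X a M B T \<mu> \<pi> = (SUP (p, \<eta>)\<in>A. ereal (dual_functional X a M B T \<alpha> \<mu> \<pi> p \<eta>))"
    (is "?J = ?S")
proof (rule antisym)
  have sub: "A \<subseteq> Bp \<times> B\<eta>"
    and dense: "\<And>S. A \<subseteq> S \<Longrightarrow> bp_closed p_space \<eta>_space S \<Longrightarrow> Bp \<times> B\<eta> \<subseteq> S"
    using A by (auto simp: bp_dense_def)
  show "?S \<le> ?J"
    using sub by (intro SUP_least) (auto intro!: dual_functional_le_cond_entropy_inf)
  show "?J \<le> ?S"
  proof (cases ?S)
    case (real s)
    define S where "S = {(p, \<eta>). p \<in> Bp \<and> \<eta> \<in> B\<eta> \<and> dual_functional X a M B T \<alpha> \<mu> \<pi> p \<eta> \<le> s}"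
    have "A \<subseteq> S"
    proof
      fix x assume x: "x \<in> A"
      obtain p \<eta> where [simp]: "x = (p, \<eta>)" by (cases x)
      have "ereal (dual_functional X a M B T \<alpha> \<mu> \<pi> p \<eta>) \<le> ?S"
        using x by (intro SUP_upper2[of x]) auto
      then show "x \<in> S" using x sub by (auto simp: S_def real)
    qed
    moreover have "bp_closed p_space \<eta>_space S"
      unfolding bp_closed_def
    proof (intro allI impI, elim conjE)
      fix ps \<eta>s p \<eta>
      assume S: "\<forall>k. (ps k, \<eta>s k) \<in> S" and lim: "bp_tendsto p_space ps p" "bp_tendsto \<eta>_space \<eta>s \<eta>"
      then have B: "\<And>k. ps k \<in> Bp" "\<And>k. \<eta>s k \<in> B\<eta>"
        and le: "\<And>k. dual_functional X a M B T \<alpha> \<mu> \<pi> (ps k) (\<eta>s k) \<le> s"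
        by (auto simp: S_def)
      have "dual_functional X a M B T \<alpha> \<mu> \<pi> p \<eta> \<le> s"
        using bp_tendsto_dual_functional[OF B(1) lim(1) B(2) lim(2)] le by (intro LIMSEQ_le_const2) auto
      then show "(p, \<eta>) \<in> S"
        using bp_tendsto_bounded_measurable[OF B(1)[THEN bounded_measurableD(1)] lim(1)]
          bp_tendsto_bounded_measurable[OF B(2)[THEN bounded_measurableD(1)] lim(2)] by (simp add: S_def)
    qed
    ultimately have "Bp \<times> B\<eta> \<subseteq> S" by (rule dense)
    then have "?J \<le> ereal s" by (intro cond_entropy_inf_le) (auto simp: S_def)
    then show ?thesis by (simp only: real)
  next
    case MInf
    \<comment> \<open>The supremum over an empty class is \<open>-\<infinity>\<close>. Density
      excludes this case, since the empty set is \<open>bp_closed\<close>.\<close>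
    have "A \<noteq> {}"
    proof
      assume "A = {}"
      then have "Bp \<times> B\<eta> \<subseteq> {}" by (intro dense) (auto simp: bp_closed_def)
      moreover have "((\<lambda>_. 0), (\<lambda>_. 0)) \<in> Bp \<times> B\<eta>" by (auto intro!: bounded_measurableI[where K=0])
      ultimately show False by blast
    qed
    then obtain x where x: "x \<in> A" by auto
    have "ereal (dual_functional X a M B T \<alpha> \<mu> \<pi> (fst x) (snd x)) \<le> ?S"
      using x by (intro SUP_upper2[of x]) (auto simp: split_beta)
    with MInf show ?thesis by simp
  qed simp
qed

section \<open>Splitting off the entropy of the initial law\<close>

lemma rel_entropy_admissible:
  assumes meaningful: "entropy_meaningful \<mu>\<^sub>0 (vol X)" and adm: "Q \<in> admissible X T \<mu> \<pi>"
  shows "rel_entropy Q (bm_mix X a M B (vol X)) = rel_entropy \<mu>\<^sub>0 (vol X) + rel_entropy Q R\<^sub>\<mu>"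
proof -
  let ?R = "bm_mix X a M B (vol X)"
  note sets_R = sets_bm_mix[OF bm sets_vol, of X a]
  have Q: "prob_space Q" "sets Q = sets (path_space X)"
    using adm by (auto simp: admissible_def space_prob_algebra)
  have Q0: "distr Q (borelX X) (\<lambda>\<omega>. \<omega> 0) = \<mu>\<^sub>0"
    using admissible_marg_0[OF adm] by (simp add: marg_def)
  have R0: "distr ?R (borelX X) (\<lambda>\<omega>. \<omega> 0) = vol X"
    using marg_0_bm_mix[OF bm sets_vol] by (simp add: marg_def)
  have start: "(\<lambda>\<omega>. \<omega> 0) \<in> path_space X \<rightarrow>\<^sub>M borelX X" by (rule measurable_coordinate) simp
  have start_R: "(\<lambda>\<omega>. \<omega> 0) \<in> ?R \<rightarrow>\<^sub>M borelX X" and start_Q: "(\<lambda>\<omega>. \<omega> 0) \<in> Q \<rightarrow>\<^sub>M borelX X"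
    using start measurable_cong_sets[OF sets_R refl] measurable_cong_sets[OF Q(2) refl] by blast+
  show ?thesis
  proof (cases "absolutely_continuous (vol X) \<mu>\<^sub>0")
    case True
    interpret vol: sigma_finite_measure "vol X" by (rule sigma_finite_vol)
    obtain f :: "real ^ 'n \<Rightarrow> real" where f: "f \<in> borel_measurable (vol X)" "\<And>x. 0 \<le> f x" "\<mu>\<^sub>0 = density (vol X) f"
      using vol.obtain_real_density[OF True _ \<mu>\<^sub>0.finite_measure_axioms] sets_\<mu>\<^sub>0 sets_vol by blast
    have f_meas: "f \<in> borel_measurable (borelX X)"
      using f(1) measurable_cong_sets[OF sets_vol refl] by blast
    have "rel_entropy Q ?R = rel_entropy \<mu>\<^sub>0 (distr ?R (borelX X) (\<lambda>\<omega>. \<omega> 0)) + rel_entropy Q R\<^sub>\<mu>"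
    proof (rule rel_entropy_reweighted_marginal[OF start_R _ _ Q(1) _ Q0 f_meas f(2)])
      show "sigma_finite_measure ?R" by (rule sigma_finite_bm_mix[OF bm sets_vol sigma_finite_vol])
      show "sigma_finite_measure (distr ?R (borelX X) (\<lambda>\<omega>. \<omega> 0))" unfolding R0 by (rule sigma_finite_vol)
      show "sets Q = sets ?R" by (simp add: Q(2) sets_R)
      show "\<mu>\<^sub>0 = density (distr ?R (borelX X) (\<lambda>\<omega>. \<omega> 0)) f" unfolding R0 by (rule f(3))
      show "R\<^sub>\<mu> = density ?R (\<lambda>\<omega>. f (\<omega> 0))"
        unfolding f(3) by (rule density_bm_mix[OF bm sets_vol]) (use f_meas in simp)
      show "prob_space R\<^sub>\<mu>" by (rule R\<^sub>\<mu>.prob_space_axioms)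
      show "entropy_meaningful \<mu>\<^sub>0 (distr ?R (borelX X) (\<lambda>\<omega>. \<omega> 0))" unfolding R0 by (rule meaningful)
    qed
    then show ?thesis by (simp only: R0)
  next
    case False
    \<comment> \<open>Absolute continuity would descend to the laws at time \<open>0\<close>. Hence
      the left-hand side is infinite, and so is the right-hand side, whose second summand is
      nonnegative.\<close>
    have "\<not> absolutely_continuous ?R Q"
    proof
      assume ac: "absolutely_continuous ?R Q"
      have "null_sets (vol X) \<subseteq> null_sets \<mu>\<^sub>0"
      proof
        fix A :: "(real ^ 'n) set" assume "A \<in> null_sets (vol X)"
        then have "A \<in> null_sets (distr ?R (borelX X) (\<lambda>\<omega>. \<omega> 0))" by (simp only: R0)
        then have A: "A \<in> sets (borelX X)" "(\<lambda>\<omega>. \<omega> 0) -` A \<inter> space ?R \<in> null_sets ?R"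
          using null_sets_distr_iff[OF start_R] by auto
        have "(\<lambda>\<omega>. \<omega> 0) -` A \<inter> space ?R \<in> null_sets Q"
          using A(2) ac by (auto simp: absolutely_continuous_def)
        moreover have "space ?R = space Q" by (rule sets_eq_imp_space_eq) (simp add: Q(2) sets_R)
        ultimately have "A \<in> null_sets (distr Q (borelX X) (\<lambda>\<omega>. \<omega> 0))"
          using null_sets_distr_iff[OF start_Q] A(1) by simp
        then show "A \<in> null_sets \<mu>\<^sub>0" by (simp only: Q0)
      qed
      with False show False by (simp add: absolutely_continuous_def)
    qed
    moreover have "0 \<le> rel_entropy Q R\<^sub>\<mu>"
      by (rule rel_entropy_nonneg[OF Q(1) R\<^sub>\<mu>.prob_space_axioms]) (simp add: Q(2) sets_R\<^sub>\<mu>)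
    ultimately show ?thesis using False by (simp add: rel_entropy_def)
  qed
qed

theorem entropy_decomposition:
  assumes meaningful: "entropy_meaningful \<mu>\<^sub>0 (vol X)"
  shows "(INF Q\<in>admissible X T \<mu> \<pi>. rel_entropy Q (bm_mix X a M B (vol X)))
    = rel_entropy \<mu>\<^sub>0 (vol X) + cond_entropy_inf X a M B T \<mu> \<pi>"
proof -
  have not_MInf: "rel_entropy \<mu>\<^sub>0 (vol X) \<noteq> -\<infinity>"
  proof (cases "absolutely_continuous (vol X) \<mu>\<^sub>0")
    case True
    then have "(\<integral>\<^sup>+x. ennreal (- entropy_density (exp 1) (vol X) \<mu>\<^sub>0 x) \<partial>\<mu>\<^sub>0) < \<infinity>"
      using meaningful by (simp add: entropy_meaningful_def)
    then obtain r where "0 \<le> r" "(\<integral>\<^sup>+x. ennreal (- entropy_density (exp 1) (vol X) \<mu>\<^sub>0 x) \<partial>\<mu>\<^sub>0) = ennreal r"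
      by (cases "\<integral>\<^sup>+x. ennreal (- entropy_density (exp 1) (vol X) \<mu>\<^sub>0 x) \<partial>\<mu>\<^sub>0" rule: ennreal_cases) auto
    then show ?thesis
      using True by (cases "\<integral>\<^sup>+x. ennreal (entropy_density (exp 1) (vol X) \<mu>\<^sub>0 x) \<partial>\<mu>\<^sub>0" rule: ennreal_cases)
        (auto simp: rel_entropy_def)
  qed (simp add: rel_entropy_def)
  have nonneg: "0 \<le> rel_entropy Q R\<^sub>\<mu>" if "Q \<in> admissible X T \<mu> \<pi>" for Q
    using that by (intro rel_entropy_nonneg R\<^sub>\<mu>.prob_space_axioms)
      (auto simp: admissible_def space_prob_algebra sets_R\<^sub>\<mu>)
  show ?thesis
  proof (cases "admissible X T \<mu> \<pi> = {}")
    \<comment> \<open>An infimum over the empty set is \<open>\<infinity>\<close> and absorbs the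
      constant, which is not \<open>-\<infinity>\<close>. Pulling the constant out of the infimum
      requires a nonempty index set, hence the case distinction.\<close>
    case True
    then show ?thesis
      using not_MInf by (cases "rel_entropy \<mu>\<^sub>0 (vol X)") (simp_all add: cond_entropy_inf_def top_ereal_def)
  next
    case False
    have "(INF Q\<in>admissible X T \<mu> \<pi>. rel_entropy Q (bm_mix X a M B (vol X)))
        = (INF Q\<in>admissible X T \<mu> \<pi>. rel_entropy \<mu>\<^sub>0 (vol X) + rel_entropy Q R\<^sub>\<mu>)"
      by (intro INF_cong refl rel_entropy_admissible[OF meaningful])
    also have "\<dots> = rel_entropy \<mu>\<^sub>0 (vol X) + (INF Q\<in>admissible X T \<mu> \<pi>. rel_entropy Q R\<^sub>\<mu>)"
      using False not_MInf nonneg by (intro INF_ereal_add_right) auto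
    finally show ?thesis by (simp add: cond_entropy_inf_def)
  qed
qed

end

theorem proposition2p3:
  fixes X :: flat_space
    and a :: real
    and M :: "'w measure"
    and B :: "real \<Rightarrow> 'w \<Rightarrow> real ^ 'n"
    and T :: "real set"
    and \<pi> :: "((real ^ 'n) \<times> (real ^ 'n)) measure"
    and \<mu> :: "real \<Rightarrow> (real ^ 'n) measure"
    and \<alpha> :: "real measure"
  assumes "a > 0"
    and "standard_bm M B"
    and "T \<in> sets borel" and "T \<subseteq> {0..1}"
    and "\<pi> \<in> space (prob_algebra (borelX X \<Otimes>\<^sub>M borelX X))"
    and "\<forall>t\<in>T. \<mu> t \<in> space (prob_algebra (borelX X))"
    and "weakly_continuous_on X T \<mu>"
    and "\<alpha> \<in> space (prob_algebra (restrict_space borel T))"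
    and "msupport \<alpha> = T"
    and "entropy_meaningful (initial_marginal X T \<mu> \<pi>) (marg X (bm_mix X a M B (vol X)) 0)"
  shows "(INF Q\<in>admissible X T \<mu> \<pi>. rel_entropy Q (bm_mix X a M B (vol X)))
           = rel_entropy (initial_marginal X T \<mu> \<pi>) (marg X (bm_mix X a M B (vol X)) 0)
             + cond_entropy_inf X a M B T \<mu> \<pi>
       \<and> (\<forall>A. bp_dense (time_space X T) (borelX X \<Otimes>\<^sub>M borelX X) A \<longrightarrow>
            cond_entropy_inf X a M B T \<mu> \<pi>
              = (SUP (p, \<eta>)\<in>A. ereal (dual_functional X a M B T \<alpha> \<mu> \<pi> p \<eta>)))"
proof -
  interpret entropic_problem X a M B T \<pi> \<mu> \<alpha>
    using assms by unfold_locales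
  \<comment> \<open>The statement refers to the initial law of \<open>R\<close> as a marginal; it is
    the volume measure.\<close>
  have R0: "marg X (bm_mix X a M B (vol X)) 0 = vol X"
    by (rule marg_0_bm_mix[OF assms(2) sets_vol])
  show ?thesis
    using entropy_decomposition dual_equality assms(10) unfolding R0 by blast
qed

end
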